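(* Let $r\in(0,\infty)$. Suppose that $\alpha\in(0,n)$, $p\in(1,\frac n\alpha)$, and $q\in(1,\infty)$ satisfy $\frac1q=\frac1p-\frac\alpha n$. Then, for any $w\in A^{\mathrm{loc}}_{p,q}(r)$, $$\left\|I_{\alpha,r}\right\|_{L^p(w^{\frac pq})\to L^q(w)}\le C\,[w]_{A^{\mathrm{loc}}_{p,q}(r)}^{(1-\frac\alpha n)\max(1,\frac{p'}{q})},$$ where the positive constant $C$ is independent of $r$ and $w$.
   Context: Cubes in $\mathbb{R}^n$ have edges parallel to the coordinate axes; $\ell(Q)$ is the edge length of $Q$; $\fint_Q f:=\frac1{|Q|}\int_Q f$; $p':=\frac{p}{p-1}$. Constants may depend on $n,\alpha,p,q$. A scalar weight is a non-negative locally integrable function on $\mathbb{R}^n$ taking values in $(0,\infty)$ almost everywhere. $A^{\mathrm{loc}}_{p,q}(r)$ is the set of all scalar weights $w$ with $$[w]_{A^{\mathrm{loc}}_{p,q}(r)}:=\sup_{\mathrm{cubes}\ Q:\ \ell(Q)\le r}\fint_Q w(x)\,dx\left\{\fint_Q[w(x)]^{-\frac{p'}{q}}\,dx\right\}^{\frac q{p'}}<\infty.$$ For $s\in(1,\infty)$ and a scalar weight $u$, $\|f\|_{L^s(u)}:=[\int_{\mathbb{R}^n}|f(x)|^su(x)\,dx]^{1/s}$. The local fractional integral operator is defined, for bounded $f$ with compact support and $x\in\mathbb{R}^n$, by $$I_{\alpha,r}f(x):=\int_{Q(x,r)}\frac{f(y)}{|x-y|^{n-\alpha}}\,dy,$$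 where $Q(x,r)$ is the cube centered at $x$ with edge length $2r$. Bounded compactly supported functions are dense in $L^p(w^{p/q})$, and the operator norm refers to the estimate on this dense class (equivalently, to the bounded extension). *)

theory Defs
  imports "HOL-Analysis.Analysis"
begin

definition conj_exp :: "real \<Rightarrow> real" where
  "conj_exp p = p / (p - 1)"

text \<open>Power of an extended nonnegative number; only used with exponents \<open>a > 0\<close>,
  where \<open>\<infinity>\<^sup>a = \<infinity>\<close> and \<open>0\<^sup>a = 0\<close>.\<close>

definition epowr :: "ennreal \<Rightarrow> real \<Rightarrow> ennreal" where
  "epowr x a = (if x = top then top else ennreal (enn2real x powr a))"

text \<open>The cube with centre \<open>x\<close> and edge length \<open>2 * t\<close>. Cubes are taken closed; the integrals
  below do not see the boundary.\<close>

definition cube :: "real ^ 'n \<Rightarrow> real \<Rightarrow> (real ^ 'n) set" where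
  "cube x t = cbox (x - vec t) (x + vec t)"

definition eavg :: "(real ^ 'n) set \<Rightarrow> (real ^ 'n \<Rightarrow> real) \<Rightarrow> ennreal" where
  "eavg Q f = (\<integral>\<^sup>+ x \<in> Q. ennreal (f x) \<partial>lebesgue) / emeasure lebesgue Q"

definition scalar_weight :: "(real ^ 'n \<Rightarrow> real) \<Rightarrow> bool" where
  "scalar_weight w \<longleftrightarrow>
     (\<forall>x. 0 \<le> w x) \<and>
     (\<forall>K. compact K \<longrightarrow> set_integrable lebesgue K w) \<and>
     (AE x in lebesgue. 0 < w x)"

text \<open>The constant is extended-valued, so that the supremum is meaningful for every weight. Since
  \<open>0 powr a = 0\<close>, the integrand \<open>w x powr (- p' / q)\<close> is \<open>0\<close> rather than \<open>\<infinity>\<close> where \<open>w x = 0\<close>, which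
  for a weight happens only on a null set.\<close>

definition Aloc_const ::
    "real \<Rightarrow> real \<Rightarrow> real \<Rightarrow> (real ^ 'n \<Rightarrow> real) \<Rightarrow> ennreal" where
  "Aloc_const p q r w =
     (SUP Q \<in> {cube x t | x t. 0 < t \<and> 2 * t \<le> r}.
        eavg Q w * epowr (eavg Q (\<lambda>x. w x powr (- conj_exp p / q))) (q / conj_exp p))"

definition Aloc :: "real \<Rightarrow> real \<Rightarrow> real \<Rightarrow> (real ^ 'n \<Rightarrow> real) set" where
  "Aloc p q r = {w. scalar_weight w \<and> Aloc_const p q r w < top}"

definition weighted_Lnorm ::
    "real \<Rightarrow> (real ^ 'n \<Rightarrow> real) \<Rightarrow> (real ^ 'n \<Rightarrow> complex) \<Rightarrow> ennreal" where
  "weighted_Lnorm s u f =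
     epowr (\<integral>\<^sup>+ x. ennreal (norm (f x) powr s * u x) \<partial>lebesgue) (1 / s)"

definition bounded_compact_support :: "(real ^ 'n \<Rightarrow> complex) set" where
  "bounded_compact_support =
     {f \<in> borel_measurable lebesgue. bounded (range f) \<and> compact (closure {x. f x \<noteq> 0})}"

text \<open>For bounded \<open>f\<close> the integral converges absolutely because \<open>\<alpha> > 0\<close>. At the single point
  \<open>y = x\<close> the integrand is \<open>0\<close> by the convention for division by zero.\<close>

definition local_frac_int ::
    "real \<Rightarrow> real \<Rightarrow> (real ^ 'n \<Rightarrow> complex) \<Rightarrow> real ^ 'n \<Rightarrow> complex" where
  "local_frac_int \<alpha> r f x =
     (LINT y : cube x r | lebesgue. f y /\<^sub>R (norm (x - y) powr (real CARD('n) - \<alpha>)))"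

text \<open>Operator norm of \<open>T\<close>, defined on the dense class of bounded functions with compact support,
  from \<open>L\<^sup>s(u)\<close> to \<open>L\<^sup>t(v)\<close>; it is \<open>\<infinity>\<close> if \<open>T\<close> is not bounded.\<close>

definition op_norm ::
    "real \<Rightarrow> (real ^ 'n \<Rightarrow> real) \<Rightarrow> real \<Rightarrow> (real ^ 'n \<Rightarrow> real) \<Rightarrow>
     ((real ^ 'n \<Rightarrow> complex) \<Rightarrow> real ^ 'n \<Rightarrow> complex) \<Rightarrow> ennreal" where
  "op_norm s u t v T =
     Inf {K. \<forall>f \<in> bounded_compact_support. weighted_Lnorm t v (T f) \<le> K * weighted_Lnorm s u f}"

end

theory Submission
  imports Defs
begin

text \<open>Write \<open>\<sigma> = w powr (- p' / q)\<close>, \<open>s = q / p'\<close>, and let \<open>V\<close>, \<open>U\<close> be the measures with densities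
  \<open>w\<close> and \<open>\<sigma>\<close>, \<open>A\<close> the weight constant, and \<open>\<Phi>\<close> the modulus of the argument of the operator. With \<open>f = \<Phi> / \<sigma>\<close> one has \<open>\<integral>\<^sub>Q \<Phi> = \<integral>\<^sub>Q f dU\<close> and
  \<open>\<integral> \<Phi>\<^sup>p w powr (p / q) = \<integral> f\<^sup>p dU\<close>, and \<open>1 - \<alpha> / n = 1 / q + 1 / p' = (1 + s) / q\<close>.
  The kernel, restricted to \<open>|x - y| \<le> r\<close> in the sup norm, is split into two parts.

  Far part, \<open>|x - y| \<ge> r / 3\<close>. The points lie in grid cells \<open>P\<close>, \<open>P'\<close> of edge \<open>r / 3\<close> which need not
  lie in one cube of edge \<open>r\<close>, but there is a cell \<open>P''\<close> between them that shares such a cube with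
  each of them. Multiplying the two Muckenhoupt bounds and dividing by \<open>V(P'') U(P'')\<^sup>s\<close>, which
  is at least \<open>|P''| powr (1 + s)\<close>, gives \<open>V(P) U(P')\<^sup>s \<le> C A\<^sup>2 r powr (n (1 + s))\<close>
  (lemma \<open>far_pair\<close>). The resulting operator norm is at most \<open>C A powr (2 / q)\<close>, and \<open>2 / q\<close> does
  not exceed the claimed exponent.

  Near part, \<open>|x - y| < r / 3\<close>. By the one-third trick it is dominated by the \<open>2\<^sup>n\<close> dyadic
  operators \<open>\<Sum>\<^sub>Q |Q| powr (\<alpha> / n - 1) (\<integral>\<^sub>Q \<Phi>) 1\<^sub>Q\<close>, where \<open>Q\<close> runs over the dyadic subcubes of a
  grid of edge \<open>r\<close> shifted by \<open>0\<close> or \<open>r / 3\<close> in each coordinate; all these cubes are admitted in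
  the local Muckenhoupt condition. Each dyadic operator is bounded by duality, from the bilinear form
  \<open>\<Sum>\<^sub>Q \<tau>\<^sub>Q \<langle>f\<rangle>\<^sub>Q \<langle>g\<rangle>\<^sub>Q\<close> with \<open>\<tau>\<^sub>Q = |Q| powr (- (1 + s) / q) U(Q) V(Q)\<close> and averages with respect to
  \<open>U\<close> and \<open>V\<close>. No sparse domination is needed; the argument works for every finite family of
  nested or disjoint sets that satisfy the Muckenhoupt condition and whose Lebesgue measure at least halves
  at each strict inclusion.

  Sort the cubes by the dyadic size \<open>B\<close> of \<open>V(Q) U(Q)\<^sup>s / |Q| powr (1 + s) \<in> [1, A]\<close>; the bounds for
  the classes will sum to a geometric series dominated by \<open>B \<approx> A\<close>. Within one class
  \<open>\<tau>\<^sub>Q \<approx> B powr (1 / q) U(Q) powr (1 / p) V(Q) powr (1 / q')\<close>, and \<open>\<tau>\<close> is also comparable to a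
  constant times \<open>|Q|\<^sup>a U(Q)\<^sup>b V(Q)\<^sup>c\<close> with \<open>a > 0\<close> and \<open>a + b + c > 1\<close>, so
  \<open>\<Sum>\<^bsub>Q' \<subseteq> Q\<^esub> \<tau>\<^bsub>Q'\<^esub> \<le> C \<tau>\<^sub>Q\<close>. Replace the averages by their running maxima \<open>F\<close>, \<open>G\<close> over the
  ancestors. Summation by parts along the tree of cubes bounds the form by \<open>\<Sum>\<^sub>Q \<tau>\<^sub>Q \<Delta>(F G)(Q)\<close>, \<open>\<Delta>\<close>
  being the increment from the parent, hence by two sums with \<open>\<Delta>F \<cdot> G\<close> and \<open>F \<cdot> \<Delta>G\<close>. In the first one
  use Hoelder with exponents \<open>p\<close>, \<open>p'\<close>: the factor with \<open>\<Delta>F\<close> is controlled by the maximal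
  inequality, and since \<open>p' > q'\<close> the other one is a sum of \<open>V(Q) powr (p' / q') G\<^bsup>p'\<^esup>\<close>, which is controlled by
  the maximal inequality and the decay \<open>V(P) \<le> (1 - c / B) V(Q)\<close> for \<open>P \<subset> Q\<close>; this costs
  \<open>B powr (1 / p')\<close>. Symmetrically the second sum costs \<open>B powr (1 / (s q))\<close>. The total exponent
  \<open>1 / q + max (1 / p') (1 / (s q))\<close> is \<open>(1 - \<alpha> / n) max 1 (p' / q)\<close>.\<close>

section \<open>Inequalities for real powers, and Hoelder's inequality\<close>

lemma young_powr:
  fixes x y p :: real
  assumes "1 < p" "0 \<le> x" "0 \<le> y"
  shows "p * x powr (p - 1) * y \<le> (p - 1) * x powr p + y powr p"
proof -
  have c: "1 / (p / (p - 1)) + 1 / p = 1" "p / (p - 1) > 1"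
    using assms by (auto simp: field_simps)
  have "x powr (p - 1) * y \<le> (x powr (p - 1)) powr (p / (p - 1)) / (p / (p - 1)) + y powr p / p"
    by (rule Youngs_inequality) (use assms c in auto)
  also have "(x powr (p - 1)) powr (p / (p - 1)) = x powr p"
    using assms by (simp add: powr_powr)
  finally have "p * (x powr (p - 1) * y) \<le> p * (x powr p / (p / (p - 1)) + y powr p / p)"
    using assms by (intro mult_left_mono) auto
  also have "\<dots> = (p - 1) * x powr p + y powr p"
    using assms by (simp add: field_simps)
  finally show ?thesis by (simp add: mult.assoc)
qed

lemma powr_diff_le_tangent:
  fixes a b p :: real
  assumes "1 \<le> p" "0 \<le> a" "a \<le> b"
  shows "b powr p - a powr p \<le> p * b powr (p - 1) * (b - a)"
proof (cases "p = 1")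
  case True then show ?thesis using assms by (cases "b = 0") auto
next
  case False
  then have "1 < p" using assms by auto
  from young_powr[OF this, of b a] assms have
    "p * b powr (p - 1) * a \<le> (p - 1) * b powr p + a powr p" by auto
  moreover have "b powr p = b powr (p - 1) * b"
    using assms by (cases "b = 0") (auto simp: powr_diff)
  ultimately show ?thesis by (simp add: algebra_simps)
qed

lemma powr_diff_le_conj:
  fixes a b p :: real
  assumes "1 < p" "0 \<le> a" "a \<le> b"
  shows "b powr p - a powr p \<le> p / (p - 1) * (b * (b powr (p - 1) - a powr (p - 1)))"
proof -
  have e: "u powr p = u powr (p - 1) * u" if "0 \<le> u" for u :: real
    using that by (cases "u = 0") (auto simp: powr_diff)
  from young_powr[OF assms(1), of a b] assms have
    "p * a powr (p - 1) * b \<le> (p - 1) * a powr p + b powr p" by auto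
  then have "(p - 1) * (b powr p - a powr p) \<le> p * (b * (b powr (p - 1) - a powr (p - 1)))"
    using e[of b] assms by (simp add: algebra_simps)
  then show ?thesis using assms by (simp add: field_simps)
qed

lemma diff_powr_le:
  fixes a b p :: real
  assumes "1 \<le> p" "0 \<le> a" "a \<le> b"
  shows "(b - a) powr p \<le> b powr p - a powr p"
proof -
  have e: "u powr p = u powr (p - 1) * u" if "0 \<le> u" for u :: real
    using that by (cases "u = 0") (auto simp: powr_diff)
  have "(b - a) powr p + a powr p = (b - a) powr (p - 1) * (b - a) + a powr (p - 1) * a"
    using e[of a] e[of "b - a"] assms by simp
  also have "\<dots> \<le> b powr (p - 1) * (b - a) + b powr (p - 1) * a"
    using assms by (intro add_mono mult_right_mono powr_mono2) auto
  also have "\<dots> = b powr p" using e[of b] assms by (simp add: algebra_simps)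
  finally show ?thesis by simp
qed

text \<open>Optimising the free scaling parameter in Young's inequality gives Hoelder's inequality; both the discrete and the integral version below are instances.\<close>
lemma scaled_young_imp_hoelder:
  fixes L X Y p p' :: real
  assumes "1 < p" "1 < p'" "1 / p + 1 / p' = 1" "0 \<le> X" "0 \<le> Y"
    and L: "\<And>c. 0 < c \<Longrightarrow> L \<le> c powr p * X / p + c powr (- p') * Y / p'"
  shows "L \<le> X powr (1 / p) * Y powr (1 / p')"
proof -
  have pp: "p + p' = p * p'" using assms by (simp add: field_simps)
  consider "X = 0 \<or> Y = 0" | "0 < X" "0 < Y" using assms by fastforce
  then show ?thesis
  proof cases
    case 2
    define c where "c = (Y / X) powr (1 / (p * p'))"
    have c0: "0 < c" using 2 by (simp add: c_def)
    have p1: "1 / p' = 1 - 1 / p" "1 / p = 1 - 1 / p'" using assms(3) by auto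
    have "c powr p = (Y / X) powr (1 / p')" using assms by (simp add: c_def powr_powr)
    then have 1: "c powr p * X = X powr (1 / p) * Y powr (1 / p')"
      using 2 by (simp add: p1(2) powr_divide powr_diff)
    have "c powr (- p') = (Y / X) powr (- 1 / p)" using assms by (simp add: c_def powr_powr)
    then have 3: "c powr (- p') * Y = X powr (1 / p) * Y powr (1 / p')"
      using 2 by (simp add: p1(1) powr_divide powr_diff powr_minus_divide)
    have "L \<le> c powr p * X / p + c powr (- p') * Y / p'" by (rule L[OF c0])
    also have "\<dots> = X powr (1 / p) * Y powr (1 / p') * (1 / p + 1 / p')"
      unfolding 1 3 by (simp add: algebra_simps)
    finally show ?thesis using assms by simp
  next
    case 1
    have "L \<le> 0"
    proof (rule ccontr)
      assume "\<not> L \<le> 0"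
      then have L0: "0 < L" by simp
      show False
      proof (cases "X = 0")
        case True
        define c where "c = (Y / L + 1) powr (1 / p')"
        have "0 < Y / L + 1" using L0 assms by (simp add: add_nonneg_pos)
        then have "0 < c" "c powr (- p') = 1 / (Y / L + 1)"
          using assms by (auto simp: c_def powr_powr powr_minus_divide)
        then have "L \<le> 1 / (Y / L + 1) * Y / p'" using L[of c] True by simp
        also have "\<dots> \<le> 1 / (Y / L + 1) * Y / 1"
          using assms L0 by (intro divide_left_mono) auto
        also have "\<dots> < L" using L0 assms by (simp add: field_simps add_pos_nonneg)
        finally show False by simp
      next
        case False
        then have Y: "Y = 0" and "0 < X" using 1 assms by auto
        define c where "c = (L / X) powr (1 / p)"
        have "0 < c" "c powr p = L / X" using assms L0 \<open>0 < X\<close> by (auto simp: c_def powr_powr)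
        then have "L \<le> L / p" using L[of c] Y \<open>0 < X\<close> by simp
        then show False using L0 assms(1) by (simp add: field_simps)
      qed
    qed
    then show ?thesis using 1 by auto
  qed
qed

lemma scaled_young:
  fixes a b c p p' :: real
  assumes "1 < p" "1 < p'" "1 / p + 1 / p' = 1" "0 \<le> a" "0 \<le> b" "0 < c"
  shows "a * b \<le> c powr p * a powr p / p + c powr (- p') * b powr p' / p'"
  using Youngs_inequality[OF assms(1-3), of "c * a" "b / c"] assms
  by (simp add: powr_mult powr_divide powr_minus_divide)

lemma hoelder_sum:
  fixes a b :: "'i \<Rightarrow> real"
  assumes "1 < p" "1 < p'" "1 / p + 1 / p' = 1"
    and "\<And>i. i \<in> I \<Longrightarrow> 0 \<le> a i" "\<And>i. i \<in> I \<Longrightarrow> 0 \<le> b i"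
  shows "(\<Sum>i\<in>I. a i * b i) \<le> (\<Sum>i\<in>I. a i powr p) powr (1 / p) * (\<Sum>i\<in>I. b i powr p') powr (1 / p')"
proof (rule scaled_young_imp_hoelder[OF assms(1-3)])
  fix c :: real assume "0 < c"
  then have "(\<Sum>i\<in>I. a i * b i) \<le> (\<Sum>i\<in>I. c powr p * a i powr p / p + c powr (- p') * b i powr p' / p')"
    by (intro sum_mono scaled_young assms)
  then show "(\<Sum>i\<in>I. a i * b i) \<le> c powr p * (\<Sum>i\<in>I. a i powr p) / p + c powr (- p') * (\<Sum>i\<in>I. b i powr p') / p'"
    by (simp add: sum.distrib sum_distrib_left sum_divide_distrib)
qed (auto intro: sum_nonneg)

lemma hoelder_integral:
  fixes f g :: "'a \<Rightarrow> real"
  assumes "1 < p" "1 < p'" "1 / p + 1 / p' = 1"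
    and [measurable]: "f \<in> borel_measurable M" "g \<in> borel_measurable M"
    and nonneg: "\<And>x. 0 \<le> f x" "\<And>x. 0 \<le> g x"
    and int: "integrable M (\<lambda>x. f x powr p)" "integrable M (\<lambda>x. g x powr p')"
  shows "integrable M (\<lambda>x. f x * g x)" (is ?I)
    and "(\<integral>x. f x * g x \<partial>M) \<le> (\<integral>x. f x powr p \<partial>M) powr (1 / p) * (\<integral>x. g x powr p' \<partial>M) powr (1 / p')"
proof -
  have pt: "f x * g x \<le> c powr p * f x powr p / p + c powr (- p') * g x powr p' / p'" if "0 < c" for c x
    by (intro scaled_young assms that)
  have rhs: "integrable M (\<lambda>x. c powr p * f x powr p / p + c powr (- p') * g x powr p' / p')" for c
    by (intro Bochner_Integration.integrable_add integrable_divide integrable_mult_right int)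
  show I: ?I
    by (rule Bochner_Integration.integrable_bound[OF rhs[of 1]])
      (use pt[of 1] nonneg assms in \<open>auto intro!: AE_I2 order.trans[OF _ abs_ge_self]\<close>)
  show "(\<integral>x. f x * g x \<partial>M) \<le> (\<integral>x. f x powr p \<partial>M) powr (1 / p) * (\<integral>x. g x powr p' \<partial>M) powr (1 / p')"
  proof (rule scaled_young_imp_hoelder[OF assms(1-3)])
    fix c :: real assume "0 < c"
    then have "(\<integral>x. f x * g x \<partial>M) \<le> (\<integral>x. c powr p * f x powr p / p + c powr (- p') * g x powr p' / p' \<partial>M)"
      by (intro integral_mono I rhs pt)
    then show "(\<integral>x. f x * g x \<partial>M) \<le> c powr p * (\<integral>x. f x powr p \<partial>M) / p + c powr (- p') * (\<integral>x. g x powr p' \<partial>M) / p'"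
      using int by (simp add: Bochner_Integration.integral_add)
  qed auto
qed

lemma one_minus_powr_le:
  fixes d \<eta> :: real
  assumes "0 < d" "0 \<le> \<eta>" "\<eta> \<le> 1"
  shows "(1 - \<eta>) powr d \<le> 1 - min d 1 * \<eta>"
proof (cases "1 \<le> d")
  case True
  have "(1 - \<eta>) powr d \<le> (1 - \<eta>) powr 1"
    using assms True by (intro powr_mono') auto
  then show ?thesis using True assms by (auto simp: min_def)
next
  case False
  show ?thesis
  proof (cases "\<eta> = 1")
    case True then show ?thesis using assms False by simp
  next
    case eta: False
    have "(1 - \<eta>) powr d * 1 powr (1 - d) \<le> d * (1 - \<eta>) + (1 - d) * 1"
      by (rule Youngs_inequality_0) (use assms False eta in auto)
    then show ?thesis using False by (simp add: algebra_simps)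
  qed
qed

text \<open>Weighted AM-GM for exponents of sum at least \<open>1\<close>; the surplus is harmless because the bases are at most \<open>1\<close>.\<close>
lemma powr_prod_le_weighted_sum:
  fixes x y z a b c :: real
  assumes "0 \<le> a" "0 \<le> b" "0 \<le> c" "1 \<le> a + b + c"
    and "0 < x" "x \<le> 1" "0 < y" "y \<le> 1" "0 < z" "z \<le> 1"
  shows "x powr a * y powr b * z powr c \<le> (a * x + b * y + c * z) / (a + b + c)"
proof -
  let ?S = "a + b + c"
  have "(a * ln x + b * ln y + c * ln z) \<le> (a * ln x + b * ln y + c * ln z) / ?S"
  proof -
    have "a * ln x + b * ln y + c * ln z \<le> 0"
      using assms by (intro add_nonpos_nonpos mult_nonneg_nonpos) auto
    then have "(a * ln x + b * ln y + c * ln z) * (?S - 1) \<le> 0"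
      using assms by (intro mult_nonpos_nonneg) auto
    then show ?thesis using assms by (simp add: field_simps)
  qed
  also have "\<dots> = (a / ?S) * ln x + (b / ?S) * ln y + (c / ?S) * ln z"
    by (simp add: add_divide_distrib)
  finally have "x powr a * y powr b * z powr c \<le> exp ((a / ?S) * ln x + (b / ?S) * ln y + (c / ?S) * ln z)"
    using assms by (simp add: powr_def mult_exp_exp add_ac)
  also have "\<dots> \<le> (a / ?S) * x + (b / ?S) * y + (c / ?S) * z"
  proof -
    let ?m = "(a / ?S) * x + (b / ?S) * y + (c / ?S) * z"
    have S: "a / ?S + b / ?S + c / ?S = 1" using assms by (simp flip: add_divide_distrib)
    have m: "0 < ?m"
    proof -
      let ?u = "min x (min y z)"
      have "0 < ?u" using assms by auto
      also have "?u = (a / ?S) * ?u + (b / ?S) * ?u + (c / ?S) * ?u"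
        using S by (metis distrib_right mult_1)
      also have "\<dots> \<le> ?m" using assms by (intro add_mono mult_left_mono) auto
      finally show ?thesis .
    qed
    have l: "ln t \<le> ln ?m + (t / ?m - 1)" if "0 < t" for t
      using ln_add_one_self_le_self2[of "t / ?m - 1"] that m by (simp add: ln_div)
    have "(a / ?S) * ln x + (b / ?S) * ln y + (c / ?S) * ln z
      \<le> (a / ?S) * (ln ?m + (x / ?m - 1)) + (b / ?S) * (ln ?m + (y / ?m - 1)) + (c / ?S) * (ln ?m + (z / ?m - 1))"
      using assms by (intro add_mono mult_left_mono l) auto
    also have "\<dots> = (a / ?S + b / ?S + c / ?S) * (ln ?m - 1) + ?m / ?m"
      by (simp only: algebra_simps add_divide_distrib times_divide_eq_right)
    also have "\<dots> = ln ?m" using S m by simp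
    finally show ?thesis using m by (simp add: ln_ge_iff)
  qed
  finally show ?thesis by (simp add: add_divide_distrib)
qed

section \<open>Summation by parts on laminar families\<close>

text \<open>A finite family of nonempty sets, any two of which are nested or disjoint. Ordered by inclusion it is a forest, like a finite family of dyadic cubes.\<close>
locale laminar_family =
  fixes S :: "'a set set"
  assumes finite_family: "finite S"
    and laminar: "\<And>P Q. P \<in> S \<Longrightarrow> Q \<in> S \<Longrightarrow> P \<subseteq> Q \<or> Q \<subseteq> P \<or> P \<inter> Q = {}"
    and empty_notin: "{} \<notin> S"
begin

text \<open>The strict ancestors of \<open>Q\<close>. They form a chain, so if there are any, their intersection is the parent of \<open>Q\<close>.\<close>
definition above :: "'a set \<Rightarrow> 'a set set" where
  "above Q = {R \<in> S. Q \<subset> R}"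

text \<open>The value of \<open>h\<close> at the parent, with value \<open>0\<close> at the roots; thus at a root \<open>jump h\<close> below is \<open>h\<close> itself.\<close>
definition prev :: "('a set \<Rightarrow> real) \<Rightarrow> 'a set \<Rightarrow> real" where
  "prev h Q = (if above Q = {} then 0 else h (\<Inter>(above Q)))"

text \<open>The increment of \<open>h\<close> from the parent to \<open>Q\<close>.\<close>
definition jump :: "('a set \<Rightarrow> real) \<Rightarrow> 'a set \<Rightarrow> real" where
  "jump h Q = h Q - prev h Q"

text \<open>The largest value of \<open>a\<close> at \<open>Q\<close> and its ancestors. Applied to averages it is a discrete maximal function.\<close>
definition running_max :: "('a set \<Rightarrow> real) \<Rightarrow> 'a set \<Rightarrow> real" where
  "running_max a Q = Max (a ` {R \<in> S. Q \<subseteq> R})"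

lemma finite_above [simp]: "finite (above Q)"
  using finite_family by (simp add: above_def)

lemma Inter_chain_mem:
  assumes "C \<subseteq> S" "C \<noteq> {}" "x \<in> \<Inter>C"
  shows "\<Inter>C \<in> C"
proof -
  have "finite C" using assms finite_family finite_subset by blast
  then obtain m where m: "m \<in> C" "\<And>R. R \<in> C \<Longrightarrow> R \<subseteq> m \<Longrightarrow> R = m"
    using finite_has_minimal[of C] assms(2) by blast
  have "m \<subseteq> R" if "R \<in> C" for R
    using laminar[of m R] m that assms by blast
  then have "\<Inter>C = m" using m(1) by blast
  then show ?thesis using m(1) by simp
qed

lemma parent:
  assumes "Q \<in> S" "above Q \<noteq> {}"
  shows "\<Inter>(above Q) \<in> S" "Q \<subset> \<Inter>(above Q)"
    "above Q = {R \<in> S. \<Inter>(above Q) \<subseteq> R}"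
    "above (\<Inter>(above Q)) \<subset> above Q"
proof -
  have "Q \<noteq> {}" using assms empty_notin by metis
  then obtain x where "x \<in> Q" by blast
  then have *: "\<Inter>(above Q) \<in> above Q"
    by (intro Inter_chain_mem[of _ x]) (use assms in \<open>auto simp: above_def\<close>)
  then show "\<Inter>(above Q) \<in> S" "Q \<subset> \<Inter>(above Q)" by (auto simp: above_def)
  with * show "above Q = {R \<in> S. \<Inter>(above Q) \<subseteq> R}"
    by (auto simp: above_def)
  have "above (\<Inter>(above Q)) \<subseteq> above Q"
    using * unfolding above_def by blast
  moreover have "\<Inter>(above Q) \<notin> above (\<Inter>(above Q))" by (simp add: above_def)
  ultimately show "above (\<Inter>(above Q)) \<subset> above Q" using * by blast
qed

lemma chain_at_point:
  assumes "R0 \<in> S" "x \<in> R0"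
  obtains Q where "Q \<in> S" "x \<in> Q" "{R \<in> S. x \<in> R} = {R \<in> S. Q \<subseteq> R}"
proof -
  let ?C = "{R \<in> S. x \<in> R}"
  have "\<Inter>?C \<in> ?C" by (rule Inter_chain_mem[of _ x]) (use assms in auto)
  then show ?thesis by (intro that[of "\<Inter>?C"]) auto
qed

lemma sum_jump:
  assumes "Q \<in> S"
  shows "(\<Sum>R\<in>{R \<in> S. Q \<subseteq> R}. jump h R) = h Q"
  using assms
proof (induction "card (above Q)" arbitrary: Q rule: less_induct)
  case less
  have up: "{R \<in> S. Q \<subseteq> R} = insert Q (above Q)" "Q \<notin> above Q"
    using less.prems by (auto simp: above_def)
  show ?case
  proof (cases "above Q = {}")
    case True
    then show ?thesis using up by (simp add: jump_def prev_def)
  next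
    case False
    note P = parent[OF less.prems False]
    have "(\<Sum>R\<in>above Q. jump h R) = h (\<Inter>(above Q))"
      using less.hyps[OF psubset_card_mono[OF _ P(4)] P(1)] P(3) by simp
    then show ?thesis using up False by (simp add: jump_def prev_def)
  qed
qed

text \<open>Summation by parts.\<close>
lemma sum_jump_swap:
  "(\<Sum>Q\<in>S. T Q * h Q) = (\<Sum>R\<in>S. jump h R * (\<Sum>Q\<in>{Q \<in> S. Q \<subseteq> R}. T Q))"
proof -
  have "(\<Sum>Q\<in>S. T Q * h Q) = (\<Sum>Q\<in>S. \<Sum>R\<in>S. if Q \<subseteq> R then jump h R * T Q else 0)"
  proof (intro sum.cong refl)
    fix Q assume "Q \<in> S"
    have "T Q * h Q = (\<Sum>R\<in>{R \<in> S. Q \<subseteq> R}. jump h R * T Q)"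
      unfolding sum_distrib_right[symmetric] sum_jump[OF \<open>Q \<in> S\<close>] by (rule mult.commute)
    then show "T Q * h Q = (\<Sum>R\<in>S. if Q \<subseteq> R then jump h R * T Q else 0)"
      using finite_family by (simp add: sum.If_cases Int_def)
  qed
  also have "\<dots> = (\<Sum>R\<in>S. \<Sum>Q\<in>S. if Q \<subseteq> R then jump h R * T Q else 0)"
    by (rule sum.swap)
  also have "\<dots> = (\<Sum>R\<in>S. jump h R * (\<Sum>Q\<in>{Q \<in> S. Q \<subseteq> R}. T Q))"
    using finite_family by (simp add: sum.If_cases Int_def sum_distrib_left)
  finally show ?thesis .
qed

text \<open>The sets that contain a given point form a chain, so the increments telescope to the value at the smallest of them.\<close>
lemma sum_jump_at_point:
  "(\<Sum>R\<in>S. jump h R * indicator R x) =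
    (if \<exists>R\<in>S. x \<in> R then h (\<Inter>{R \<in> S. x \<in> R}) else 0)"
proof (cases "\<exists>R\<in>S. x \<in> R")
  case True
  then obtain R0 where "R0 \<in> S" "x \<in> R0" by blast
  then obtain Q where Q: "Q \<in> S" "x \<in> Q" "{R \<in> S. x \<in> R} = {R \<in> S. Q \<subseteq> R}"
    by (rule chain_at_point)
  have "(\<Sum>R\<in>S. jump h R * indicator R x) = (\<Sum>R\<in>{R \<in> S. x \<in> R}. jump h R)"
    using finite_family by (simp add: indicator_def sum.If_cases Int_def if_distrib cong: if_cong)
  also have "\<dots> = h Q" using sum_jump[OF Q(1)] Q(3) by simp
  also have "Q = \<Inter>{R \<in> S. x \<in> R}" using Q by blast
  finally show ?thesis using True by simp
next
  case False
  then show ?thesis by (auto intro!: sum.neutral)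
qed

text \<open>If \<open>T\<close>, summed over disjoint strict subsets of \<open>Q\<close>, gains a factor \<open>\<kappa> < 1\<close>, then the sum over all descendants is a geometric series. The induction applies this gain to the maximal strict subsets.\<close>
lemma laminar_sum_bound:
  fixes T :: "'a set \<Rightarrow> real"
  assumes T: "\<And>Q. Q \<in> S \<Longrightarrow> 0 \<le> T Q" and \<kappa>: "0 \<le> \<kappa>" "\<kappa> < 1"
    and children: "\<And>Q C. Q \<in> S \<Longrightarrow> C \<subseteq> S \<Longrightarrow> (\<And>P. P \<in> C \<Longrightarrow> P \<subset> Q) \<Longrightarrow> disjoint C \<Longrightarrow>
      (\<Sum>P\<in>C. T P) \<le> \<kappa> * T Q"
    and "Q \<in> S"
  shows "(\<Sum>P\<in>{P \<in> S. P \<subseteq> Q}. T P) \<le> T Q / (1 - \<kappa>)"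
  using \<open>Q \<in> S\<close>
proof (induction "card {P \<in> S. P \<subset> Q}" arbitrary: Q rule: less_induct)
  case less
  let ?B = "{P \<in> S. P \<subset> Q}"
  \<comment> \<open>The children of \<open>Q\<close>.\<close>
  define C where "C = {P \<in> ?B. \<forall>P'\<in>?B. P \<subseteq> P' \<longrightarrow> P = P'}"
  have fin: "finite ?B" "finite C" using finite_family by (auto simp: C_def)
  have disj: "disjoint C"
    unfolding disjoint_def
  proof (intro ballI impI)
    fix P P' assume P: "P \<in> C" "P' \<in> C" "P \<noteq> P'"
    with laminar[of P P'] show "P \<inter> P' = {}" by (auto simp: C_def)
  qed
  have cover: "?B \<subseteq> (\<Union>P\<in>C. {R \<in> S. R \<subseteq> P})"
  proof
    fix R assume R: "R \<in> ?B"
    then obtain m where "m \<in> ?B" "R \<subseteq> m" "\<And>P'. P' \<in> ?B \<Longrightarrow> m \<subseteq> P' \<Longrightarrow> m = P'"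
      using finite_has_maximal2[OF fin(1) R] by metis
    then have "m \<in> C" unfolding C_def by blast
    then show "R \<in> (\<Union>P\<in>C. {R \<in> S. R \<subseteq> P})" using R \<open>R \<subseteq> m\<close> by blast
  qed
  have "(\<Sum>P\<in>{P \<in> S. P \<subseteq> Q}. T P) = T Q + (\<Sum>P\<in>?B. T P)"
  proof -
    have "{P \<in> S. P \<subseteq> Q} = insert Q ?B" using less.prems by auto
    then show ?thesis using fin by simp
  qed
  also have "(\<Sum>P\<in>?B. T P) \<le> (\<Sum>P\<in>(\<Union>P\<in>C. {R \<in> S. R \<subseteq> P}). T P)"
    using cover finite_family T fin by (intro sum_mono2) auto
  also have "\<dots> \<le> (\<Sum>P\<in>C. \<Sum>R\<in>{R \<in> S. R \<subseteq> P}. T R)"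
  proof (subst sum.UNION_disjoint)
    show "\<forall>i\<in>C. \<forall>j\<in>C. i \<noteq> j \<longrightarrow> {R \<in> S. R \<subseteq> i} \<inter> {R \<in> S. R \<subseteq> j} = {}"
    proof (intro ballI impI)
      fix P P' assume "P \<in> C" "P' \<in> C" "P \<noteq> P'"
      then have "P \<inter> P' = {}" using disj by (simp add: disjoint_def)
      moreover have "R \<noteq> {}" if "R \<in> S" for R using that empty_notin by metis
      ultimately show "{R \<in> S. R \<subseteq> P} \<inter> {R \<in> S. R \<subseteq> P'} = {}" by blast
    qed
  qed (use fin finite_family in auto)
  also have "\<dots> \<le> (\<Sum>P\<in>C. T P / (1 - \<kappa>))"
  proof (intro sum_mono less.hyps)
    fix P assume "P \<in> C"
    then show "P \<in> S" "card {R \<in> S. R \<subset> P} < card {R \<in> S. R \<subset> Q}"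
      using fin(1) by (auto simp: C_def intro!: psubset_card_mono)
  qed
  also have "\<dots> \<le> \<kappa> * T Q / (1 - \<kappa>)"
  proof -
    have "(\<Sum>P\<in>C. T P) \<le> \<kappa> * T Q"
      by (rule children[OF less.prems _ _ disj]) (auto simp: C_def)
    then show ?thesis
      unfolding sum_divide_distrib[symmetric] using \<kappa> by (intro divide_right_mono) auto
  qed
  finally have "(\<Sum>P\<in>{P \<in> S. P \<subseteq> Q}. T P) \<le> T Q + \<kappa> * T Q / (1 - \<kappa>)" by simp
  also have "\<dots> = T Q / (1 - \<kappa>)" using \<kappa> by (simp add: field_simps)
  finally show ?case .
qed

lemma sum_prod_jump_le:
  fixes T h :: "'a set \<Rightarrow> real"
  assumes T: "\<And>Q. Q \<in> S \<Longrightarrow> 0 \<le> T Q" and \<kappa>: "0 \<le> \<kappa>" "\<kappa> < 1"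
    and children: "\<And>Q C. Q \<in> S \<Longrightarrow> C \<subseteq> S \<Longrightarrow> (\<And>P. P \<in> C \<Longrightarrow> P \<subset> Q) \<Longrightarrow> disjoint C \<Longrightarrow>
      (\<Sum>P\<in>C. T P) \<le> \<kappa> * T Q"
    and jump: "\<And>Q. Q \<in> S \<Longrightarrow> 0 \<le> jump h Q"
  shows "(\<Sum>Q\<in>S. T Q * h Q) \<le> (\<Sum>Q\<in>S. T Q * jump h Q) / (1 - \<kappa>)"
proof -
  have "(\<Sum>Q\<in>S. T Q * h Q) \<le> (\<Sum>R\<in>S. jump h R * (T R / (1 - \<kappa>)))"
  proof (subst sum_jump_swap, rule sum_mono, rule mult_left_mono)
    fix R assume "R \<in> S"
    show "(\<Sum>Q\<in>{Q \<in> S. Q \<subseteq> R}. T Q) \<le> T R / (1 - \<kappa>)"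
    proof (rule laminar_sum_bound[of T \<kappa> R])
      show "(\<Sum>P\<in>C. T P) \<le> \<kappa> * T Q"
        if "Q \<in> S" "C \<subseteq> S" "\<And>P. P \<in> C \<Longrightarrow> P \<subset> Q" "disjoint C" for Q C
        using that by (rule children)
    qed (fact T \<kappa> \<open>R \<in> S\<close>)+
  qed (rule jump)
  then show ?thesis by (simp add: sum_divide_distrib mult.commute)
qed

lemma prev_comp: "\<phi> 0 = 0 \<Longrightarrow> prev (\<lambda>Q. \<phi> (h Q)) Q = \<phi> (prev h Q)"
  by (simp add: prev_def)

lemma prev_mult: "prev (\<lambda>Q. h Q * g Q) Q = prev h Q * prev g Q"
  by (simp add: prev_def)

lemma prev_nonneg:
  assumes "Q \<in> S" "\<And>R. R \<in> S \<Longrightarrow> 0 \<le> h R"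
  shows "0 \<le> prev h Q"
  using parent(1)[OF assms(1)] assms(2) by (simp add: prev_def)

context
  fixes a :: "'a set \<Rightarrow> real"
  assumes a: "\<And>Q. Q \<in> S \<Longrightarrow> 0 \<le> a Q"
begin

lemma running_max_ge: "Q \<in> S \<Longrightarrow> a Q \<le> running_max a Q"
  using finite_family unfolding running_max_def by (intro Max_ge) auto

lemma running_max_nonneg: "Q \<in> S \<Longrightarrow> 0 \<le> running_max a Q"
  using running_max_ge a order_trans by blast

lemma running_max_eq:
  assumes "Q \<in> S"
  shows "running_max a Q = max (a Q) (prev (running_max a) Q)"
proof (cases "above Q = {}")
  case True
  then have "{R \<in> S. Q \<subseteq> R} = {Q}" using assms by (auto simp: above_def)
  then show ?thesis using True a[OF assms] by (simp add: running_max_def prev_def max_def)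
next
  case False
  note P = parent[OF assms False]
  have "{R \<in> S. Q \<subseteq> R} = insert Q (above Q)" using assms by (auto simp: above_def)
  then have "running_max a Q = max (a Q) (Max (a ` above Q))"
    using False by (simp add: running_max_def)
  also have "Max (a ` above Q) = running_max a (\<Inter>(above Q))"
    using P(3) by (simp add: running_max_def)
  finally show ?thesis using False by (simp add: prev_def)
qed

lemma prev_running_max:
  assumes "Q \<in> S"
  shows "0 \<le> prev (running_max a) Q" "prev (running_max a) Q \<le> running_max a Q"
    and "prev (running_max a) Q < running_max a Q \<Longrightarrow> running_max a Q = a Q"
  using running_max_eq[OF assms] prev_nonneg[OF assms running_max_nonneg] by auto

end

end

section \<open>The maximal inequality and sums with geometric decay\<close>

text \<open>The average of \<open>f\<close> over \<open>Q\<close> with respect to \<open>M\<close>.\<close>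
definition average :: "'a measure \<Rightarrow> ('a \<Rightarrow> real) \<Rightarrow> 'a set \<Rightarrow> real" where
  "average M f Q = (LINT x:Q|M. f x) / measure M Q"

text \<open>The constant of lemma \<open>sum_jump_decay_le\<close>: the two maximal inequalities contribute \<open>p / (p - 1)\<close> and \<open>r / (r - 1)\<close>, and the middle factor comes from summing powers that decay geometrically.\<close>
definition decay_const :: "real \<Rightarrow> real \<Rightarrow> real" where
  "decay_const p r = p / (p - 1) * ((p / (p - 1) / r) / min (p / (p - 1) / r - 1) 1) powr ((p - 1) / p) * (r / (r - 1))"

lemma emeasure_finite_if_measure_pos:
  assumes "0 < measure M R"
  shows "emeasure M R < \<infinity>"
proof -
  have "emeasure M R \<noteq> \<infinity>" using assms by (auto simp: measure_def)
  then show ?thesis by (simp add: top.not_eq_extremum)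
qed

context laminar_family
begin

lemma sum_measure_disjoint_le:
  assumes sets: "\<And>Q. Q \<in> S \<Longrightarrow> Q \<in> sets M" and pos: "\<And>Q. Q \<in> S \<Longrightarrow> 0 < measure M Q"
    and "Q \<in> S" "C \<subseteq> S" "\<And>P. P \<in> C \<Longrightarrow> P \<subset> Q" "disjoint C"
  shows "(\<Sum>P\<in>C. measure M P) \<le> measure M Q"
proof -
  have fm: "R \<in> fmeasurable M" if "R \<in> S" for R
    using sets[OF that] emeasure_finite_if_measure_pos[OF pos[OF that]] by (intro fmeasurableI) auto
  have "(\<Sum>P\<in>C. measure M P) = measure M (\<Union>C)"
  proof (rule measure_Union'[symmetric])
    show "finite C" using assms finite_family finite_subset by blast
    show "pairwise disjnt C" using assms by (simp add: disjoint_def pairwise_def disjnt_def)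
  qed (use fm assms in blast)
  also have "\<dots> \<le> measure M Q"
  proof (rule measure_mono_fmeasurable)
    show "\<Union>C \<subseteq> Q" using assms(5) by blast
    show "\<Union>C \<in> sets M" using assms finite_family finite_subset
      by (intro sets.finite_Union) blast+
  qed (rule fm[OF \<open>Q \<in> S\<close>])
  finally show ?thesis .
qed

lemma sum_jump_ge:
  assumes "\<And>R. R \<in> S \<Longrightarrow> 0 \<le> jump h R" "\<And>R. R \<in> S \<Longrightarrow> R \<in> sets M"
    and pos: "\<And>Q. Q \<in> S \<Longrightarrow> 0 < measure M Q" and "Q \<in> S"
  shows "measure M Q * h Q \<le> (\<Sum>R\<in>S. measure M R * jump h R)"
proof -
  have "measure M Q * h Q = (\<Sum>R\<in>{R \<in> S. Q \<subseteq> R}. measure M Q * jump h R)"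
    using sum_jump[OF \<open>Q \<in> S\<close>, of h] by (simp add: sum_distrib_left[symmetric])
  also have "\<dots> \<le> (\<Sum>R\<in>{R \<in> S. Q \<subseteq> R}. measure M R * jump h R)"
  proof (intro sum_mono mult_right_mono)
    fix R assume "R \<in> {R \<in> S. Q \<subseteq> R}"
    moreover from this have "emeasure M R < \<infinity>"
      using emeasure_finite_if_measure_pos[OF pos] by auto
    ultimately show "measure M Q \<le> measure M R" "0 \<le> jump h R"
      using assms by (auto intro!: measure_mono_fmeasurable fmeasurableI)
  qed
  also have "\<dots> \<le> (\<Sum>R\<in>S. measure M R * jump h R)"
    using finite_family assms by (intro sum_mono2) auto
  finally show ?thesis .
qed

lemma average_nonneg: "(\<And>x. 0 \<le> f x) \<Longrightarrow> 0 \<le> average M f Q"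
  unfolding average_def set_lebesgue_integral_def
  by (intro divide_nonneg_nonneg integral_nonneg_AE AE_I2) auto

text \<open>The left-hand side is the integral of the \<open>p\<close>-th power of the maximal function, written as a sum of
  increments. Where \<open>F\<close> jumps it equals the average of \<open>f\<close>, so by \<open>powr_diff_le_conj\<close> the sum is at most
  \<open>p / (p - 1)\<close> times the integral of \<open>f\<close> against the \<open>(p - 1)\<close>-st power of the maximal function; Hoelder's inequality concludes.\<close>
lemma maximal_inequality:
  fixes f :: "'a \<Rightarrow> real"
  assumes sets: "\<And>Q. Q \<in> S \<Longrightarrow> Q \<in> sets M" and pos: "\<And>Q. Q \<in> S \<Longrightarrow> 0 < measure M Q"
    and p: "1 < p" and [measurable]: "f \<in> borel_measurable M" and f0: "\<And>x. 0 \<le> f x"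
    and loc: "\<And>Q. Q \<in> S \<Longrightarrow> set_integrable M Q f" and fp: "integrable M (\<lambda>x. f x powr p)"
  defines "F \<equiv> running_max (average M f)"
  shows "(\<Sum>R\<in>S. measure M R * (F R powr p - prev F R powr p))
    \<le> (p / (p - 1)) powr p * (\<integral>x. f x powr p \<partial>M)" (is "?X \<le> _ * ?I")
proof -
  define p' where "p' = p / (p - 1)"
  have p': "1 < p'" "1 / p + 1 / p' = 1" "(p - 1) * p' = p" using p by (auto simp: p'_def field_simps)
  have a0: "0 \<le> average M f Q" for Q by (intro average_nonneg f0)
  have F0: "0 \<le> F Q" "0 \<le> prev F Q" "prev F Q \<le> F Q" "prev F Q < F Q \<Longrightarrow> F Q = average M f Q"
    if "Q \<in> S" for Q
    using that a0 running_max_nonneg[of "average M f" Q] prev_running_max[of "average M f" Q] unfolding F_def by blast+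
  have j: "jump (\<lambda>Q. F Q powr t) R = F R powr t - prev F R powr t" for t R
    by (simp add: jump_def prev_comp[of "\<lambda>x. x powr t"])
  define m where "m t x = (\<Sum>R\<in>S. jump (\<lambda>Q. F Q powr t) R * indicator R x)" for t x
  have m0: "0 \<le> m t x" if "0 < t" for t x
    unfolding m_def j using F0 that by (intro sum_nonneg mult_nonneg_nonneg) (auto intro!: powr_mono2)
  have [measurable]: "m t \<in> borel_measurable M" for t
    unfolding m_def using sets by measurable
  have mp: "m (p - 1) x powr p' = m p x" for x
    using p p' unfolding m_def sum_jump_at_point by (simp add: powr_powr)
  have ind: "integrable M (indicator R :: 'a \<Rightarrow> real)" if "R \<in> S" for R
    using sets[OF that] emeasure_finite_if_measure_pos[OF pos[OF that]]
    by (intro integrable_real_indicator) auto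
  have intm: "integrable M (m p)" unfolding m_def using ind
    by (intro Bochner_Integration.integrable_sum integrable_mult_right) auto
  have X: "?X = (\<integral>x. m p x \<partial>M)"
    unfolding m_def using ind sets
    by (subst Bochner_Integration.integral_sum)
      (auto intro!: sum.cong simp: j mult.commute sets.sets_into_space Int_absorb2)
  have "?X \<le> (\<Sum>R\<in>S. p' * ((LINT x:R|M. f x) * jump (\<lambda>Q. F Q powr (p - 1)) R))"
  proof (intro sum_mono)
    fix R assume R: "R \<in> S"
    show "measure M R * (F R powr p - prev F R powr p) \<le> p' * ((LINT x:R|M. f x) * jump (\<lambda>Q. F Q powr (p - 1)) R)"
    proof (cases "prev F R < F R")
      case True
      have "measure M R * (F R powr p - prev F R powr p)
          \<le> measure M R * (p' * (F R * (F R powr (p - 1) - prev F R powr (p - 1))))"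
        unfolding p'_def using F0[OF R] p by (intro mult_left_mono powr_diff_le_conj) auto
      also have "\<dots> = p' * (measure M R * F R) * jump (\<lambda>Q. F Q powr (p - 1)) R"
        by (simp add: j)
      also have "measure M R * F R = (LINT x:R|M. f x)"
        using F0(4)[OF R True] pos[OF R] by (simp add: average_def)
      finally show ?thesis by (simp add: mult.assoc)
    next
      case False
      then have "prev F R = F R" using F0(3)[OF R] by simp
      then show ?thesis by (simp add: j)
    qed
  qed
  also have "\<dots> = p' * (\<integral>x. f x * m (p - 1) x \<partial>M)"
  proof -
    have "(\<integral>x. f x * m (p - 1) x \<partial>M)
      = (\<integral>x. (\<Sum>R\<in>S. jump (\<lambda>Q. F Q powr (p - 1)) R * (indicator R x * f x)) \<partial>M)"
      by (simp add: m_def sum_distrib_left mult_ac)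
    also have "\<dots> = (\<Sum>R\<in>S. jump (\<lambda>Q. F Q powr (p - 1)) R * (LINT x:R|M. f x))"
      using loc unfolding set_integrable_def set_lebesgue_integral_def
      by (subst Bochner_Integration.integral_sum) auto
    finally show ?thesis by (simp add: sum_distrib_left mult_ac)
  qed
  also have "\<dots> \<le> p' * (?I powr (1 / p) * (\<integral>x. m (p - 1) x powr p' \<partial>M) powr (1 / p'))"
    using p p' intm m0[of "p - 1"] f0 fp by (intro mult_left_mono hoelder_integral(2)) (auto simp: mp)
  finally have main: "?X \<le> p' * (?I powr (1 / p) * ?X powr (1 / p'))"
    by (simp add: mp X)
  have X0: "0 \<le> ?X" unfolding X using m0[of p] p by (intro integral_nonneg_AE AE_I2) auto
  have I0: "0 \<le> ?I" by (intro integral_nonneg_AE AE_I2) auto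
  show ?thesis
  proof (cases "?X = 0")
    case True then show ?thesis using I0 by (simp only:) simp
  next
    case False
    with X0 have Xp: "0 < ?X" by simp
    have "?X = ?X powr (1 / p) * ?X powr (1 / p')"
      using Xp p' by (simp flip: powr_add)
    with main have "?X powr (1 / p) * ?X powr (1 / p') \<le> p' * ?I powr (1 / p) * ?X powr (1 / p')"
      by (simp only: mult.assoc)
    then have "?X powr (1 / p) \<le> p' * ?I powr (1 / p)"
      using Xp by (simp add: mult_le_cancel_right)
    then have "(?X powr (1 / p)) powr p \<le> (p' * ?I powr (1 / p)) powr p"
      using p by (intro powr_mono2) auto
    then show ?thesis
      using p p' I0 X0 by (simp add: powr_mult powr_powr p'_def[symmetric])
  qed
qed

text \<open>The estimate that produces the power of the weight constant. Since \<open>p' / r > 1\<close>, the decay of \<open>N\<close> makes the powers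
  \<open>N(Q) powr (p' / r)\<close> summable over the descendants of a set, with a loss of only \<open>1 / \<eta>\<close>, and this loss enters with the power \<open>1 / p'\<close>.\<close>
lemma sum_jump_decay_le:
  fixes f g :: "'a \<Rightarrow> real"
  assumes sets: "\<And>Q. Q \<in> S \<Longrightarrow> Q \<in> sets M" "\<And>Q. Q \<in> S \<Longrightarrow> Q \<in> sets N"
    and pos: "\<And>Q. Q \<in> S \<Longrightarrow> 0 < measure M Q" "\<And>Q. Q \<in> S \<Longrightarrow> 0 < measure N Q"
    and pr: "1 < p" "1 < r" "1 < 1 / p + 1 / r"
    and f: "f \<in> borel_measurable M" "\<And>x. 0 \<le> f x" "\<And>Q. Q \<in> S \<Longrightarrow> set_integrable M Q f"
      "integrable M (\<lambda>x. f x powr p)"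
    and g: "g \<in> borel_measurable N" "\<And>x. 0 \<le> g x" "\<And>Q. Q \<in> S \<Longrightarrow> set_integrable N Q g"
      "integrable N (\<lambda>x. g x powr r)"
    and \<eta>: "0 < \<eta>" "\<eta> \<le> 1"
    and decay: "\<And>P Q. P \<in> S \<Longrightarrow> Q \<in> S \<Longrightarrow> P \<subset> Q \<Longrightarrow> measure N P \<le> (1 - \<eta>) * measure N Q"
  defines "F \<equiv> running_max (average M f)" and "G \<equiv> running_max (average N g)"
    and "p' \<equiv> p / (p - 1)"
  shows "(\<Sum>R\<in>S. (measure M R powr (1 / p) * jump F R) * (measure N R powr (1 / r) * G R))
    \<le> decay_const p r * \<eta> powr (- (1 / p')) * ((\<integral>x. f x powr p \<partial>M) powr (1 / p) * (\<integral>x. g x powr r \<partial>N) powr (1 / r))"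
proof -
  \<comment> \<open>This exponent exceeds \<open>1\<close> exactly because \<open>1 / p + 1 / r > 1\<close>; the decay of \<open>N\<close> acts on the surplus \<open>\<kappa> - 1\<close>.\<close>
  define \<kappa> where "\<kappa> = p' / r"
  have p': "1 < p'" "1 / p + 1 / p' = 1" "(p - 1) / p = 1 / p'" using pr by (auto simp: p'_def field_simps)
  have "1 / p' < 1 / r" using pr p' by linarith
  then have \<kappa>: "1 < \<kappa>" using pr p' by (simp add: \<kappa>_def field_simps)
  define c where "c = \<kappa> / min (\<kappa> - 1) 1"
  have c0: "0 < c" using \<kappa> by (auto simp: c_def)
  let ?If = "\<integral>x. f x powr p \<partial>M" and ?Ig = "\<integral>x. g x powr r \<partial>N"
  have I0: "0 \<le> ?If" "0 \<le> ?Ig" by (auto intro!: integral_nonneg_AE AE_I2)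
  have F0: "0 \<le> F Q" "0 \<le> prev F Q" "prev F Q \<le> F Q" if "Q \<in> S" for Q
    using that average_nonneg[of f M, OF f(2)] running_max_nonneg[of "average M f" Q] prev_running_max[of "average M f" Q] unfolding F_def by blast+
  have G0: "0 \<le> G Q" "0 \<le> prev G Q" "prev G Q \<le> G Q" if "Q \<in> S" for Q
    using that average_nonneg[of g N, OF g(2)] running_max_nonneg[of "average N g" Q] prev_running_max[of "average N g" Q] unfolding G_def by blast+
  have jG: "jump (\<lambda>Q. G Q powr t) R = G R powr t - prev G R powr t" for t R
    by (simp add: jump_def prev_comp[of "\<lambda>x. x powr t"])
  have jG0: "0 \<le> jump (\<lambda>Q. G Q powr t) R" if "R \<in> S" "0 \<le> t" for t R
    using that G0 by (auto simp: jG intro!: powr_mono2)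

  have first: "(\<Sum>R\<in>S. (measure M R powr (1 / p) * jump F R) powr p) \<le> p' powr p * ?If"
  proof -
    have "(\<Sum>R\<in>S. (measure M R powr (1 / p) * jump F R) powr p)
        \<le> (\<Sum>R\<in>S. measure M R * (F R powr p - prev F R powr p))"
    proof (intro sum_mono)
      fix R assume R: "R \<in> S"
      have "(measure M R powr (1 / p) * jump F R) powr p = measure M R * (F R - prev F R) powr p"
        using F0[OF R] pr by (simp add: jump_def powr_mult powr_powr)
      then show "(measure M R powr (1 / p) * jump F R) powr p \<le> measure M R * (F R powr p - prev F R powr p)"
        using F0[OF R] pr by (auto intro!: mult_left_mono diff_powr_le)
    qed
    also have "\<dots> \<le> p' powr p * ?If"
      unfolding F_def p'_def by (rule maximal_inequality) (use sets pos f pr in auto)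
    finally show ?thesis .
  qed

  \<comment> \<open>The integral of the \<open>r\<close>-th power of the maximal function of \<open>g\<close>.\<close>
  define Y where "Y = (\<Sum>R\<in>S. measure N R * jump (\<lambda>Q. G Q powr r) R)"
  have Y0: "0 \<le> Y" unfolding Y_def using jG0 pr by (intro sum_nonneg) auto
  have YI: "Y \<le> (r / (r - 1)) powr r * ?Ig"
    unfolding Y_def jG unfolding G_def by (rule maximal_inequality) (use sets pos g pr in auto)
  have second: "(\<Sum>R\<in>S. (measure N R powr (1 / r) * G R) powr p') \<le> c / \<eta> * Y powr \<kappa>"
  proof -
    define \<rho> where "\<rho> = (1 - \<eta>) powr (\<kappa> - 1)"
    have \<rho>: "0 \<le> \<rho>" "\<rho> \<le> 1 - min (\<kappa> - 1) 1 * \<eta>" "0 < min (\<kappa> - 1) 1 * \<eta>"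
      unfolding \<rho>_def using one_minus_powr_le[of "\<kappa> - 1" \<eta>] \<kappa> \<eta> by auto
    then have \<rho>1: "\<rho> < 1" by linarith
    have "(\<Sum>R\<in>S. (measure N R powr (1 / r) * G R) powr p') = (\<Sum>R\<in>S. measure N R powr \<kappa> * G R powr p')"
      using G0 by (intro sum.cong refl) (simp add: powr_mult powr_powr \<kappa>_def)
    also have "\<dots> \<le> (\<Sum>R\<in>S. measure N R powr \<kappa> * jump (\<lambda>Q. G Q powr p') R) / (1 - \<rho>)"
    proof (rule sum_prod_jump_le)
      fix Q C assume C: "Q \<in> S" "C \<subseteq> S" "\<And>P. P \<in> C \<Longrightarrow> P \<subset> Q" "disjoint C"
      have "(\<Sum>P\<in>C. measure N P powr \<kappa>) \<le> (\<Sum>P\<in>C. ((1 - \<eta>) * measure N Q) powr (\<kappa> - 1) * measure N P)"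
      proof (intro sum_mono)
        fix P assume P: "P \<in> C"
        then have "measure N P powr \<kappa> = measure N P powr (\<kappa> - 1) * measure N P"
          using pos(2)[of P] C by (simp add: powr_diff subset_iff)
        also have "\<dots> \<le> ((1 - \<eta>) * measure N Q) powr (\<kappa> - 1) * measure N P"
          using \<kappa> decay[of P Q] P C by (intro mult_right_mono powr_mono2) auto
        finally show "measure N P powr \<kappa> \<le> ((1 - \<eta>) * measure N Q) powr (\<kappa> - 1) * measure N P" .
      qed
      also have "\<dots> \<le> ((1 - \<eta>) * measure N Q) powr (\<kappa> - 1) * measure N Q"
        unfolding sum_distrib_left[symmetric]
        using sum_measure_disjoint_le[of N Q C] sets pos C by (intro mult_left_mono) auto
      also have "\<dots> = \<rho> * measure N Q powr \<kappa>"
        using pos(2)[OF C(1)] \<eta> by (simp add: \<rho>_def powr_mult powr_diff)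
      finally show "(\<Sum>P\<in>C. measure N P powr \<kappa>) \<le> \<rho> * measure N Q powr \<kappa>" .
    qed (use \<rho> \<rho>1 jG0 p' in auto)
    also have "\<dots> \<le> (\<Sum>R\<in>S. \<kappa> * Y powr (\<kappa> - 1) * (measure N R * jump (\<lambda>Q. G Q powr r) R)) / (1 - \<rho>)"
    proof (intro divide_right_mono sum_mono)
      fix R assume R: "R \<in> S"
      have e: "u powr p' = (u powr r) powr \<kappa>" for u :: real
        using pr by (simp add: powr_powr \<kappa>_def)
      have "jump (\<lambda>Q. G Q powr p') R \<le> \<kappa> * (G R powr r) powr (\<kappa> - 1) * jump (\<lambda>Q. G Q powr r) R"
        unfolding jG unfolding e using \<kappa> G0[OF R] pr by (intro powr_diff_le_tangent) (auto intro!: powr_mono2)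
      then have "measure N R powr \<kappa> * jump (\<lambda>Q. G Q powr p') R
        \<le> measure N R powr \<kappa> * (\<kappa> * (G R powr r) powr (\<kappa> - 1) * jump (\<lambda>Q. G Q powr r) R)"
        by (intro mult_left_mono) auto
      also have "\<dots> = \<kappa> * (measure N R * G R powr r) powr (\<kappa> - 1) * (measure N R * jump (\<lambda>Q. G Q powr r) R)"
        using pos(2)[OF R] by (simp add: powr_mult powr_diff)
      also have "\<dots> \<le> \<kappa> * Y powr (\<kappa> - 1) * (measure N R * jump (\<lambda>Q. G Q powr r) R)"
      proof (intro mult_right_mono mult_left_mono powr_mono2)
        show "measure N R * G R powr r \<le> Y"
          unfolding Y_def by (rule sum_jump_ge[where h="\<lambda>Q. G Q powr r"]) (use jG0 pr sets pos R in auto)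
      qed (use \<kappa> jG0[OF R] pr in auto)
      finally show "measure N R powr \<kappa> * jump (\<lambda>Q. G Q powr p') R
        \<le> \<kappa> * Y powr (\<kappa> - 1) * (measure N R * jump (\<lambda>Q. G Q powr r) R)" .
    qed (use \<rho> \<rho>1 in auto)
    also have "\<dots> = \<kappa> * (Y powr (\<kappa> - 1) * Y) / (1 - \<rho>)"
      by (simp add: Y_def sum_distrib_left mult.assoc)
    also have "Y powr (\<kappa> - 1) * Y = Y powr \<kappa>" using Y0 by (cases "Y = 0") (auto simp: powr_diff)
    also have "\<kappa> * Y powr \<kappa> / (1 - \<rho>) \<le> \<kappa> * Y powr \<kappa> / (min (\<kappa> - 1) 1 * \<eta>)"
      using \<rho> \<rho>1 \<kappa> \<eta> by (intro divide_left_mono mult_nonneg_nonneg mult_pos_pos) auto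
    also have "\<dots> = c / \<eta> * Y powr \<kappa>" by (simp add: c_def)
    finally show ?thesis .
  qed

  have "(\<Sum>R\<in>S. (measure M R powr (1 / p) * jump F R) * (measure N R powr (1 / r) * G R))
    \<le> (\<Sum>R\<in>S. (measure M R powr (1 / p) * jump F R) powr p) powr (1 / p)
      * (\<Sum>R\<in>S. (measure N R powr (1 / r) * G R) powr p') powr (1 / p')"
    by (rule hoelder_sum) (use pr p' F0 G0 in \<open>auto simp: jump_def\<close>)
  also have "\<dots> \<le> (p' powr p * ?If) powr (1 / p) * (c / \<eta> * Y powr \<kappa>) powr (1 / p')"
    using pr p' by (intro mult_mono powr_mono2 first second) (auto intro!: sum_nonneg)
  also have "(p' powr p * ?If) powr (1 / p) = p' * ?If powr (1 / p)"
    using pr p' I0 by (simp add: powr_mult powr_powr)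
  also have "(c / \<eta> * Y powr \<kappa>) powr (1 / p') = c powr (1 / p') * \<eta> powr (- (1 / p')) * Y powr (1 / r)"
    using c0 \<eta> p' pr by (simp add: powr_mult powr_divide powr_powr powr_minus_divide \<kappa>_def)
  also have "p' * ?If powr (1 / p) * (c powr (1 / p') * \<eta> powr (- (1 / p')) * Y powr (1 / r))
      \<le> p' * ?If powr (1 / p) * (c powr (1 / p') * \<eta> powr (- (1 / p')) * (r / (r - 1) * ?Ig powr (1 / r)))"
  proof (intro mult_left_mono)
    have "Y powr (1 / r) \<le> ((r / (r - 1)) powr r * ?Ig) powr (1 / r)"
      using pr Y0 by (intro powr_mono2 YI) auto
    then show "Y powr (1 / r) \<le> r / (r - 1) * ?Ig powr (1 / r)"
      using pr I0 by (simp add: powr_mult powr_powr)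
  qed (use p' in auto)
  finally show ?thesis using p' 
    by (simp add: decay_const_def c_def \<kappa>_def mult_ac flip: p'_def)
qed

end

section \<open>A pair of measures on a laminar family\<close>

text \<open>\<open>L\<close> plays the role of Lebesgue measure; \<open>U\<close> and \<open>V\<close> are the measures with densities \<open>\<sigma>\<close> and \<open>w\<close>, and
  \<open>s = q / p'\<close>. The last assumption is what Hoelder's inequality gives for the identity \<open>1 = w powr (1 / (1 + s)) * \<sigma> powr (s / (1 + s))\<close>.\<close>
locale weighted_laminar = laminar_family S for S :: "'a set set" +
  fixes L U V :: "'a measure" and p q s :: real
  assumes p: "1 < p" and pq: "p < q" and s: "s = q * (p - 1) / p"
    and sets: "Q \<in> S \<Longrightarrow> Q \<in> sets L" "sets U = sets L" "sets V = sets L"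
    and pos: "Q \<in> S \<Longrightarrow> 0 < measure L Q" "Q \<in> S \<Longrightarrow> 0 < measure U Q" "Q \<in> S \<Longrightarrow> 0 < measure V Q"
    and half: "P \<in> S \<Longrightarrow> Q \<in> S \<Longrightarrow> P \<subset> Q \<Longrightarrow> measure L P \<le> measure L Q / 2"
    and duality: "Q \<in> S \<Longrightarrow> E \<in> sets L \<Longrightarrow> E \<subseteq> Q \<Longrightarrow>
      measure L E powr (1 + s) \<le> measure V E * measure U E powr s"
begin

text \<open>The quantity whose supremum over cubes is the Muckenhoupt constant.\<close>
definition weight_char :: "'a set \<Rightarrow> real" where
  "weight_char Q = measure V Q * measure U Q powr s / measure L Q powr (1 + s)"

lemma q: "1 < q" and s0: "0 < s"
  using p pq by (auto simp: s)

lemma s_eqs: "s / q = 1 - 1 / p" "(1 + s) / q = 1 / q + (1 - 1 / p)"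
  using p q by (auto simp: s diff_divide_distrib add_divide_distrib)

lemma sets': "Q \<in> S \<Longrightarrow> Q \<in> sets U" "Q \<in> S \<Longrightarrow> Q \<in> sets V"
  using sets by auto

lemma weight_char_pos: "Q \<in> S \<Longrightarrow> 0 < weight_char Q"
  using pos[of Q] by (simp add: weight_char_def)

lemma weight_char_ge_1: "Q \<in> S \<Longrightarrow> 1 \<le> weight_char Q"
  using duality[of Q Q] sets pos[of Q] by (simp add: weight_char_def)

lemma fmeasurable_family:
  assumes "Q \<in> S"
  shows "Q \<in> fmeasurable L" "Q \<in> fmeasurable U" "Q \<in> fmeasurable V"
  using assms sets sets' pos[OF assms] by (auto intro!: fmeasurableI dest: emeasure_finite_if_measure_pos)

text \<open>A strict subset \<open>P\<close> omits at least half of \<open>Q\<close> in \<open>L\<close>, hence by duality a definite portion of \<open>Q\<close> in \<open>V\<close> and in \<open>U\<close>.\<close>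
lemma decay:
  assumes "P \<in> S" "Q \<in> S" "P \<subset> Q" and B: "weight_char Q \<le> 2 * B"
  shows "measure V P \<le> (1 - 2 powr (- (2 + s)) / B) * measure V Q"
    and "measure U P \<le> (1 - (2 powr (- (2 + s)) / B) powr (1 / s)) * measure U Q"
proof -
  let ?\<eta> = "2 powr (- (2 + s)) / B"
  have B0: "0 < B" using weight_char_pos[OF assms(2)] B by simp
  note fm = fmeasurable_family[OF assms(1)] fmeasurable_family[OF assms(2)]
  have E: "Q - P \<in> sets L" "Q - P \<subseteq> Q" using sets assms by auto
  have diff: "measure M (Q - P) = measure M Q - measure M P" if "M \<in> {L, U, V}" for M
    using fm that assms by (intro measure_Diff) (auto simp: fmeasurable_def)
  have VE: "0 \<le> measure V (Q - P)" "measure V (Q - P) \<le> measure V Q"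
    and UE: "measure U (Q - P) \<le> measure U Q"
    using diff[of U] diff[of V] measure_mono_fmeasurable[of P Q V] assms(3) fm
    by (auto simp: fmeasurable_def)
  have "(measure L Q / 2) powr (1 + s) \<le> measure L (Q - P) powr (1 + s)"
    using half[OF assms(1-3)] s0 by (intro powr_mono2) (auto simp: diff)
  also have "\<dots> \<le> measure V (Q - P) * measure U (Q - P) powr s"
    by (rule duality[OF assms(2) E])
  finally have E1: "(measure L Q / 2) powr (1 + s) \<le> measure V (Q - P) * measure U (Q - P) powr s" .
  have "measure V Q * measure U Q powr s \<le> 2 * B * measure L Q powr (1 + s)"
    using B pos[OF assms(2)] by (simp add: weight_char_def field_simps)
  then have "?\<eta> * (measure V Q * measure U Q powr s) \<le> ?\<eta> * (2 * B * measure L Q powr (1 + s))"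
    using B0 by (intro mult_left_mono) auto
  also have "\<dots> = (measure L Q / 2) powr (1 + s)"
  proof -
    have "(2::real) powr (2 + s) = 2 * 2 powr (1 + s)" by (simp add: powr_add)
    then have "2 powr (- (2 + s)) = 1 / (2 * 2 powr (1 + s))" by (simp only: powr_minus_divide)
    then show ?thesis using pos[OF assms(2)] B0 by (simp add: powr_divide)
  qed
  finally have E2: "?\<eta> * (measure V Q * measure U Q powr s) \<le> measure V (Q - P) * measure U (Q - P) powr s"
    using E1 by linarith
  have "measure V (Q - P) * measure U (Q - P) powr s \<le> measure V (Q - P) * measure U Q powr s"
    using UE s0 VE by (intro mult_left_mono powr_mono2) auto
  with E2 have "?\<eta> * measure V Q * measure U Q powr s \<le> measure V (Q - P) * measure U Q powr s"
    by (simp only: mult.assoc)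
  then have "?\<eta> * measure V Q \<le> measure V (Q - P)"
    by (rule mult_right_le_imp_le) (use pos[OF assms(2)] in auto)
  then show "measure V P \<le> (1 - ?\<eta>) * measure V Q"
    using diff[of V] by (simp add: algebra_simps)
  have "measure V (Q - P) * measure U (Q - P) powr s \<le> measure V Q * measure U (Q - P) powr s"
    using VE by (intro mult_right_mono) auto
  with E2 have "measure V Q * (?\<eta> * measure U Q powr s) \<le> measure V Q * measure U (Q - P) powr s"
    by (simp only: mult_ac)
  then have "?\<eta> * measure U Q powr s \<le> measure U (Q - P) powr s"
    by (rule mult_left_le_imp_le) (use pos[OF assms(2)] in auto)
  then have "(?\<eta> * measure U Q powr s) powr (1 / s) \<le> (measure U (Q - P) powr s) powr (1 / s)"
    using B0 s0 by (intro powr_mono2) auto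
  moreover have "(?\<eta> * measure U Q powr s) powr (1 / s) = ?\<eta> powr (1 / s) * measure U Q"
    using s0 B0 pos[OF assms(2)] by (subst powr_mult) (auto simp: powr_powr)
  ultimately have "?\<eta> powr (1 / s) * measure U Q \<le> measure U (Q - P)"
    using s0 by (simp add: powr_powr)
  then show "measure U P \<le> (1 - ?\<eta> powr (1 / s)) * measure U Q"
    using diff[of U] by (simp add: algebra_simps)
qed

text \<open>Two ways of writing the coefficient of the bilinear form: the free parameter \<open>e\<close> moves a power of the weight characteristic in or out. For \<open>e > 0\<close> the bracket contains a positive power of \<open>L(Q)\<close>, which makes it summable over descendants.\<close>
lemma kernel_eq:
  assumes "Q \<in> S"
  shows "measure L Q powr (- (1 / q + (1 - 1 / p))) * measure U Q * measure V Q
    = weight_char Q powr (1 / q + e) * (measure L Q powr ((1 + s) * e) * measure U Q powr (1 / p - s * e) * measure V Q powr (1 - 1 / q - e))"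
    (is ?A)
  and "measure L Q powr ((1 + s) * e) * measure U Q powr (1 / p - s * e) * measure V Q powr (1 - 1 / q - e)
    = weight_char Q powr (- e) * (measure U Q powr (1 / p) * measure V Q powr (1 - 1 / q))" (is ?B)
proof -
  have l: "ln (weight_char Q) = ln (measure V Q) + s * ln (measure U Q) - (1 + s) * ln (measure L Q)"
    using pos[OF assms] pos[OF assms, THEN less_imp_neq, THEN not_sym]
    by (simp add: weight_char_def ln_mult ln_div ln_powr)
  let ?l = "ln (measure L Q)" and ?u = "ln (measure U Q)" and ?v = "ln (measure V Q)" and ?c = "ln (weight_char Q)"
  have pw: "x powr y = exp (y * ln x)" if "0 < x" for x y :: real using that by (simp add: powr_def)
  have "- (1 / q + (1 - 1 / p)) * ?l + ?u + ?v = (1 / q + e) * ?c + ((1 + s) * e * ?l + (1 / p - s * e) * ?u + (1 - 1 / q - e) * ?v)"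
  proof -
    have "1 / q * ?c = ?v / q + s / q * ?u - (1 + s) / q * ?l" unfolding l by (simp add: algebra_simps add_divide_distrib diff_divide_distrib)
    also have "\<dots> = ?v / q + (1 - 1 / p) * ?u - (1 / q + (1 - 1 / p)) * ?l" unfolding s_eqs by simp
    finally have "(1 / q + e) * ?c = ?v / q + (1 - 1 / p) * ?u - (1 / q + (1 - 1 / p)) * ?l + e * (?v + s * ?u - (1 + s) * ?l)"
      unfolding distrib_right l by simp
    then show ?thesis by (simp add: algebra_simps)
  qed
  then have "exp (- (1 / q + (1 - 1 / p)) * ?l + ?u + ?v) = exp ((1 / q + e) * ?c + ((1 + s) * e * ?l + (1 / p - s * e) * ?u + (1 - 1 / q - e) * ?v))"
    by (simp only:)
  then show ?A by (simp only: exp_add exp_ln pos[OF assms] pw weight_char_pos[OF assms])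
  have "(1 + s) * e * ?l + (1 / p - s * e) * ?u + (1 - 1 / q - e) * ?v = - e * ?c + (1 / p * ?u + (1 - 1 / q) * ?v)"
    unfolding l by (simp add: algebra_simps)
  then have "exp ((1 + s) * e * ?l + (1 / p - s * e) * ?u + (1 - 1 / q - e) * ?v) = exp (- e * ?c + (1 / p * ?u + (1 - 1 / q) * ?v))"
    by (simp only:)
  then show ?B by (simp only: exp_add exp_ln pos[OF assms] pw weight_char_pos[OF assms])
qed

lemma children_sum_le:
  fixes a b c d :: real
  assumes abc: "0 \<le> b" "0 \<le> c" "0 \<le> d" "d \<le> a" "1 \<le> a - d + b + c"
    and C: "Q \<in> S" "C \<subseteq> S" "\<And>P. P \<in> C \<Longrightarrow> P \<subset> Q" "disjoint C"
  shows "(\<Sum>P\<in>C. measure L P powr a * measure U P powr b * measure V P powr c)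
    \<le> 2 powr (- d) * (measure L Q powr a * measure U Q powr b * measure V Q powr c)"
proof -
  let ?T = "\<lambda>Q. measure L Q powr a * measure U Q powr b * measure V Q powr c"
  let ?s = "a - d + b + c"
  let ?x = "\<lambda>M P. measure M P / measure M Q"
  note Q = pos[OF C(1)]
  have "(\<Sum>P\<in>C. ?T P) \<le> (\<Sum>P\<in>C. 2 powr (- d) * ?T Q * (((a - d) * ?x L P + b * ?x U P + c * ?x V P) / ?s))"
  proof (intro sum_mono)
    fix P assume P: "P \<in> C"
    then have PS: "P \<in> S" "P \<subset> Q" using C by auto
    note pp = pos[OF PS(1)]
    have x1: "?x L P \<le> 1" "?x U P \<le> 1" "?x V P \<le> 1"
      using fmeasurable_family[OF C(1)] fmeasurable_family[OF PS(1)] PS Q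
      by (auto simp: divide_le_eq_1 intro!: measure_mono_fmeasurable)
    have "?T P = measure L P powr d * (measure L P powr (a - d) * measure U P powr b * measure V P powr c)"
      using pp by (simp add: powr_diff)
    also have "\<dots> \<le> (measure L Q / 2) powr d * (measure L P powr (a - d) * measure U P powr b * measure V P powr c)"
      using half[OF PS(1) C(1) PS(2)] pp abc by (intro mult_right_mono powr_mono2) auto
    also have "\<dots> = 2 powr (- d) * ?T Q * (?x L P powr (a - d) * ?x U P powr b * ?x V P powr c)"
      using pp Q by (simp add: powr_divide powr_minus powr_diff field_simps)
    also have "\<dots> \<le> 2 powr (- d) * ?T Q * (((a - d) * ?x L P + b * ?x U P + c * ?x V P) / ?s)"
      using x1 abc pp Q by (intro mult_left_mono powr_prod_le_weighted_sum) auto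
    finally show "?T P \<le> \<dots>" .
  qed
  also have "\<dots> = 2 powr (- d) * ?T Q * (((a - d) * (\<Sum>P\<in>C. ?x L P) + b * (\<Sum>P\<in>C. ?x U P) + c * (\<Sum>P\<in>C. ?x V P)) / ?s)"
    by (simp only: sum_distrib_left[symmetric] sum.distrib sum_divide_distrib[symmetric])
  also have "\<dots> \<le> 2 powr (- d) * ?T Q * (((a - d) * 1 + b * 1 + c * 1) / ?s)"
  proof (intro mult_left_mono divide_right_mono add_mono)
    have "(\<Sum>P\<in>C. measure M P / measure M Q) \<le> 1" if "M \<in> {L, U, V}" for M
      using sum_measure_disjoint_le[of M Q C] sets sets' pos C that Q
      by (auto simp: sum_divide_distrib[symmetric] divide_le_eq_1)
    then show "(\<Sum>P\<in>C. ?x L P) \<le> 1" "(\<Sum>P\<in>C. ?x U P) \<le> 1" "(\<Sum>P\<in>C. ?x V P) \<le> 1" by auto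
  qed (use abc in auto)
  also have "\<dots> = 2 powr (- d) * ?T Q" using abc by simp
  finally show ?thesis .
qed

end

section \<open>The bilinear form on a class of sets with comparable weight characteristic\<close>

text \<open>The parameter \<open>e\<close> of lemma \<open>kernel_eq\<close>, small enough to keep all exponents nonnegative.\<close>
definition pinned_eps :: "real \<Rightarrow> real \<Rightarrow> real" where
  "pinned_eps p q = min (1 / (q * (p - 1))) (1 - 1 / q) / 2"

text \<open>The ratio of the geometric series in the sum over descendants.\<close>
definition pinned_ratio :: "real \<Rightarrow> real \<Rightarrow> real" where
  "pinned_ratio p q = 2 powr (- min ((1 + q * (p - 1) / p) * pinned_eps p q) (1 / p - 1 / q))"

text \<open>The exponent \<open>1 / q + max (1 / p') (p' / q\<^sup>2)\<close>; lemma \<open>sharp_exp_eq\<close> brings it into the form of the theorem.\<close>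
definition sharp_exp :: "real \<Rightarrow> real \<Rightarrow> real" where
  "sharp_exp p q = 1 / q + max (1 - 1 / p) (p / (q * q * (p - 1)))"

text \<open>The constant of lemma \<open>pinned_bilinear_bound\<close>. The two summands belong to the two terms of the product rule for increments.\<close>
definition pinned_const :: "real \<Rightarrow> real \<Rightarrow> real" where
  "pinned_const p q = 2 powr (1 / q + pinned_eps p q) / (1 - pinned_ratio p q) *
     (decay_const p (q / (q - 1)) * 2 powr ((2 + q * (p - 1) / p) * (1 - 1 / p))
      + decay_const (q / (q - 1)) p * 2 powr ((2 + q * (p - 1) / p) * (p / (q * q * (p - 1)))))"

text \<open>The second factor comes from summing the geometric series over the dyadic classes of the weight characteristic.\<close>
definition bilinear_const :: "real \<Rightarrow> real \<Rightarrow> real" where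
  "bilinear_const p q = pinned_const p q * (2 powr sharp_exp p q / (2 powr sharp_exp p q - 1))"

lemma decay_const_pos:
  assumes "1 < p" "1 < r" "1 < 1 / p + 1 / r"
  shows "0 < decay_const p r"
proof -
  have "1 < p / (p - 1) / r"
  proof -
    have "1 - 1 / p < 1 / r" using assms by linarith
    then show ?thesis using assms by (simp add: field_simps)
  qed
  then have "0 < p / (p - 1) / r / min (p / (p - 1) / r - 1) 1"
    using assms by (intro divide_pos_pos) auto
  then show ?thesis using assms unfolding decay_const_def by (intro mult_pos_pos) auto
qed

context weighted_laminar
begin

lemma eps: "0 < pinned_eps p q" "s * pinned_eps p q \<le> 1 / p" "pinned_eps p q \<le> 1 - 1 / q"
  "0 < pinned_ratio p q" "pinned_ratio p q < 1"
proof -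
  show e0: "0 < pinned_eps p q" using p q by (auto simp: pinned_eps_def)
  have half_min: "min x y / 2 \<le> x" "min x y / 2 \<le> y" if "0 < x" "0 < y" for x y :: real
    using that by auto
  have "0 < 1 / (q * (p - 1))" "0 < 1 - 1 / q" using p q by auto
  note half_min[OF this, folded pinned_eps_def]
  then have "s * pinned_eps p q \<le> s * (1 / (q * (p - 1)))"
    using s0 by (intro mult_left_mono) auto
  also have "\<dots> = 1 / p" using p q by (simp add: s)
  finally show "s * pinned_eps p q \<le> 1 / p" .
  show "pinned_eps p q \<le> 1 - 1 / q" by fact
  show "0 < pinned_ratio p q" by (simp add: pinned_ratio_def)
  have "1 / q < 1 / p" using p pq by (intro divide_strict_left_mono) auto
  then have "0 < min ((1 + s) * pinned_eps p q) (1 / p - 1 / q)"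
    using e0 s0 by simp
  then have "2 powr (- min ((1 + s) * pinned_eps p q) (1 / p - 1 / q)) < 2 powr (0::real)"
    by (intro powr_less_mono) auto
  then show "pinned_ratio p q < 1" by (simp add: pinned_ratio_def s)
qed

lemma pinned_const_pos: "0 < pinned_const p q"
proof -
  have "1 / q < 1 / p" using p pq by (intro divide_strict_left_mono) auto
  then have "1 < 1 / p + 1 / (q / (q - 1))" "1 < 1 / (q / (q - 1)) + 1 / p"
    using q by (auto simp: diff_divide_distrib)
  then have "0 < decay_const p (q / (q - 1))" "0 < decay_const (q / (q - 1)) p"
    using p q by (auto intro!: decay_const_pos)
  then show ?thesis using eps unfolding pinned_const_def by (intro mult_pos_pos divide_pos_pos add_pos_pos) auto
qed

text \<open>The bilinear form on a class of sets whose weight characteristic is pinned to \<open>[B, 2 B]\<close>.\<close>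
lemma pinned_bilinear_bound:
  fixes f g :: "'a \<Rightarrow> real"
  assumes B: "1 \<le> B" "\<And>Q. Q \<in> S \<Longrightarrow> B \<le> weight_char Q" "\<And>Q. Q \<in> S \<Longrightarrow> weight_char Q \<le> 2 * B"
    and f: "f \<in> borel_measurable U" "\<And>x. 0 \<le> f x" "\<And>Q. Q \<in> S \<Longrightarrow> set_integrable U Q f"
      "integrable U (\<lambda>x. f x powr p)"
    and g: "g \<in> borel_measurable V" "\<And>x. 0 \<le> g x" "\<And>Q. Q \<in> S \<Longrightarrow> set_integrable V Q g"
      "integrable V (\<lambda>x. g x powr (q / (q - 1)))"
  shows "(\<Sum>Q\<in>S. measure L Q powr (- (1 / q + (1 - 1 / p))) * (LINT x:Q|U. f x) * (LINT x:Q|V. g x))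
    \<le> pinned_const p q * B powr sharp_exp p q *
      ((\<integral>x. f x powr p \<partial>U) powr (1 / p) * (\<integral>x. g x powr (q / (q - 1)) \<partial>V) powr (1 - 1 / q))"
proof -
  define e where "e = pinned_eps p q"
  define \<rho> where "\<rho> = pinned_ratio p q"
  define q' where "q' = q / (q - 1)"
  define F where "F = running_max (average U f)"
  define G where "G = running_max (average V g)"
  define T where "T Q = measure L Q powr ((1 + s) * e) * measure U Q powr (1 / p - s * e) * measure V Q powr (1 - 1 / q - e)" for Q
  define W where "W Q = measure U Q powr (1 / p) * measure V Q powr (1 - 1 / q)" for Q
  define \<eta> where "\<eta> = 2 powr (- (2 + s)) / B"
  define N where "N = (\<integral>x. f x powr p \<partial>U) powr (1 / p) * (\<integral>x. g x powr q' \<partial>V) powr (1 - 1 / q)"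
  note e = eps[folded e_def \<rho>_def]
  have q': "1 < q'" "1 / q' = 1 - 1 / q" using q by (auto simp: q'_def diff_divide_distrib)
  have qp: "1 / q < 1 / p" using p pq by (intro divide_strict_left_mono) auto
  have F0: "0 \<le> F Q" "0 \<le> prev F Q" "prev F Q \<le> F Q" "average U f Q \<le> F Q" if "Q \<in> S" for Q
    using that average_nonneg[of f U, OF f(2)] running_max_nonneg[of "average U f" Q] prev_running_max[of "average U f" Q]
      running_max_ge[of "average U f" Q] unfolding F_def by blast+
  have G0: "0 \<le> G Q" "0 \<le> prev G Q" "prev G Q \<le> G Q" "average V g Q \<le> G Q" if "Q \<in> S" for Q
    using that average_nonneg[of g V, OF g(2)] running_max_nonneg[of "average V g" Q] prev_running_max[of "average V g" Q]
      running_max_ge[of "average V g" Q] unfolding G_def by blast+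
  have T0: "0 \<le> T Q" for Q by (simp add: T_def)
  have W0: "0 \<le> W Q" for Q by (simp add: W_def)
  have N0: "0 \<le> N" by (simp add: N_def)
  define c where "c = (2 * B) powr (1 / q + e)"
  have c0: "0 < c" using B by (simp add: c_def)
  have jump_prod: "jump (\<lambda>Q. F Q * G Q) R = F R * G R - prev F R * prev G R" for R
    by (simp add: jump_def prev_mult)
  have "(\<Sum>Q\<in>S. measure L Q powr (- (1 / q + (1 - 1 / p))) * (LINT x:Q|U. f x) * (LINT x:Q|V. g x))
    \<le> (\<Sum>Q\<in>S. c * (T Q * (F Q * G Q)))"
  proof (intro sum_mono)
    fix Q assume Q: "Q \<in> S"
    note pQ = pos[OF Q]
    have "measure L Q powr (- (1 / q + (1 - 1 / p))) * (LINT x:Q|U. f x) * (LINT x:Q|V. g x)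
      = (measure L Q powr (- (1 / q + (1 - 1 / p))) * measure U Q * measure V Q) * (average U f Q * average V g Q)"
      using pQ by (simp add: average_def)
    also have "\<dots> = weight_char Q powr (1 / q + e) * T Q * (average U f Q * average V g Q)"
      unfolding kernel_eq(1)[OF Q, of e] T_def ..
    also have "\<dots> \<le> c * T Q * (F Q * G Q)"
      unfolding c_def using B(3)[OF Q] weight_char_pos[OF Q] F0[OF Q] G0[OF Q] T0 q e
      by (intro mult_mono powr_mono2 average_nonneg f g mult_nonneg_nonneg) auto
    finally show "measure L Q powr (- (1 / q + (1 - 1 / p))) * (LINT x:Q|U. f x) * (LINT x:Q|V. g x) \<le> c * (T Q * (F Q * G Q))"
      by (simp add: mult.assoc)
  qed
  also have "\<dots> = c * (\<Sum>Q\<in>S. T Q * (F Q * G Q))" by (simp add: sum_distrib_left)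
  also have "\<dots> \<le> c * ((\<Sum>Q\<in>S. T Q * jump (\<lambda>Q. F Q * G Q) Q) / (1 - \<rho>))"
  proof (rule mult_left_mono)
    show "(\<Sum>Q\<in>S. T Q * (F Q * G Q)) \<le> (\<Sum>Q\<in>S. T Q * jump (\<lambda>Q. F Q * G Q) Q) / (1 - \<rho>)"
    proof (rule sum_prod_jump_le)
      fix Q assume "Q \<in> S"
      from F0[OF this] G0[OF this] show "0 \<le> jump (\<lambda>Q. F Q * G Q) Q"
        unfolding jump_prod by (simp add: mult_mono)
    next
      fix Q C assume C: "Q \<in> S" "C \<subseteq> S" "\<And>P. P \<in> C \<Longrightarrow> P \<subset> Q" "disjoint C"
      have "min ((1 + s) * e) (1 / p - 1 / q) \<le> (1 + s) * e" "min ((1 + s) * e) (1 / p - 1 / q) \<le> 1 / p - 1 / q"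
        "0 \<le> min ((1 + s) * e) (1 / p - 1 / q)"
        using e s0 qp by auto
      then show "(\<Sum>P\<in>C. T P) \<le> \<rho> * T Q"
        unfolding T_def \<rho>_def pinned_ratio_def s[symmetric] e_def[symmetric] using e
        by (intro children_sum_le C) (auto simp: algebra_simps)
    qed (use e T0 in auto)
  qed (use c0 in simp)
  also have "\<dots> = c / (1 - \<rho>) * (\<Sum>Q\<in>S. T Q * jump (\<lambda>Q. F Q * G Q) Q)" by simp
  also have "\<dots> \<le> c / (1 - \<rho>) * (\<Sum>Q\<in>S. B powr (- e) * (W Q * (jump F Q * G Q + F Q * jump G Q)))"
  proof (intro mult_left_mono sum_mono)
    fix Q assume Q: "Q \<in> S"
    have "T Q = weight_char Q powr (- e) * W Q"
      unfolding T_def W_def by (rule kernel_eq(2)[OF Q])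
    also have "\<dots> \<le> B powr (- e) * W Q"
      using B(1) B(2)[OF Q] e W0 by (intro mult_right_mono powr_mono2') auto
    finally have T: "T Q \<le> B powr (- e) * W Q" .
    have "prev F Q * (G Q - prev G Q) \<le> F Q * (G Q - prev G Q)"
      using F0[OF Q] G0[OF Q] by (intro mult_right_mono) auto
    then have J: "jump (\<lambda>Q. F Q * G Q) Q \<le> jump F Q * G Q + F Q * jump G Q"
      unfolding jump_prod by (simp add: jump_def algebra_simps)
    have J0: "0 \<le> jump F Q * G Q + F Q * jump G Q"
      using F0[OF Q] G0[OF Q] by (simp add: jump_def)
    have "T Q * jump (\<lambda>Q. F Q * G Q) Q \<le> T Q * (jump F Q * G Q + F Q * jump G Q)"
      using T0 J by (intro mult_left_mono)
    also have "\<dots> \<le> B powr (- e) * W Q * (jump F Q * G Q + F Q * jump G Q)"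
      using T J0 by (intro mult_right_mono)
    finally show "T Q * jump (\<lambda>Q. F Q * G Q) Q \<le> B powr (- e) * (W Q * (jump F Q * G Q + F Q * jump G Q))"
      by (simp add: mult.assoc)
  qed (use c0 e in auto)
  also have "\<dots> = c / (1 - \<rho>) * B powr (- e) *
     ((\<Sum>R\<in>S. (measure U R powr (1 / p) * jump F R) * (measure V R powr (1 / q') * G R))
    + (\<Sum>R\<in>S. (measure V R powr (1 / q') * jump G R) * (measure U R powr (1 / p) * F R)))"
    unfolding q'(2) W_def by (simp add: sum_distrib_left sum.distrib[symmetric] algebra_simps)
  also have "\<dots> \<le> c / (1 - \<rho>) * B powr (- e) *
     (decay_const p q' * \<eta> powr (- (1 - 1 / p)) * N + decay_const q' p * (\<eta> powr (1 / s)) powr (- (1 / q)) * N)"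
  proof (intro mult_left_mono add_mono)
    have "2 powr (- (2 + s)) \<le> (2::real) powr 0" using s0 by (intro powr_mono) auto
    then have \<eta>: "0 < \<eta>" "\<eta> \<le> 1" using B(1) by (auto simp: \<eta>_def divide_le_eq)
    have d: "measure V P \<le> (1 - \<eta>) * measure V Q" "measure U P \<le> (1 - \<eta> powr (1 / s)) * measure U Q"
      if "P \<in> S" "Q \<in> S" "P \<subset> Q" for P Q
      using decay[OF that B(3)] that by (auto simp: \<eta>_def)
    have pp: "1 / (p / (p - 1)) = 1 - 1 / p" "q' / (q' - 1) = q"
      using p q by (auto simp: q'_def field_simps)
    have "(\<Sum>R\<in>S. (measure U R powr (1 / p) * jump F R) * (measure V R powr (1 / q') * G R))
      \<le> decay_const p q' * \<eta> powr (- (1 / (p / (p - 1)))) *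
        ((\<integral>x. f x powr p \<partial>U) powr (1 / p) * (\<integral>x. g x powr q' \<partial>V) powr (1 / q'))"
      unfolding F_def G_def
      by (rule sum_jump_decay_le) (use sets' pos f g q' p qp \<eta> d in \<open>auto simp: q'_def[symmetric]\<close>)
    then show "(\<Sum>R\<in>S. (measure U R powr (1 / p) * jump F R) * (measure V R powr (1 / q') * G R))
      \<le> decay_const p q' * \<eta> powr (- (1 - 1 / p)) * N"
      by (simp only: pp N_def q')
    have "\<eta> powr (1 / s) \<le> 1 powr (1 / s)" using \<eta> s0 by (intro powr_mono2) auto
    then have \<eta>': "0 < \<eta> powr (1 / s)" "\<eta> powr (1 / s) \<le> 1" using \<eta> by auto
    have "(\<Sum>R\<in>S. (measure V R powr (1 / q') * jump G R) * (measure U R powr (1 / p) * F R))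
      \<le> decay_const q' p * (\<eta> powr (1 / s)) powr (- (1 / (q' / (q' - 1)))) *
        ((\<integral>x. g x powr q' \<partial>V) powr (1 / q') * (\<integral>x. f x powr p \<partial>U) powr (1 / p))"
      unfolding F_def G_def
      by (rule sum_jump_decay_le) (use sets' pos f g q' p qp \<eta>' d in \<open>auto simp: q'_def[symmetric]\<close>)
    then show "(\<Sum>R\<in>S. (measure V R powr (1 / q') * jump G R) * (measure U R powr (1 / p) * F R))
      \<le> decay_const q' p * (\<eta> powr (1 / s)) powr (- (1 / q)) * N"
      by (simp only: pp N_def q' mult.commute)
  qed (use c0 e in auto)
  also have "\<dots> \<le> pinned_const p q * B powr sharp_exp p q * N"
  proof -
    define x where "x = 1 - 1 / p"
    define y where "y = p / (q * q * (p - 1))"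
    have y: "1 / s * (1 / q) = y" using p q by (simp add: y_def s)
    have B0: "0 < B" using B by simp
    have \<eta>_powr: "\<eta> powr (- t) = 2 powr ((2 + s) * t) * B powr t" for t
    proof -
      have "\<eta> = 2 powr (- (2 + s)) * B powr (- 1)"
        using B0 by (simp add: \<eta>_def powr_minus_divide)
      also have "\<dots> powr (- t) = (2 powr (- (2 + s))) powr (- t) * (B powr (- 1)) powr (- t)"
        by (simp only: powr_mult)
      finally show ?thesis by (simp only: powr_powr minus_mult_minus mult_1)
    qed
    have "\<eta> powr (- x) = 2 powr ((2 + s) * x) * B powr x"
      by (rule \<eta>_powr)
    also have "\<dots> \<le> 2 powr ((2 + s) * x) * B powr (max x y)"
      using B by (intro mult_left_mono powr_mono) auto
    finally have 1: "\<eta> powr (- x) \<le> 2 powr ((2 + s) * x) * B powr (max x y)" .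
    have "(\<eta> powr (1 / s)) powr (- (1 / q)) = \<eta> powr (- y)"
      using y by (simp add: powr_powr)
    also have "\<dots> = 2 powr ((2 + s) * y) * B powr y"
      by (rule \<eta>_powr)
    also have "\<dots> \<le> 2 powr ((2 + s) * y) * B powr (max x y)"
      using B by (intro mult_left_mono powr_mono) auto
    finally have 2: "(\<eta> powr (1 / s)) powr (- (1 / q)) \<le> 2 powr ((2 + s) * y) * B powr (max x y)" .
    have "1 < 1 / p + 1 / q'" "1 < 1 / q' + 1 / p" using qp q' by auto
    then have dc: "0 < decay_const p q'" "0 < decay_const q' p"
      using p q' by (auto intro!: decay_const_pos)
    have "decay_const p q' * \<eta> powr (- x) * N + decay_const q' p * (\<eta> powr (1 / s)) powr (- (1 / q)) * N
      \<le> decay_const p q' * (2 powr ((2 + s) * x) * B powr (max x y)) * N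
        + decay_const q' p * (2 powr ((2 + s) * y) * B powr (max x y)) * N"
      using 1 2 dc N0 by (intro add_mono mult_right_mono mult_left_mono) auto
    also have "\<dots> = (decay_const p q' * 2 powr ((2 + s) * x) + decay_const q' p * 2 powr ((2 + s) * y)) * B powr (max x y) * N"
      by (simp add: algebra_simps)
    finally have "c / (1 - \<rho>) * B powr (- e) * (decay_const p q' * \<eta> powr (- x) * N + decay_const q' p * (\<eta> powr (1 / s)) powr (- (1 / q)) * N)
      \<le> c / (1 - \<rho>) * B powr (- e) * ((decay_const p q' * 2 powr ((2 + s) * x) + decay_const q' p * 2 powr ((2 + s) * y)) * B powr (max x y) * N)"
      using c0 e by (intro mult_left_mono) auto
    also have "\<dots> = 2 powr (1 / q + e) / (1 - \<rho>) * (decay_const p q' * 2 powr ((2 + s) * x) + decay_const q' p * 2 powr ((2 + s) * y))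
      * (B powr (1 / q + e) * B powr (- e) * B powr (max x y)) * N"
      using B0 by (simp add: c_def powr_mult)
    also have "B powr (1 / q + e) * B powr (- e) * B powr (max x y) = B powr sharp_exp p q"
      by (simp add: sharp_exp_def x_def y_def flip: powr_add)
    finally show ?thesis
      by (simp only: pinned_const_def x_def y_def e_def \<rho>_def s q'_def)
  qed
  finally show ?thesis by (simp only: N_def q'_def)
qed

end

section \<open>The bilinear form and the dyadic operator on the whole family\<close>

context weighted_laminar
begin

lemma weighted_laminar_subset:
  assumes "S' \<subseteq> S"
  shows "weighted_laminar S' L U V p q s"
proof
  show "finite S'" using assms finite_family finite_subset by blast
qed (use assms laminar empty_notin p pq s sets pos half duality in \<open>auto simp: subset_iff\<close>)

lemma sharp_exp_pos: "0 < sharp_exp p q"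
  using p q by (auto simp: sharp_exp_def le_max_iff_disj intro!: add_pos_nonneg)

lemma bilinear_const_pos: "0 < bilinear_const p q"
proof -
  have "(1::real) < 2 powr sharp_exp p q" using sharp_exp_pos by simp
  then show ?thesis unfolding bilinear_const_def
    using pinned_const_pos by (intro mult_pos_pos divide_pos_pos) auto
qed

lemma bilinear_bound:
  fixes f g :: "'a \<Rightarrow> real"
  assumes A: "\<And>Q. Q \<in> S \<Longrightarrow> weight_char Q \<le> A"
    and f: "f \<in> borel_measurable U" "\<And>x. 0 \<le> f x" "\<And>Q. Q \<in> S \<Longrightarrow> set_integrable U Q f"
      "integrable U (\<lambda>x. f x powr p)"
    and g: "g \<in> borel_measurable V" "\<And>x. 0 \<le> g x" "\<And>Q. Q \<in> S \<Longrightarrow> set_integrable V Q g"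
      "integrable V (\<lambda>x. g x powr (q / (q - 1)))"
  shows "(\<Sum>Q\<in>S. measure L Q powr (- (1 / q + (1 - 1 / p))) * (LINT x:Q|U. f x) * (LINT x:Q|V. g x))
    \<le> bilinear_const p q * A powr sharp_exp p q *
      ((\<integral>x. f x powr p \<partial>U) powr (1 / p) * (\<integral>x. g x powr (q / (q - 1)) \<partial>V) powr (1 - 1 / q))"
    (is "sum ?t S \<le> _ * ?N")
proof (cases "S = {}")
  case True
  have "0 \<le> bilinear_const p q" using bilinear_const_pos by simp
  then show ?thesis using True by simp
next
  case False
  then obtain Q0 where "Q0 \<in> S" by blast
  with A[of Q0] weight_char_ge_1[of Q0] have A1: "1 \<le> A" by simp
  \<comment> \<open>The characteristic is at least \<open>1\<close>, so the classes start at level \<open>0\<close>.\<close>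
  define level where "level Q = nat \<lfloor>log 2 (weight_char Q)\<rfloor>" for Q
  define K where "K = nat \<lfloor>log 2 A\<rfloor>"
  define e where "e = sharp_exp p q"
  have e: "0 < e" "1 < 2 powr e" using sharp_exp_pos by (auto simp: e_def)
  have level: "2 ^ level Q \<le> weight_char Q" "weight_char Q \<le> 2 * 2 ^ level Q" if "Q \<in> S" for Q
  proof -
    have l0: "0 \<le> log 2 (weight_char Q)" using weight_char_ge_1[OF that] by simp
    have "real (level Q) \<le> log 2 (weight_char Q)" "log 2 (weight_char Q) \<le> real (level Q) + 1"
      using l0 by (auto simp: level_def)
    then have "2 powr real (level Q) \<le> 2 powr log 2 (weight_char Q)" "2 powr log 2 (weight_char Q) \<le> 2 powr (real (level Q) + 1)"
      by (auto intro!: powr_mono)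
    then show "2 ^ level Q \<le> weight_char Q" "weight_char Q \<le> 2 * 2 ^ level Q"
      using weight_char_pos[OF that] by (auto simp: powr_add powr_realpow)
  qed
  have K: "(2 powr e) ^ K \<le> A powr e"
  proof -
    have "real K \<le> log 2 A" using A1 by (simp add: K_def)
    then have "2 powr real K \<le> 2 powr log 2 A" by (intro powr_mono) auto
    then have "2 powr real K \<le> A" using A1 by simp
    then have "(2 powr real K) powr e \<le> A powr e" using e by (intro powr_mono2) auto
    then show ?thesis by (simp add: powr_powr powr_realpow[symmetric] mult.commute)
  qed
  have "sum ?t S = (\<Sum>k\<in>{..K}. sum ?t {Q \<in> S. level Q = k})"
  proof (rule sum.group[symmetric])
    show "level ` S \<subseteq> {..K}"
      using A weight_char_pos A1 by (auto simp: level_def K_def intro!: nat_mono floor_mono log_mono)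
  qed (use finite_family in auto)
  also have "\<dots> \<le> (\<Sum>k\<in>{..K}. pinned_const p q * (2 ^ k) powr e * ?N)"
  proof (rule sum_mono)
    fix k
    interpret Sk: weighted_laminar "{Q \<in> S. level Q = k}" L U V p q s
      by (rule weighted_laminar_subset) auto
    show "sum ?t {Q \<in> S. level Q = k} \<le> pinned_const p q * (2 ^ k) powr e * ?N"
      unfolding e_def by (rule Sk.pinned_bilinear_bound) (use f g level in auto)
  qed
  also have "\<dots> = pinned_const p q * (\<Sum>k\<in>{..K}. (2 powr e) ^ k) * ?N"
    by (simp add: sum_distrib_left sum_distrib_right powr_realpow[symmetric] powr_powr mult.commute)
  also have "\<dots> \<le> pinned_const p q * (2 powr e / (2 powr e - 1) * A powr e) * ?N"
  proof (intro mult_right_mono mult_left_mono)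
    have "(\<Sum>k\<in>{..K}. (2 powr e) ^ k) = ((2 powr e) ^ Suc K - 1) / (2 powr e - 1)"
      using geometric_sum[of "2 powr e" "Suc K"] e(2) by (simp only: lessThan_Suc_atMost)
    also have "\<dots> \<le> (2 powr e * A powr e) / (2 powr e - 1)"
    proof (rule divide_right_mono)
      have "2 powr e * (2 powr e) ^ K \<le> 2 powr e * A powr e"
        using K by (intro mult_left_mono) auto
      then show "(2 powr e) ^ Suc K - 1 \<le> 2 powr e * A powr e"
        unfolding power_Suc by linarith
    qed (use e(2) in linarith)
    finally show "(\<Sum>k\<in>{..K}. (2 powr e) ^ k) \<le> 2 powr e / (2 powr e - 1) * A powr e" by simp
  qed (use pinned_const_pos in auto)
  finally show ?thesis by (simp add: bilinear_const_def e_def mult.assoc)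
qed

text \<open>The bilinear bound, applied with \<open>g = H powr (q - 1)\<close>. The integral of \<open>H powr q\<close> is finite because \<open>H\<close> is a finite sum of multiples of indicators, so it can be cancelled.\<close>
lemma strong_bound:
  fixes f :: "'a \<Rightarrow> real"
  assumes A: "\<And>Q. Q \<in> S \<Longrightarrow> weight_char Q \<le> A" and A0: "0 \<le> A"
    and f: "f \<in> borel_measurable U" "\<And>x. 0 \<le> f x" "\<And>Q. Q \<in> S \<Longrightarrow> set_integrable U Q f"
      "integrable U (\<lambda>x. f x powr p)"
  defines "H \<equiv> \<lambda>x. \<Sum>Q\<in>S. measure L Q powr (- (1 / q + (1 - 1 / p))) * (LINT y:Q|U. f y) * indicator Q x"
  shows "integrable V (\<lambda>x. H x powr q)"
    and "(\<integral>x. H x powr q \<partial>V) \<le> (bilinear_const p q * A powr sharp_exp p q * (\<integral>x. f x powr p \<partial>U) powr (1 / p)) powr q"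
proof -
  define c where "c Q = measure L Q powr (- (1 / q + (1 - 1 / p))) * (LINT y:Q|U. f y)" for Q
  have c0: "0 \<le> c Q" for Q
    unfolding c_def set_lebesgue_integral_def using f by (intro mult_nonneg_nonneg integral_nonneg_AE AE_I2) auto
  have H: "H x = (\<Sum>Q\<in>S. c Q * indicator Q x)" for x by (simp add: H_def c_def)
  have H0: "0 \<le> H x" for x unfolding H using c0 by (intro sum_nonneg mult_nonneg_nonneg) auto
  have [measurable]: "Q \<in> S \<Longrightarrow> Q \<in> sets V" for Q by (rule sets')
  have Hm [measurable]: "H \<in> borel_measurable V"
    unfolding H[abs_def] by measurable
  define b where "b = (\<Sum>Q\<in>S. c Q)"
  have Hb: "H x \<le> b" for x
    unfolding H b_def using c0 by (intro sum_mono mult_left_le) (auto simp: indicator_def)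
  have out: "H x = 0" if "x \<notin> \<Union>S" for x
    unfolding H using that by (auto intro!: sum.neutral)
  have fin: "\<Union>S \<in> fmeasurable V"
    using finite_family fmeasurable_family by (intro fmeasurable.finite_Union) auto
  have Hint: "integrable V (\<lambda>x. H x powr t)" if "0 < t" for t
  proof (rule integrableI_bounded_set[where A="\<Union>S" and B="b powr t"])
    show "emeasure V (\<Union>S) < \<infinity>" "\<Union>S \<in> sets V" using fin by (auto simp: fmeasurable_def)
    show "AE x in V. x \<in> \<Union>S \<longrightarrow> norm (H x powr t) \<le> b powr t"
      using H0 Hb that by (auto intro!: AE_I2 powr_mono2)
    show "AE x in V. x \<notin> \<Union>S \<longrightarrow> H x powr t = 0" using out that by auto
  qed (use Hm in measurable)
  show I: "integrable V (\<lambda>x. H x powr q)" using q by (intro Hint) auto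
  let ?X = "\<integral>x. H x powr q \<partial>V"
  define g where "g x = H x powr (q - 1)" for x
  have gq: "g x powr (q / (q - 1)) = H x powr q" for x using q by (simp add: g_def powr_powr)
  have gint: "integrable V g" unfolding g_def[abs_def] using q by (intro Hint) auto
  have gQ: "set_integrable V Q g" if "Q \<in> S" for Q
    unfolding set_integrable_def using gint that by (intro integrable_mult_indicator) auto
  have X0: "0 \<le> ?X" by (intro integral_nonneg_AE AE_I2) auto
  let ?K = "bilinear_const p q * A powr sharp_exp p q * (\<integral>x. f x powr p \<partial>U) powr (1 / p)"
  have K0: "0 \<le> ?K" using bilinear_const_pos by simp
  have "?X = (\<integral>x. (\<Sum>Q\<in>S. c Q * (indicator Q x * g x)) \<partial>V)"
  proof (intro Bochner_Integration.integral_cong refl)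
    fix x
    have "H x powr q = H x * g x" using H0[of x] by (cases "H x = 0") (auto simp: g_def powr_diff)
    then show "H x powr q = (\<Sum>Q\<in>S. c Q * (indicator Q x * g x))"
      by (simp add: H sum_distrib_right mult.assoc)
  qed
  also have "\<dots> = (\<Sum>Q\<in>S. c Q * (LINT x:Q|V. g x))"
    using gQ unfolding set_integrable_def set_lebesgue_integral_def
    by (subst Bochner_Integration.integral_sum) auto
  also have "\<dots> \<le> ?K * ?X powr (1 - 1 / q)"
    using bilinear_bound[OF A f, of g] gQ I gint unfolding gq c_def
    by (simp add: g_def mult.assoc)
  finally have main: "?X \<le> ?K * ?X powr (1 - 1 / q)" .
  show "?X \<le> ?K powr q"
  proof (cases "?X = 0")
    case False
    with X0 have Xp: "0 < ?X" by linarith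
    have "?X = ?X powr (1 / q) * ?X powr (1 - 1 / q)" using Xp by (simp flip: powr_add)
    with main have "?X powr (1 / q) * ?X powr (1 - 1 / q) \<le> ?K * ?X powr (1 - 1 / q)" by simp
    then have "?X powr (1 / q) \<le> ?K" using Xp by (auto dest: mult_right_le_imp_le)
    then have "(?X powr (1 / q)) powr q \<le> ?K powr q" using q by (intro powr_mono2) auto
    then show ?thesis using q Xp by (simp add: powr_powr)
  qed (simp only: powr_ge_zero)
qed

end

section \<open>Cells of shifted grids\<close>

text \<open>The half-open cells of edge \<open>d\<close> of the grid with a vertex at \<open>c\<close>, indexed by integer vectors.\<close>
definition cell :: "real ^ 'n \<Rightarrow> real \<Rightarrow> int ^ 'n \<Rightarrow> (real ^ 'n) set" where
  "cell c d m = {x. \<forall>i. \<lfloor>(x $ i - c $ i) / d\<rfloor> = m $ i}"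

text \<open>The index of the cell that contains \<open>x\<close>.\<close>
definition cell_index :: "real ^ 'n \<Rightarrow> real \<Rightarrow> real ^ 'n \<Rightarrow> int ^ 'n" where
  "cell_index c d x = (\<chi> i. \<lfloor>(x $ i - c $ i) / d\<rfloor>)"

lemma mem_cell_iff: "x \<in> cell c d m \<longleftrightarrow> cell_index c d x = m"
  by (auto simp: cell_def cell_index_def vec_eq_iff)

lemma mem_cell_bounds:
  assumes "0 < d"
  shows "x \<in> cell c d m \<longleftrightarrow> (\<forall>i. c $ i + d * m $ i \<le> x $ i \<and> x $ i < c $ i + d * (m $ i + 1))"
  using assms by (simp add: cell_def floor_eq_iff field_simps)

lemma cell_subset_cbox:
  fixes c :: "real ^ 'n"
  assumes "0 < d"
  shows "cell c d m \<subseteq> cbox (\<chi> i. c $ i + d * m $ i) (\<chi> i. c $ i + d * (m $ i + 1))"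
    and "box (\<chi> i. c $ i + d * m $ i) (\<chi> i. c $ i + d * (m $ i + 1)) \<subseteq> cell c d m"
  using assms by (auto simp: mem_cell_bounds mem_box_cart less_imp_le)

lemma measure_cbox_vec:
  fixes a :: "real ^ 'n"
  assumes "0 \<le> d"
  shows "measure lebesgue (cbox a (\<chi> i. a $ i + d)) = d ^ CARD('n)"
    "emeasure lebesgue (cbox a (\<chi> i. a $ i + d)) = ennreal (d ^ CARD('n))"
proof -
  have "cbox a (\<chi> i. a $ i + d) \<noteq> {}" using assms by (simp add: interval_ne_empty_cart)
  then show *: "measure lebesgue (cbox a (\<chi> i. a $ i + d)) = d ^ CARD('n)"
    by (simp add: content_cbox_cart)
  have "emeasure lebesgue (cbox a (\<chi> i. a $ i + d)) = ennreal (measure lebesgue (cbox a (\<chi> i. a $ i + d)))"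
    by (intro emeasure_eq_ennreal_measure) (simp add: emeasure_lborel_cbox_eq)
  then show "emeasure lebesgue (cbox a (\<chi> i. a $ i + d)) = ennreal (d ^ CARD('n))" by (simp only: *)
qed

lemma cube_eq_cbox: "cube x t = cbox (x - vec t) (\<chi> i. (x - vec t) $ i + 2 * t)"
  by (auto simp: cube_def mem_box_cart algebra_simps)

lemma measure_cube:
  fixes x :: "real ^ 'n"
  assumes "0 \<le> t"
  shows "measure lebesgue (cube x t) = (2 * t) ^ CARD('n)"
    "emeasure lebesgue (cube x t) = ennreal ((2 * t) ^ CARD('n))"
  using measure_cbox_vec[of "2 * t" "x - vec t"] assms by (simp_all only: cube_eq_cbox mult_nonneg_nonneg)

lemma cell_measurable [measurable]: "cell c d m \<in> sets borel" "cell c d m \<in> sets lebesgue"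
proof -
  have "cell c d m = (\<Inter>i\<in>UNIV. {x \<in> space borel. \<lfloor>(x $ i - c $ i) / d\<rfloor> = m $ i})"
    by (auto simp: cell_def)
  also have "\<dots> \<in> sets borel"
    by (intro sets.finite_INT) (auto, measurable)
  finally show "cell c d m \<in> sets borel" .
  then show "cell c d m \<in> sets lebesgue" by (rule sets_completionI_sets[of _ lborel, simplified])
qed

lemma measure_cell:
  fixes c :: "real ^ 'n"
  assumes "0 < d"
  shows "measure lebesgue (cell c d m) = d ^ CARD('n)"
proof (rule antisym)
  let ?a = "\<chi> i. c $ i + d * m $ i"
  have eq: "(\<chi> i. c $ i + d * (m $ i + 1)) = (\<chi> i. ?a $ i + d)"
    by (simp add: vec_eq_iff algebra_simps)
  note sub = cell_subset_cbox[OF assms, of c m, unfolded eq]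
  have "measure lebesgue (cell c d m) \<le> measure lebesgue (cbox ?a (\<chi> i. ?a $ i + d))"
    by (intro measure_mono_fmeasurable sub) auto
  also have "\<dots> = d ^ CARD('n)" using assms by (intro measure_cbox_vec) auto
  finally show "measure lebesgue (cell c d m) \<le> d ^ CARD('n)" .
  have "d ^ CARD('n) = measure lebesgue (cbox ?a (\<chi> i. ?a $ i + d))"
    using assms by (intro measure_cbox_vec(1)[symmetric]) auto
  also have "\<dots> = measure lebesgue (box ?a (\<chi> i. ?a $ i + d))"
    by (simp add: measure_lborel_box_eq measure_lborel_cbox_eq)
  also have "\<dots> \<le> measure lebesgue (cell c d m)"
  proof (rule measure_mono_fmeasurable)
    have "emeasure lebesgue (cell c d m) \<le> emeasure lebesgue (cbox ?a (\<chi> i. ?a $ i + d))"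
      by (intro emeasure_mono sub) auto
    also have "\<dots> < \<infinity>" using assms by (subst measure_cbox_vec(2)) auto
    finally show "cell c d m \<in> fmeasurable lebesgue" by (intro fmeasurableI) auto
  qed (use sub in auto)
  finally show "d ^ CARD('n) \<le> measure lebesgue (cell c d m)" .
qed

lemma cell_subset_cube:
  fixes c :: "real ^ 'n"
  assumes "0 < d"
  obtains x where "cell c d m \<subseteq> cube x (d / 2)"
proof
  have eq: "(\<chi> i. c $ i + d * m $ i) = (\<chi> i. c $ i + d * m $ i + d / 2) - vec (d / 2)"
     "(\<chi> i. c $ i + d * (m $ i + 1)) = (\<chi> i. c $ i + d * m $ i + d / 2) + vec (d / 2)"
    by (simp_all add: vec_eq_iff algebra_simps)
  show "cell c d m \<subseteq> cube (\<chi> i. c $ i + d * m $ i + d / 2) (d / 2)"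
    using cell_subset_cbox(1)[OF assms, of c m] unfolding cube_def eq .
qed

lemma cells_nested:
  fixes c :: "real ^ 'n"
  assumes "i \<le> j" "0 < r" "cell c (r / 2 ^ j) m \<inter> cell c (r / 2 ^ i) m' \<noteq> {}"
  shows "cell c (r / 2 ^ j) m \<subseteq> cell c (r / 2 ^ i) m'"
proof
  obtain x where x: "x \<in> cell c (r / 2 ^ j) m" "x \<in> cell c (r / 2 ^ i) m'" using assms by blast
  have coarse: "\<lfloor>u / (r / 2 ^ i)\<rfloor> = \<lfloor>u / (r / 2 ^ j)\<rfloor> div 2 ^ (j - i)" for u :: real
  proof -
    have "(2::real) ^ j = 2 ^ i * 2 ^ (j - i)" using assms(1) by (simp flip: power_add)
    then have "u / (r / 2 ^ i) = u / (r / 2 ^ j) / real_of_int (2 ^ (j - i))"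
      by simp
    also have "\<lfloor>\<dots>\<rfloor> = \<lfloor>u / (r / 2 ^ j)\<rfloor> div 2 ^ (j - i)"
      by (rule floor_divide_real_eq_div) simp
    finally show ?thesis .
  qed
  fix y assume y: "y \<in> cell c (r / 2 ^ j) m"
  show "y \<in> cell c (r / 2 ^ i) m'"
    using x y unfolding cell_def mem_Collect_eq coarse by metis
qed

lemma finite_bounded_int_vec: "finite {m :: int ^ 'n. \<forall>i. m $ i \<in> {a $ i..b $ i}}"
proof (rule finite_subset)
  show "{m :: int ^ 'n. \<forall>i. m $ i \<in> {a $ i..b $ i}} \<subseteq> vec_lambda ` (PiE UNIV (\<lambda>i. {a $ i..b $ i}))"
    by (auto simp: image_iff intro!: bexI[of _ "vec_nth _"])
  show "finite (vec_lambda ` (PiE UNIV (\<lambda>i. {a $ i..b $ i})) :: (int ^ 'n) set)"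
    by (intro finite_imageI finite_PiE) auto
qed

lemma finite_cell_indices:
  fixes K :: "(real ^ 'n) set"
  assumes "bounded K" "0 < d"
  shows "finite (cell_index c d ` K)"
proof -
  obtain a b where K: "K \<subseteq> cbox a b" using assms(1) bounded_subset_cbox_symmetric by metis
  have "cell_index c d ` K \<subseteq> {m. \<forall>i. m $ i \<in> {cell_index c d a $ i..cell_index c d b $ i}}"
    using K assms(2) by (fastforce simp: cell_index_def mem_box_cart intro!: floor_mono divide_right_mono)
  then show ?thesis by (rule finite_subset) (rule finite_bounded_int_vec)
qed

text \<open>The one-third trick: if a grid point separates \<open>u\<close> and \<open>v\<close>, then no point of the grid shifted by \<open>2\<^sup>j / 3\<close> does, because \<open>3\<close> does not divide \<open>2\<^sup>j\<close>.\<close>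
lemma third_shift:
  fixes u v :: real
  assumes "\<bar>u - v\<bar> < 1 / 3"
  shows "\<lfloor>u\<rfloor> = \<lfloor>v\<rfloor> \<or> \<lfloor>u - 2 ^ j / 3\<rfloor> = \<lfloor>v - 2 ^ j / 3\<rfloor>"
proof (rule ccontr)
  assume neg: "\<not> ?thesis"
  have *: False if uv: "u \<le> v" "v - u < 1 / 3" and n: "\<lfloor>u\<rfloor> \<noteq> \<lfloor>v\<rfloor>" "\<lfloor>u - 2 ^ j / 3\<rfloor> \<noteq> \<lfloor>v - 2 ^ j / 3\<rfloor>" for u v :: real
  proof -
    define k l where "k = \<lfloor>v\<rfloor>" and "l = \<lfloor>v - 2 ^ j / 3\<rfloor>"
    have "\<lfloor>u\<rfloor> < k" "\<lfloor>u - 2 ^ j / 3\<rfloor> < l"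
      using n floor_mono[of u v] floor_mono[of "u - 2 ^ j / 3" "v - 2 ^ j / 3"] uv by (auto simp: k_def l_def)
    then have "u < k" "u - 2 ^ j / 3 < l" by (auto simp: floor_less_iff)
    moreover have "k \<le> v" "l \<le> v - 2 ^ j / 3" by (auto simp: k_def l_def)
    ultimately have "\<bar>real_of_int (3 * k - 3 * l - 2 ^ j)\<bar> < 1" using uv by auto
    then have "3 * k - 3 * l - 2 ^ j = 0" by linarith
    then have "(2::int) ^ j = 3 * (k - l)" by simp
    then have "(3::int) dvd 2 ^ j" by simp
    then have "(3::int) dvd 2" using prime_dvd_power[of "3::int" 2 j] by simp
    then show False by simp
  qed
  show False
    using *[of u v] *[of v u] neg assms by (cases "u \<le> v") auto
qed

section \<open>Local Muckenhoupt weights\<close>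

text \<open>A weight of finite local characteristic. In the notation below, \<open>sig\<close> is \<open>\<sigma>\<close>, \<open>s\<close> is \<open>q / p'\<close>, and \<open>A\<close> is the local Muckenhoupt constant as a real number.\<close>
locale local_weight =
  fixes p q r :: real and w :: "real ^ 'n \<Rightarrow> real"
  assumes p: "1 < p" and pq: "p < q" and r: "0 < r" and w: "w \<in> Aloc p q r"
begin

definition s :: real where "s = q * (p - 1) / p"

definition sig :: "real ^ 'n \<Rightarrow> real" where "sig x = w x powr (- conj_exp p / q)"

definition U :: "(real ^ 'n) measure" where "U = density lebesgue (\<lambda>x. ennreal (sig x))"

definition V :: "(real ^ 'n) measure" where "V = density lebesgue (\<lambda>x. ennreal (w x))"

definition A :: real where "A = enn2real (Aloc_const p q r w)"

lemma s0: "0 < s" and s_eq: "q / conj_exp p = s" "- conj_exp p / q = - (1 / s)"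
  using p pq by (auto simp: s_def conj_exp_def)

lemma w_nonneg: "0 \<le> w x" and w_pos: "AE x in lebesgue. 0 < w x"
  and w_int: "compact K \<Longrightarrow> set_integrable lebesgue K w"
  using w by (auto simp: Aloc_def scalar_weight_def)

lemma sig_eq: "sig x = w x powr (- (1 / s))" unfolding sig_def s_eq ..

lemma sig_nonneg: "0 \<le> sig x" by (simp add: sig_def)

lemma w_measurable [measurable]: "w \<in> borel_measurable lebesgue"
proof (rule borel_measurable_LIMSEQ_real)
  fix x
  show "(\<lambda>k. indicator (cball 0 (real k)) x * w x) \<longlonglongrightarrow> w x"
  proof (rule tendsto_eventually)
    obtain N where "norm x \<le> real N" using real_arch_simple by blast
    then have "\<forall>k\<ge>N. indicator (cball 0 (real k)) x * w x = w x"
      by (auto simp: indicator_def)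
    then show "\<forall>\<^sub>F k in sequentially. indicator (cball 0 (real k)) x * w x = w x"
      by (auto simp: eventually_sequentially)
  qed
next
  fix k
  show "(\<lambda>x. indicator (cball 0 (real k)) x * w x) \<in> borel_measurable lebesgue"
    using w_int[of "cball 0 (real k)"] by (auto simp: set_integrable_def dest: borel_measurable_integrable)
qed

lemma sig_measurable [measurable]: "sig \<in> borel_measurable lebesgue"
  unfolding sig_def[abs_def] by measurable

lemma sets_UV [simp]: "sets U = sets lebesgue" "sets V = sets lebesgue"
  by (simp_all add: U_def V_def)

lemma emeasure_U: "E \<in> sets lebesgue \<Longrightarrow> emeasure U E = (\<integral>\<^sup>+x\<in>E. ennreal (sig x) \<partial>lebesgue)"
  and emeasure_V: "E \<in> sets lebesgue \<Longrightarrow> emeasure V E = (\<integral>\<^sup>+x\<in>E. ennreal (w x) \<partial>lebesgue)"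
  by (simp_all add: U_def V_def emeasure_density)

lemma emeasure_V_compact:
  assumes "compact K"
  shows "emeasure V K < \<infinity>"
proof -
  have K: "K \<in> sets lebesgue" using assms by (simp add: borel_compact)
  have "emeasure V K = (\<integral>\<^sup>+x. ennreal (indicator K x * w x) \<partial>lebesgue)"
    unfolding emeasure_V[OF K] by (intro nn_integral_cong) (auto simp: indicator_def)
  also have "\<dots> < \<infinity>"
    using integrableD(2)[OF w_int[OF assms, unfolded set_integrable_def]] w_nonneg
    by (simp add: abs_mult top.not_eq_extremum)
  finally show ?thesis .
qed

lemma emeasure_V_pos:
  assumes "E \<in> sets lebesgue" "emeasure lebesgue E \<noteq> 0"
  shows "emeasure V E \<noteq> 0"
proof
  assume "emeasure V E = 0"
  then have "AE x in lebesgue. ennreal (w x) * indicator E x = 0"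
    using assms by (simp add: emeasure_V nn_integral_0_iff_AE)
  with w_pos have "AE x in lebesgue. x \<notin> E"
    by eventually_elim (auto simp: indicator_def split: if_splits)
  then have "emeasure lebesgue E = 0"
    using assms by (simp add: AE_iff_measurable[OF _ refl])
  then show False using assms by simp
qed

lemma cube_lebesgue: "cube x t \<in> sets lebesgue" "compact (cube x t)"
  by (auto simp: cube_def)

lemma cube_bound:
  assumes t: "0 < t" "2 * t \<le> r"
  shows "emeasure U (cube x t) < \<infinity>"
    and "measure V (cube x t) * measure U (cube x t) powr s \<le> A * ((2 * t) ^ CARD('n)) powr (1 + s)"
proof -
  let ?Q = "cube x t"
  define l where "l = (2 * t) ^ CARD('n)"
  have l: "0 < l" using t by (simp add: l_def)
  have lQ: "emeasure lebesgue ?Q = ennreal l" using t by (simp add: l_def measure_cube)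
  have Q: "?Q \<in> sets lebesgue" by (rule cube_lebesgue)
  have Aeq: "ennreal A = Aloc_const p q r w"
    using w by (simp add: A_def Aloc_def)
  have "eavg ?Q w * epowr (eavg ?Q sig) s \<le> Aloc_const p q r w"
    unfolding Aloc_const_def sig_def[abs_def] s_eq(1)[symmetric]
    using t by (intro SUP_upper2[of ?Q]) auto
  then have bd: "eavg ?Q w * epowr (eavg ?Q sig) s \<le> ennreal A" by (simp add: Aeq)
  have ew: "eavg ?Q w = emeasure V ?Q / ennreal l" and es: "eavg ?Q sig = emeasure U ?Q / ennreal l"
    by (simp_all add: eavg_def emeasure_U emeasure_V Q lQ)
  have V: "emeasure V ?Q = ennreal (measure V ?Q)"
    using emeasure_V_compact[OF cube_lebesgue(2)[of x t]] by (intro emeasure_eq_ennreal_measure) auto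
  have "emeasure V ?Q \<noteq> 0" using lQ l Q by (intro emeasure_V_pos) auto
  then have v: "0 < measure V ?Q" using V by (simp add: zero_less_measure_iff)
  have ew': "eavg ?Q w = ennreal (measure V ?Q / l)"
    unfolding ew V using l v by (simp add: divide_ennreal)
  show fin: "emeasure U ?Q < \<infinity>"
  proof (rule ccontr)
    assume "\<not> emeasure U ?Q < \<infinity>"
    then have "emeasure U ?Q = top" by (auto simp: top.not_eq_extremum[symmetric])
    then have "eavg ?Q sig = top" by (simp add: es ennreal_top_divide)
    then have "eavg ?Q w * epowr (eavg ?Q sig) s = top"
      using ew' v l by (simp add: epowr_def ennreal_mult_top)
    with bd show False by (simp add: top_unique)
  qed
  have U: "emeasure U ?Q = ennreal (measure U ?Q)"
    using fin by (intro emeasure_eq_ennreal_measure) auto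
  have es': "eavg ?Q sig = ennreal (measure U ?Q / l)"
    unfolding es U using l by (simp add: divide_ennreal)
  have "ennreal (measure V ?Q / l * (measure U ?Q / l) powr s) \<le> ennreal A"
    using bd l unfolding ew' es'
    by (subst ennreal_mult) (auto simp: epowr_def divide_nonneg_pos)
  then have "measure V ?Q / l * (measure U ?Q / l) powr s \<le> A"
    by (simp add: A_def)
  then have "measure V ?Q / l * (measure U ?Q / l) powr s * l powr (1 + s) \<le> A * l powr (1 + s)"
    by (intro mult_right_mono) auto
  then show "measure V ?Q * measure U ?Q powr s \<le> A * ((2 * t) ^ CARD('n)) powr (1 + s)"
    unfolding l_def[symmetric] using l by (simp add: powr_divide powr_add)
qed

lemma duality:
  assumes E: "E \<in> sets lebesgue" "emeasure lebesgue E < \<infinity>" "emeasure U E < \<infinity>" "emeasure V E < \<infinity>"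
  shows "measure lebesgue E powr (1 + s) \<le> measure V E * measure U E powr s"
proof -
  let ?f = "\<lambda>x. w x powr (1 / (1 + s)) * indicator E x"
  let ?g = "\<lambda>x. w x powr (- 1 / (1 + s)) * indicator E x"
  have [measurable]: "E \<in> sets lebesgue" by fact
  have c: "1 < 1 + s" "1 < (1 + s) / s" "1 / (1 + s) + 1 / ((1 + s) / s) = 1"
    using s0 by (auto simp: add_divide_distrib[symmetric])
  have fp: "?f x powr (1 + s) = w x * indicator E x" for x
    using s0 w_nonneg[of x] by (auto simp: powr_powr indicator_def)
  have gp: "?g x powr ((1 + s) / s) = sig x * indicator E x" for x
    using s0 by (auto simp: powr_powr indicator_def sig_eq)
  have iV: "integrable lebesgue (\<lambda>x. w x * indicator E x)" "(\<integral>x. w x * indicator E x \<partial>lebesgue) = measure V E"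
  proof -
    have *: "(\<integral>\<^sup>+x. ennreal (w x * indicator E x) \<partial>lebesgue) = ennreal (measure V E)"
      using E by (subst emeasure_eq_ennreal_measure[symmetric]) (auto simp: emeasure_V ennreal_mult' ennreal_indicator w_nonneg intro!: nn_integral_cong split: split_indicator)
    show "integrable lebesgue (\<lambda>x. w x * indicator E x)"
      by (rule integrableI_nonneg) (use * w_nonneg in auto)
    show "(\<integral>x. w x * indicator E x \<partial>lebesgue) = measure V E"
      by (rule integral_eq_nn_integral[THEN trans]) (use * w_nonneg in auto)
  qed
  have iU: "integrable lebesgue (\<lambda>x. sig x * indicator E x)" "(\<integral>x. sig x * indicator E x \<partial>lebesgue) = measure U E"
  proof -
    have *: "(\<integral>\<^sup>+x. ennreal (sig x * indicator E x) \<partial>lebesgue) = ennreal (measure U E)"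
      using E by (subst emeasure_eq_ennreal_measure[symmetric]) (auto simp: emeasure_U ennreal_mult' ennreal_indicator sig_nonneg intro!: nn_integral_cong split: split_indicator)
    show "integrable lebesgue (\<lambda>x. sig x * indicator E x)"
      by (rule integrableI_nonneg) (use * sig_nonneg in auto)
    show "(\<integral>x. sig x * indicator E x \<partial>lebesgue) = measure U E"
      by (rule integral_eq_nn_integral[THEN trans]) (use * sig_nonneg in auto)
  qed
  have "(\<integral>x. ?f x * ?g x \<partial>lebesgue) = (\<integral>x. indicator E x \<partial>lebesgue)"
  proof (rule integral_cong_AE)
    show "AE x in lebesgue. ?f x * ?g x = indicator E x"
      using w_pos by eventually_elim (auto simp: indicator_def powr_minus divide_simps powr_add[symmetric])
  qed auto
  then have "measure lebesgue E = (\<integral>x. ?f x * ?g x \<partial>lebesgue)" by simp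
  also have "\<dots> \<le> (\<integral>x. ?f x powr (1 + s) \<partial>lebesgue) powr (1 / (1 + s)) * (\<integral>x. ?g x powr ((1 + s) / s) \<partial>lebesgue) powr (1 / ((1 + s) / s))"
    by (rule hoelder_integral(2)[OF c]) (use iU iV in \<open>simp_all only: fp gp, auto\<close>)
  also have "\<dots> = measure V E powr (1 / (1 + s)) * measure U E powr (s / (1 + s))"
    by (simp only: fp gp iV iU) simp
  finally have "measure lebesgue E powr (1 + s) \<le> (measure V E powr (1 / (1 + s)) * measure U E powr (s / (1 + s))) powr (1 + s)"
    using s0 by (intro powr_mono2) auto
  also have "\<dots> = measure V E * measure U E powr s"
    using s0 by (simp add: powr_mult powr_powr)
  finally show ?thesis .
qed

lemma cell_bounds:
  assumes d: "0 < d" "d \<le> r"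
  shows "emeasure U (cell c d m) < \<infinity>" "emeasure V (cell c d m) < \<infinity>"
    "emeasure lebesgue (cell c d m) < \<infinity>"
    "measure V (cell c d m) * measure U (cell c d m) powr s \<le> A * (d ^ CARD('n)) powr (1 + s)"
    "0 < measure U (cell c d m)" "0 < measure V (cell c d m)"
proof -
  obtain x where sub: "cell c d m \<subseteq> cube x (d / 2)" using cell_subset_cube[OF d(1)] by blast
  have t: "0 < d / 2" "2 * (d / 2) \<le> r" using d by auto
  let ?Q = "cell c d m" and ?R = "cube x (d / 2)"
  note b = cube_bound[OF t, of x]
  have mono: "emeasure M ?Q \<le> emeasure M ?R" if "sets M = sets lebesgue" for M
    using sub that cube_lebesgue by (intro emeasure_mono) auto
  show U: "emeasure U ?Q < \<infinity>" using mono[of U] b by (auto intro: le_less_trans)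
  show V: "emeasure V ?Q < \<infinity>" using mono[of V] emeasure_V_compact[OF cube_lebesgue(2)[of x "d / 2"]] by (auto intro: le_less_trans)
  show L: "emeasure lebesgue ?Q < \<infinity>" using mono[of lebesgue] measure_cube(2)[of "d / 2" x] d by (auto intro: le_less_trans)
  have mm: "measure M ?Q \<le> measure M ?R" if "sets M = sets lebesgue" "emeasure M ?R < \<infinity>" for M
    using that sub cube_lebesgue by (intro measure_mono_fmeasurable fmeasurableI) auto
  have "measure V ?Q * measure U ?Q powr s \<le> measure V ?R * measure U ?R powr s"
    using mm[of V] mm[of U] b emeasure_V_compact[OF cube_lebesgue(2)[of x "d / 2"]] s0
    by (intro mult_mono powr_mono2) auto
  also have "\<dots> \<le> A * (d ^ CARD('n)) powr (1 + s)" using b(2) by simp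
  finally show "measure V ?Q * measure U ?Q powr s \<le> A * (d ^ CARD('n)) powr (1 + s)" .
  have "0 < (d ^ CARD('n)) powr (1 + s)" using d by simp
  also have "\<dots> \<le> measure V ?Q * measure U ?Q powr s"
    using duality[OF cell_measurable(2) L U V] measure_cell[OF d(1), of c m] by simp
  finally show "0 < measure U ?Q" "0 < measure V ?Q"
    by (auto simp: zero_less_mult_iff zero_less_measure_iff)
qed

lemma A_ge_1: "1 \<le> A"
proof -
  let ?Q = "cell (0 :: real ^ 'n) r 0"
  have l: "0 < r ^ CARD('n)" using r by simp
  have "(r ^ CARD('n)) powr (1 + s) \<le> measure V ?Q * measure U ?Q powr s"
    using duality[of ?Q] cell_bounds(1-3)[OF r order_refl, of "0 :: real ^ 'n" 0] measure_cell[OF r, of "0 :: real ^ 'n" 0] by simp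
  also have "\<dots> \<le> A * (r ^ CARD('n)) powr (1 + s)" by (rule cell_bounds(4)[OF r order_refl])
  finally have "1 * (r ^ CARD('n)) powr (1 + s) \<le> A * (r ^ CARD('n)) powr (1 + s)" by simp
  then show ?thesis by (rule mult_right_le_imp_le) (use r in simp)
qed

lemma weighted_laminar_cells:
  assumes "finite S" "S \<subseteq> {cell c (r / 2 ^ j) m | j m. True}"
  shows "weighted_laminar S lebesgue U V p q s"
proof
  have S: "\<exists>j m. Q = cell c (r / 2 ^ j) m" if "Q \<in> S" for Q using assms(2) that by blast
  have d: "0 < r / 2 ^ j" "r / 2 ^ j \<le> r" for j using r by (auto simp: divide_le_eq)
  have leb: "measure lebesgue (cell c (r / 2 ^ j) m) = (r / 2 ^ j) ^ CARD('n)" for j m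
    by (rule measure_cell) (rule d)
  show "finite S" by fact
  show "P \<subseteq> Q \<or> Q \<subseteq> P \<or> P \<inter> Q = {}" if PQ: "P \<in> S" "Q \<in> S" for P Q
  proof -
    obtain i m j k where e: "P = cell c (r / 2 ^ i) m" "Q = cell c (r / 2 ^ j) k"
      using S[OF PQ(1)] S[OF PQ(2)] by blast
    show ?thesis
      using cells_nested[OF _ r, of i j c k m] cells_nested[OF _ r, of j i c m k]
      unfolding e by (cases "i \<le> j") (blast, simp, blast)
  qed
  show L0: "0 < measure lebesgue Q" if "Q \<in> S" for Q
    using S[OF that] leb d by auto
  show "{} \<notin> S" using L0 by fastforce
  show "0 < measure U Q" "0 < measure V Q" "Q \<in> sets lebesgue" if "Q \<in> S" for Q
    using S[OF that] cell_bounds(5,6)[OF d] by auto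
  show "measure lebesgue P \<le> measure lebesgue Q / 2" if PQ: "P \<in> S" "Q \<in> S" "P \<subset> Q" for P Q
  proof -
    obtain i m j k where e: "P = cell c (r / 2 ^ i) m" "Q = cell c (r / 2 ^ j) k"
      using S[OF PQ(1)] S[OF PQ(2)] by blast
    have "P \<noteq> {}" using L0[OF PQ(1)] by fastforce
    have "\<not> i \<le> j"
      using cells_nested[OF _ r, of i j c k m] e PQ(3) \<open>P \<noteq> {}\<close> by blast
    then have "j < i" by simp
    have "r / 2 ^ i \<le> (r / 2 ^ j) / 2"
    proof -
      have "(2::real) ^ Suc j \<le> 2 ^ i" using \<open>j < i\<close> by (intro power_increasing) auto
      then show ?thesis using r by (simp add: field_simps)
    qed
    then have "(r / 2 ^ i) ^ CARD('n) \<le> ((r / 2 ^ j) / 2) ^ CARD('n)"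
      using r by (intro power_mono) auto
    also have "\<dots> = (r / 2 ^ j) ^ CARD('n) / 2 ^ CARD('n)" by (simp add: power_divide)
    also have "\<dots> \<le> (r / 2 ^ j) ^ CARD('n) / 2 ^ 1"
      using r by (intro divide_left_mono power_increasing) auto
    finally show ?thesis unfolding e leb by simp
  qed
  show "measure lebesgue E powr (1 + s) \<le> measure V E * measure U E powr s"
    if E: "Q \<in> S" "E \<in> sets lebesgue" "E \<subseteq> Q" for Q E
  proof (rule duality[OF E(2)])
    obtain j m where Q: "Q = cell c (r / 2 ^ j) m" using S[OF E(1)] by blast
    have "emeasure M E \<le> emeasure M Q" if "sets M = sets lebesgue" for M
      using E(3) that by (intro emeasure_mono) (auto simp: Q)
    from this[of lebesgue] this[of U] this[of V]
    show "emeasure lebesgue E < \<infinity>" "emeasure U E < \<infinity>" "emeasure V E < \<infinity>"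
      using cell_bounds(1-3)[OF d, of c j m] by (auto simp: Q intro: le_less_trans)
  qed
qed (use p pq in \<open>auto simp: s_def\<close>)

lemma weight_char_le:
  assumes "finite S" "S \<subseteq> {cell c (r / 2 ^ j) m | j m. True}" "Q \<in> S"
  shows "weighted_laminar.weight_char lebesgue U V s Q \<le> A"
proof -
  interpret weighted_laminar S lebesgue U V p q s by (rule weighted_laminar_cells[OF assms(1,2)])
  obtain j m where Q: "Q = cell c (r / 2 ^ j) m" using assms by blast
  have d: "0 < r / 2 ^ j" "r / 2 ^ j \<le> r" using r by (auto simp: divide_le_eq)
  show ?thesis
    unfolding weight_char_def Q measure_cell[OF d(1)]
    using cell_bounds(4)[OF d, of c m] d by (subst pos_divide_le_eq) auto
qed

text \<open>Two cells of edge \<open>r / 3\<close> whose indices differ by at most \<open>2\<close> lie in one cube of edge \<open>r\<close>.\<close>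
lemma two_cells:
  fixes k k' :: "int ^ 'n"
  assumes "\<And>i. \<bar>k $ i - k' $ i\<bar> \<le> 2"
  shows "measure V (cell c (r / 3) k) * measure U (cell c (r / 3) k') powr s \<le> A * (r ^ CARD('n)) powr (1 + s)"
proof -
  define x :: "real ^ 'n" where "x = (\<chi> i. c $ i + r / 3 * min (k $ i) (k' $ i) + r / 2)"
  have d: "0 < r / 3" "r / 3 \<le> r" and t: "0 < r / 2" "2 * (r / 2) \<le> r" using r by auto
  have sub: "cell c (r / 3) l \<subseteq> cube x (r / 2)" if "l = k \<or> l = k'" for l
  proof
    fix y assume y: "y \<in> cell c (r / 3) l"
    have "x $ i - r / 2 \<le> y $ i \<and> y $ i \<le> x $ i + r / 2" for i
    proof -
      let ?m = "min (k $ i) (k' $ i)"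
      have "?m \<le> l $ i" "l $ i + 1 \<le> ?m + 3" using that assms[of i] by auto
      then have "real_of_int ?m \<le> real_of_int (l $ i)" "real_of_int (l $ i) + 1 \<le> real_of_int ?m + 3" by linarith+
      then have "r / 3 * ?m \<le> r / 3 * (l $ i)" "r / 3 * (l $ i + 1) \<le> r / 3 * (real_of_int ?m + 3)"
        using r by (auto intro!: mult_left_mono simp del: of_int_min)
      moreover have "c $ i + r / 3 * l $ i \<le> y $ i" "y $ i < c $ i + r / 3 * (l $ i + 1)"
        using y d(1) by (auto simp: mem_cell_bounds)
      moreover have "r / 3 * (real_of_int (l $ i) + 1) = r / 3 * l $ i + r / 3"
        "r / 3 * (real_of_int ?m + 3) = r / 3 * ?m + r"
        by (simp_all add: algebra_simps)
      moreover have "x $ i = c $ i + r / 3 * ?m + r / 2" by (simp add: x_def)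
      ultimately show ?thesis by linarith
    qed
    then show "y \<in> cube x (r / 2)" by (simp add: cube_def mem_box_cart)
  qed
  note b = cube_bound[OF t, of x]
  have mm: "measure X (cell c (r / 3) l) \<le> measure X (cube x (r / 2))"
    if "sets X = sets lebesgue" "emeasure X (cube x (r / 2)) < \<infinity>" "l = k \<or> l = k'" for X l
    using that sub[of l] cube_lebesgue by (intro measure_mono_fmeasurable fmeasurableI) auto
  have "measure V (cell c (r / 3) k) * measure U (cell c (r / 3) k') powr s
    \<le> measure V (cube x (r / 2)) * measure U (cube x (r / 2)) powr s"
    using mm[of V k] mm[of U k'] b emeasure_V_compact[OF cube_lebesgue(2)[of x "r / 2"]] s0
    by (intro mult_mono powr_mono2) auto
  then show ?thesis using b(2) by simp
qed

text \<open>For index differences up to \<open>3\<close> a middle cell is interposed, at the price of the square of the constant.\<close>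
lemma far_pair:
  fixes k m :: "int ^ 'n"
  assumes m: "\<And>i. \<bar>m $ i\<bar> \<le> 3"
  shows "measure V (cell c (r / 3) (k + m)) * measure U (cell c (r / 3) k) powr s
    \<le> A ^ 2 * (3 ^ CARD('n)) powr (1 + s) * (r ^ CARD('n)) powr (1 + s)"
proof -
  \<comment> \<open>Half of an offset of modulus at most \<open>3\<close>, rounded either way, has modulus at most \<open>2\<close>.\<close>
  define l where "l = k + (\<chi> i. m $ i div 2)"
  define R where "R = (r ^ CARD('n)) powr (1 + s)"
  define T where "T = (3 ^ CARD('n)) powr (1 + s)"
  have RT: "0 < R" "0 < T" using r by (auto simp: R_def T_def)
  have d: "0 < r / 3" "r / 3 \<le> r" using r by auto
  let ?v = "\<lambda>k. measure V (cell c (r / 3) k)" and ?u = "\<lambda>k. measure U (cell c (r / 3) k) powr s"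
  have 1: "?v (k + m) * ?u l \<le> A * R"
    unfolding R_def
  proof (rule two_cells)
    fix i show "\<bar>(k + m) $ i - l $ i\<bar> \<le> 2" using m[of i] by (simp add: l_def; linarith)
  qed
  have 2: "?v l * ?u k \<le> A * R"
    unfolding R_def
  proof (rule two_cells)
    fix i show "\<bar>l $ i - k $ i\<bar> \<le> 2" using m[of i] by (simp add: l_def; linarith)
  qed
  have "R / T = ((r / 3) ^ CARD('n)) powr (1 + s)"
    using r by (simp add: R_def T_def power_divide powr_divide)
  also have "\<dots> \<le> ?v l * ?u l"
    using duality[OF cell_measurable(2) cell_bounds(3,1,2)[OF d], of c l] by (simp add: measure_cell[OF d(1)])
  finally have 3: "R / T \<le> ?v l * ?u l" .
  have "(?v (k + m) * ?u k) * (R / T) \<le> (?v (k + m) * ?u k) * (?v l * ?u l)"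
    using 3 by (intro mult_left_mono) auto
  also have "\<dots> = (?v (k + m) * ?u l) * (?v l * ?u k)" by simp
  also have "\<dots> \<le> (A * R) * (A * R)"
    using A_ge_1 RT by (intro mult_mono[OF 1 2]) auto
  finally have "(?v (k + m) * ?u k) * (R / T) \<le> (A ^ 2 * T * R) * (R / T)"
    using RT by (simp add: power2_eq_square mult_ac)
  then have "?v (k + m) * ?u k \<le> A ^ 2 * T * R"
    by (rule mult_right_le_imp_le) (use RT in simp)
  then show ?thesis unfolding R_def T_def .
qed

end

section \<open>Bounds for the dyadic and the far operators\<close>

text \<open>In addition a bounded, nonnegative, measurable function \<open>\<Phi>\<close> that vanishes outside the compact set \<open>K\<close>; it will be the modulus of the argument of the operator.\<close>
locale local_weight_function = local_weight p q r w for p q r :: real and w :: "real ^ 'n \<Rightarrow> real" +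
  fixes \<Phi> :: "real ^ 'n \<Rightarrow> real" and M :: real and K :: "(real ^ 'n) set"
  assumes \<Phi>_measurable [measurable]: "\<Phi> \<in> borel_measurable lebesgue"
    and \<Phi>: "\<And>x. 0 \<le> \<Phi> x" "\<And>x. \<Phi> x \<le> M" "compact K" "\<And>x. x \<notin> K \<Longrightarrow> \<Phi> x = 0"
begin

text \<open>The density of \<open>\<Phi>\<close> with respect to \<open>U\<close>, that is \<open>\<Phi> / \<sigma>\<close>; it is \<open>0\<close> on the null set where \<open>w\<close> vanishes.\<close>
definition f :: "real ^ 'n \<Rightarrow> real" where "f x = \<Phi> x * w x powr (1 / s)"

text \<open>The \<open>p\<close>-th power of the weighted norm of \<open>\<Phi>\<close>.\<close>
definition N :: real where "N = (\<integral>x. \<Phi> x powr p * w x powr (p / q) \<partial>lebesgue)"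

lemma q1: "1 < q" using p pq by simp

lemma K_sets: "K \<in> sets lebesgue" "K \<in> fmeasurable lebesgue"
  using \<Phi>(3) by (auto intro: lmeasurable_compact simp: borel_compact)

lemma f_measurable [measurable]: "f \<in> borel_measurable lebesgue"
  unfolding f_def[abs_def] by measurable

lemma f_nonneg: "0 \<le> f x" using \<Phi> by (simp add: f_def)

lemma \<Phi>_integrable: "integrable lebesgue \<Phi>"
proof (rule integrableI_bounded_set[where A=K and B=M])
  show "emeasure lebesgue K < \<infinity>" using K_sets by (auto simp: fmeasurable_def)
qed (use \<Phi> K_sets in \<open>auto intro!: AE_I2\<close>)

lemma integrable_N: "integrable lebesgue (\<lambda>x. \<Phi> x powr p * w x powr (p / q))"
proof (rule Bochner_Integration.integrable_bound)
  show "integrable lebesgue (\<lambda>x. M powr p * (indicator K x + indicator K x * w x))"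
    using w_int[OF \<Phi>(3)] K_sets unfolding set_integrable_def
    by (intro integrable_mult_right Bochner_Integration.integrable_add) (auto simp: fmeasurable_def)
  show "AE x in lebesgue. norm (\<Phi> x powr p * w x powr (p / q)) \<le> norm (M powr p * (indicator K x + indicator K x * w x))"
  proof (rule AE_I2)
    fix x
    have "w x powr (p / q) \<le> 1 + w x"
    proof (cases "w x \<le> 1")
      case True
      then have "w x powr (p / q) \<le> 1 powr (p / q)" using w_nonneg[of x] p pq by (intro powr_mono2) auto
      then show ?thesis using w_nonneg[of x] by simp
    next
      case False
      then have "w x powr (p / q) \<le> w x powr 1" using p pq by (intro powr_mono) auto
      then show ?thesis using False by simp
    qed
    moreover have "\<Phi> x powr p \<le> M powr p" using \<Phi> p by (intro powr_mono2) auto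
    ultimately have "\<Phi> x powr p * w x powr (p / q) \<le> M powr p * (1 + w x)"
      by (intro mult_mono) auto
    then show "norm (\<Phi> x powr p * w x powr (p / q)) \<le> norm (M powr p * (indicator K x + indicator K x * w x))"
      using w_nonneg[of x] p by (cases "x \<in> K") (auto simp: \<Phi>(4) abs_mult)
  qed
qed measurable

lemma f_sig: "AE x in lebesgue. sig x * f x = \<Phi> x"
  using w_pos by eventually_elim (simp add: sig_eq f_def powr_minus)

lemma fp_sig: "sig x * f x powr p = \<Phi> x powr p * w x powr (p / q)"
proof -
  have "- (1 / s) + 1 / s * p = p / q"
  proof -
    have "1 / s * (p - 1) = p / q" using p by (simp add: s_def)
    then show ?thesis by (simp add: algebra_simps diff_divide_distrib)
  qed
  then show ?thesis
    using \<Phi>(1)[of x] by (simp add: sig_eq f_def powr_mult powr_powr powr_add[symmetric])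
qed

lemma f_U: "integrable U f" "Q \<in> sets lebesgue \<Longrightarrow> set_integrable U Q f"
    "Q \<in> sets lebesgue \<Longrightarrow> (LINT x:Q|U. f x) = (LINT x:Q|lebesgue. \<Phi> x)"
    "integrable U (\<lambda>x. f x powr p)" "(\<integral>x. f x powr p \<partial>U) = N" "f \<in> borel_measurable U"
proof -
  show m: "f \<in> borel_measurable U" by (simp add: U_def)
  show i: "integrable U f"
    unfolding U_def using f_sig \<Phi>_integrable
    by (subst integrable_density) (auto simp: sig_nonneg intro: integrable_cong_AE_imp)
  show "set_integrable U Q f" if "Q \<in> sets lebesgue"
    unfolding set_integrable_def using i that by (intro integrable_mult_indicator) auto
  show "(LINT x:Q|U. f x) = (LINT x:Q|lebesgue. \<Phi> x)" if [measurable]: "Q \<in> sets lebesgue"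
  proof -
    have "(LINT x:Q|U. f x) = (\<integral>x. sig x *\<^sub>R (indicator Q x *\<^sub>R f x) \<partial>lebesgue)"
      unfolding set_lebesgue_integral_def U_def by (rule integral_density) (auto simp: sig_nonneg)
    also have "\<dots> = (LINT x:Q|lebesgue. \<Phi> x)"
      unfolding set_lebesgue_integral_def
    proof (rule integral_cong_AE)
      show "AE x in lebesgue. sig x *\<^sub>R indicator Q x *\<^sub>R f x = indicator Q x *\<^sub>R \<Phi> x"
        using f_sig by eventually_elim (simp add: indicator_def)
    qed auto
    finally show ?thesis .
  qed
  show "integrable U (\<lambda>x. f x powr p)"
    unfolding U_def using integrable_N
    by (subst integrable_density) (auto simp: sig_nonneg fp_sig)
  show "(\<integral>x. f x powr p \<partial>U) = N"
    unfolding U_def N_def by (subst integral_density) (auto simp: sig_nonneg fp_sig)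
qed

lemma N_nonneg: "0 \<le> N"
  unfolding N_def by (intro integral_nonneg_AE AE_I2) auto

lemma dyadic_bound:
  assumes S: "finite S" "S \<subseteq> {cell c (r / 2 ^ j) m | j m. True}"
  shows "(\<integral>\<^sup>+x. ennreal ((\<Sum>Q\<in>S. measure lebesgue Q powr (- (1 / q + (1 - 1 / p))) * (LINT y:Q|lebesgue. \<Phi> y) * indicator Q x) powr q) \<partial>V)
    \<le> ennreal ((bilinear_const p q * A powr sharp_exp p q * N powr (1 / p)) powr q)"
proof -
  interpret W: weighted_laminar S lebesgue U V p q s by (rule weighted_laminar_cells[OF S])
  note SB = W.strong_bound[of A f]
  have pre: "\<And>Q. Q \<in> S \<Longrightarrow> W.weight_char Q \<le> A" "0 \<le> A" using weight_char_le[OF S] A_ge_1 by auto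
  note SB' = SB[OF pre f_U(6) f_nonneg f_U(2) f_U(4)]
  have eq: "(\<Sum>Q\<in>S. measure lebesgue Q powr (- (1 / q + (1 - 1 / p))) * (LINT y:Q|U. f y) * indicator Q x)
     = (\<Sum>Q\<in>S. measure lebesgue Q powr (- (1 / q + (1 - 1 / p))) * (LINT y:Q|lebesgue. \<Phi> y) * indicator Q x)" for x
    using W.sets(1) by (intro sum.cong refl) (simp add: f_U(3))
  show ?thesis
    using SB' W.sets(1) unfolding eq f_U(5) by (subst nn_integral_eq_integral) (auto intro!: ennreal_leI)
qed

lemma cell_integral_le:
  assumes d: "0 < d" "d \<le> r"
  shows "(LINT y:cell c d k|lebesgue. \<Phi> y)
    \<le> (LINT y:cell c d k|lebesgue. \<Phi> y powr p * w y powr (p / q)) powr (1 / p) * measure U (cell c d k) powr (1 - 1 / p)"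
proof -
  let ?Q = "cell c d k"
  let ?p' = "p / (p - 1)"
  have p': "1 < ?p'" "1 / p + 1 / ?p' = 1" "1 / ?p' = 1 - 1 / p" using p by (auto simp: field_simps)
  have Q [measurable]: "?Q \<in> sets U" by simp
  have fQ: "(f x * indicator ?Q x) powr p = indicator ?Q x *\<^sub>R f x powr p" for x
    using p by (simp add: indicator_def)
  have iQ: "(indicator ?Q x :: real) powr ?p' = indicator ?Q x" for x
    using p by (simp add: indicator_def)
  have N: "(\<integral>x. indicator ?Q x *\<^sub>R f x powr p \<partial>U) = (LINT y:?Q|lebesgue. \<Phi> y powr p * w y powr (p / q))"
  proof -
    have "(\<integral>x. indicator ?Q x *\<^sub>R f x powr p \<partial>U) = (\<integral>x. sig x *\<^sub>R (indicator ?Q x *\<^sub>R f x powr p) \<partial>lebesgue)"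
      unfolding U_def by (rule integral_density) (auto simp: sig_nonneg)
    also have "\<dots> = (LINT y:?Q|lebesgue. \<Phi> y powr p * w y powr (p / q))"
      unfolding set_lebesgue_integral_def
      by (intro Bochner_Integration.integral_cong refl) (simp add: fp_sig[symmetric])
    finally show ?thesis .
  qed
  have "(LINT y:?Q|lebesgue. \<Phi> y) = (\<integral>x. (f x * indicator ?Q x) * indicator ?Q x \<partial>U)"
    unfolding f_U(3)[OF cell_measurable(2), symmetric]
    unfolding set_lebesgue_integral_def
    by (intro Bochner_Integration.integral_cong refl) (simp add: indicator_def)
  also have "\<dots> \<le> (\<integral>x. (f x * indicator ?Q x) powr p \<partial>U) powr (1 / p) * (\<integral>x. indicator ?Q x powr ?p' \<partial>U) powr (1 / ?p')"
  proof (rule hoelder_integral(2)[OF p p'(1,2)])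
    show "integrable U (\<lambda>x. (f x * indicator ?Q x) powr p)"
      unfolding fQ using f_U(4) by (intro integrable_mult_indicator) auto
    show "integrable U (\<lambda>x. (indicator ?Q x :: real) powr ?p')"
      unfolding iQ using cell_bounds(1)[OF d] by (intro integrable_real_indicator) auto
  qed (use f_U(6) f_nonneg in auto)
  also have "\<dots> = (LINT y:?Q|lebesgue. \<Phi> y powr p * w y powr (p / q)) powr (1 / p) * measure U ?Q powr (1 - 1 / p)"
    unfolding fQ iQ N p'(3) by (simp add: U_def)
  finally show ?thesis .
qed

text \<open>The cells are disjoint, so the integral is a sum over cells, to which Hoelder's inequality on each cell and \<open>far_pair\<close> apply; the sum of the powers \<open>q / p > 1\<close> is at most the power of the sum.\<close>
lemma far_bound:
  fixes m :: "int ^ 'n"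
  assumes D: "finite D" and m: "\<And>i. \<bar>m $ i\<bar> \<le> 3"
  shows "(\<integral>\<^sup>+x. ennreal ((\<Sum>k\<in>D. (LINT y:cell c (r / 3) k|lebesgue. \<Phi> y) * indicator (cell c (r / 3) (k + m)) x) powr q) \<partial>V)
    \<le> ennreal (A ^ 2 * (3 ^ CARD('n)) powr (1 + s) * (r ^ CARD('n)) powr (1 + s) * N powr (q / p))"
proof -
  define b where "b k = (LINT y:cell c (r / 3) k|lebesgue. \<Phi> y)" for k
  define Nk where "Nk k = (LINT y:cell c (r / 3) k|lebesgue. \<Phi> y powr p * w y powr (p / q))" for k
  define B where "B = A ^ 2 * (3 ^ CARD('n)) powr (1 + s) * (r ^ CARD('n)) powr (1 + s)"
  have B0: "0 \<le> B" by (simp add: B_def)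
  have d: "0 < r / 3" "r / 3 \<le> r" using r by auto
  have b0: "0 \<le> b k" for k unfolding b_def set_lebesgue_integral_def
    using \<Phi> by (intro integral_nonneg_AE AE_I2) auto
  have Nk0: "0 \<le> Nk k" for k unfolding Nk_def set_lebesgue_integral_def
    by (intro integral_nonneg_AE AE_I2) auto
  have ind: "indicator (cell c (r / 3) (k + m)) x = (if k = cell_index c (r / 3) x - m then 1 else 0 :: real)" for k x
    by (auto simp: indicator_def mem_cell_iff)
  have pw: "(\<Sum>k\<in>D. b k * indicator (cell c (r / 3) (k + m)) x) powr q
    = (\<Sum>k\<in>D. b k powr q * indicator (cell c (r / 3) (k + m)) x)" for x
    unfolding ind using D q1 by (simp add: if_distrib cong: if_cong)
  have sumN: "(\<Sum>k\<in>E. Nk k) \<le> N" if "finite E" for E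
  proof -
    have "(\<Sum>k\<in>E. Nk k) = (\<integral>x. (\<Sum>k\<in>E. indicator (cell c (r / 3) k) x *\<^sub>R (\<Phi> x powr p * w x powr (p / q))) \<partial>lebesgue)"
      unfolding Nk_def set_lebesgue_integral_def
      by (rule Bochner_Integration.integral_sum[symmetric]) (intro integrable_mult_indicator integrable_N cell_measurable)
    also have "\<dots> \<le> N"
      unfolding N_def
    proof (rule integral_mono)
      show "integrable lebesgue (\<lambda>x. \<Sum>k\<in>E. indicator (cell c (r / 3) k) x *\<^sub>R (\<Phi> x powr p * w x powr (p / q)))"
        by (intro Bochner_Integration.integrable_sum integrable_mult_indicator integrable_N cell_measurable)
      fix x
      have "(\<Sum>k\<in>E. indicator (cell c (r / 3) k) x *\<^sub>R (\<Phi> x powr p * w x powr (p / q)))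
        = (\<Sum>k\<in>E. if k = cell_index c (r / 3) x then \<Phi> x powr p * w x powr (p / q) else 0)"
        by (intro sum.cong refl) (auto simp: indicator_def mem_cell_iff)
      also have "\<dots> \<le> \<Phi> x powr p * w x powr (p / q)" using that by simp
      finally show "(\<Sum>k\<in>E. indicator (cell c (r / 3) k) x *\<^sub>R (\<Phi> x powr p * w x powr (p / q))) \<le> \<Phi> x powr p * w x powr (p / q)" .
    qed (rule integrable_N)
    finally show ?thesis .
  qed
  have summand: "b k powr q * measure V (cell c (r / 3) (k + m)) \<le> B * N powr (q / p - 1) * Nk k" for k
  proof -
    have qs: "q * (1 - 1 / p) = s" using p by (simp add: s_def field_simps)
    have "b k powr q \<le> (Nk k powr (1 / p) * measure U (cell c (r / 3) k) powr (1 - 1 / p)) powr q"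
      using cell_integral_le[OF d, of c k] b0 q1 unfolding b_def[symmetric] Nk_def[symmetric]
      by (intro powr_mono2) auto
    also have "\<dots> = Nk k powr (q / p) * measure U (cell c (r / 3) k) powr s"
      by (simp add: powr_mult powr_powr qs[symmetric] mult.commute)
    finally have "b k powr q * measure V (cell c (r / 3) (k + m))
      \<le> Nk k powr (q / p) * measure U (cell c (r / 3) k) powr s * measure V (cell c (r / 3) (k + m))"
      by (intro mult_right_mono) auto
    also have "\<dots> = Nk k powr (q / p) * (measure V (cell c (r / 3) (k + m)) * measure U (cell c (r / 3) k) powr s)"
      by simp
    also have "\<dots> \<le> Nk k powr (q / p) * B"
      unfolding B_def using far_pair[OF m] by (intro mult_left_mono) auto
    also have "Nk k powr (q / p) = Nk k powr (q / p - 1) * Nk k"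
      using Nk0[of k] by (cases "Nk k = 0") (auto simp: powr_diff)
    also have "\<dots> * B \<le> (N powr (q / p - 1) * Nk k) * B"
      using sumN[of "{k}"] Nk0[of k] B0 p pq by (intro mult_right_mono powr_mono2) auto
    finally show ?thesis by (simp add: mult_ac)
  qed
  have "(\<integral>\<^sup>+x. ennreal ((\<Sum>k\<in>D. b k * indicator (cell c (r / 3) (k + m)) x) powr q) \<partial>V)
    = (\<integral>\<^sup>+x. (\<Sum>k\<in>D. ennreal (b k powr q) * indicator (cell c (r / 3) (k + m)) x) \<partial>V)"
    unfolding pw by (intro nn_integral_cong, subst sum_ennreal[symmetric])
      (auto simp: ennreal_mult ennreal_indicator)
  also have "\<dots> = (\<Sum>k\<in>D. ennreal (b k powr q) * emeasure V (cell c (r / 3) (k + m)))"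
  proof (subst nn_integral_sum)
    show "(\<lambda>x. ennreal (b k powr q) * indicator (cell c (r / 3) (k + m)) x) \<in> borel_measurable V" for k
      by (intro borel_measurable_times_ennreal borel_measurable_indicator) auto
  qed (intro sum.cong refl nn_integral_cmult_indicator, simp)
  also have "\<dots> = (\<Sum>k\<in>D. ennreal (b k powr q * measure V (cell c (r / 3) (k + m))))"
  proof (intro sum.cong refl)
    fix k
    have "emeasure V (cell c (r / 3) (k + m)) = ennreal (measure V (cell c (r / 3) (k + m)))"
      using cell_bounds(2)[OF d, of c "k + m"] by (intro emeasure_eq_ennreal_measure) auto
    then show "ennreal (b k powr q) * emeasure V (cell c (r / 3) (k + m)) = ennreal (b k powr q * measure V (cell c (r / 3) (k + m)))"
      by (simp add: ennreal_mult)
  qed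
  also have "\<dots> = ennreal (\<Sum>k\<in>D. b k powr q * measure V (cell c (r / 3) (k + m)))"
    by (rule sum_ennreal) auto
  also have "\<dots> \<le> ennreal (\<Sum>k\<in>D. B * N powr (q / p - 1) * Nk k)"
    by (intro ennreal_leI sum_mono summand)
  also have "\<dots> \<le> ennreal (B * N powr (q / p - 1) * N)"
    unfolding sum_distrib_left[symmetric] using B0 by (intro ennreal_leI mult_left_mono sumN D) auto
  also have "B * N powr (q / p - 1) * N = B * N powr (q / p)"
    using N_nonneg by (cases "N = 0") (auto simp: powr_diff)
  finally show ?thesis unfolding b_def B_def .
qed

end

section \<open>Domination of the local fractional integral\<close>

text \<open>A crude form of the power mean inequality: the sum is at most the number of terms times the largest of them.\<close>
lemma sum_powr_le:
  fixes h :: "'i \<Rightarrow> real"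
  assumes "finite I" "1 \<le> q" "\<And>i. i \<in> I \<Longrightarrow> 0 \<le> h i"
  shows "(\<Sum>i\<in>I. h i) powr q \<le> real (card I) powr q * (\<Sum>i\<in>I. h i powr q)"
proof (cases "I = {}")
  case False
  define m where "m = Max (h ` I)"
  have "m \<in> h ` I" unfolding m_def using assms False by (intro Max_in) auto
  then obtain j where j: "j \<in> I" "m = h j" by auto
  have "(\<Sum>i\<in>I. h i) \<le> real (card I) * m"
    using assms by (intro sum_bounded_above) (auto simp: m_def)
  then have "(\<Sum>i\<in>I. h i) powr q \<le> (real (card I) * m) powr q"
    using assms by (intro powr_mono2 sum_nonneg) auto
  also have "\<dots> = real (card I) powr q * h j powr q"
    using j by (simp add: powr_mult)
  also have "h j powr q \<le> (\<Sum>i\<in>I. h i powr q)"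
    using assms j by (intro member_le_sum) auto
  finally show ?thesis by (simp add: mult_left_mono)
qed simp

lemma nn_integral_sum_powr_le:
  fixes h :: "'i \<Rightarrow> 'a \<Rightarrow> real"
  assumes I: "finite I" and q: "1 \<le> q" and h0: "\<And>i x. i \<in> I \<Longrightarrow> 0 \<le> h i x"
    and [measurable]: "\<And>i. i \<in> I \<Longrightarrow> h i \<in> borel_measurable M"
    and X: "0 \<le> X" "\<And>i. i \<in> I \<Longrightarrow> (\<integral>\<^sup>+x. ennreal (h i x powr q) \<partial>M) \<le> ennreal (X powr q)"
  shows "(\<integral>\<^sup>+x. ennreal ((\<Sum>i\<in>I. h i x) powr q) \<partial>M) \<le> ennreal ((real (card I) * real (card I) * X) powr q)"
proof -
  let ?n = "real (card I)"
  have "(\<integral>\<^sup>+x. ennreal ((\<Sum>i\<in>I. h i x) powr q) \<partial>M) \<le> (\<integral>\<^sup>+x. ennreal (?n powr q) * (\<Sum>i\<in>I. ennreal (h i x powr q)) \<partial>M)"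
    using sum_powr_le[OF I q] h0
    by (intro nn_integral_mono) (auto simp: ennreal_mult'[symmetric] sum_nonneg intro!: ennreal_leI)
  also have "\<dots> = ennreal (?n powr q) * (\<Sum>i\<in>I. \<integral>\<^sup>+x. ennreal (h i x powr q) \<partial>M)"
    by (subst nn_integral_cmult) (auto simp: nn_integral_sum simp del: sum_ennreal)
  also have "\<dots> \<le> ennreal (?n powr q) * (\<Sum>i\<in>I. ennreal (X powr q))"
    by (intro mult_left_mono sum_mono X) auto
  also have "\<dots> = ennreal (?n powr q * (?n * X powr q))"
    by (simp add: ennreal_mult' ennreal_of_nat_eq_real_of_nat)
  also have "\<dots> \<le> ennreal (?n powr q * (?n powr q * X powr q))"
  proof (intro ennreal_leI mult_left_mono mult_right_mono)
    show "?n \<le> ?n powr q"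
    proof (cases "card I = 0")
      case False
      then have "?n powr 1 \<le> ?n powr q" using q by (intro powr_mono) auto
      then show ?thesis by simp
    qed simp
  qed auto
  also have "?n powr q * (?n powr q * X powr q) = (?n * ?n * X) powr q"
    using X by (simp add: powr_mult)
  finally show ?thesis .
qed

text \<open>Real powers commute with suprema, in a form that does not require the supremum to be finite.\<close>
lemma ennreal_powr_le_SUP:
  assumes u: "0 \<le> u" "ennreal u \<le> (SUP J. ennreal (a J))" and a: "\<And>J :: nat. 0 \<le> a J" and q: "0 < q"
  shows "ennreal (u powr q) \<le> (SUP J. ennreal (a J powr q))"
proof (rule ccontr)
  assume "\<not> ?thesis"
  then have less: "(SUP J. ennreal (a J powr q)) < ennreal (u powr q)" by simp
  then obtain v where v: "(SUP J. ennreal (a J powr q)) = ennreal v" "0 \<le> v" "v < u powr q"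
    by (cases "SUP J. ennreal (a J powr q)") (auto simp: ennreal_less_iff)
  have "a J \<le> v powr (1 / q)" for J
  proof -
    have "ennreal (a J powr q) \<le> ennreal v" unfolding v(1)[symmetric] by (rule SUP_upper) simp
    then have "(a J powr q) powr (1 / q) \<le> v powr (1 / q)"
      using q v by (intro powr_mono2) auto
    then show ?thesis using a q by (simp add: powr_powr)
  qed
  then have "(SUP J. ennreal (a J)) \<le> ennreal (v powr (1 / q))"
    by (intro SUP_least ennreal_leI)
  then have "ennreal u \<le> ennreal (v powr (1 / q))" by (rule order_trans[OF u(2)])
  then have "u \<le> v powr (1 / q)" by simp
  then have "u powr q \<le> (v powr (1 / q)) powr q" using u q by (intro powr_mono2) auto
  then show False using v q by (simp add: powr_powr)
qed

lemma dyadic_scale: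
  fixes d r :: real
  assumes "0 < d" "d < r"
  obtains j :: nat where "r / 2 ^ Suc j \<le> d" "d < r / 2 ^ j"
proof -
  define P where "P j \<longleftrightarrow> r / 2 ^ j \<le> d" for j :: nat
  have "\<exists>j. P j"
  proof -
    obtain j where "(1 / 2) ^ j < d / r"
      using real_arch_pow_inv[of "d / r" "1 / 2"] assms by auto
    then have "P j" using assms by (simp add: P_def power_divide field_simps)
    then show ?thesis ..
  qed
  moreover have "\<not> P 0" using assms by (simp add: P_def)
  ultimately obtain j where "\<not> P j" "P (Suc j)"
    by (metis not0_implies_Suc LeastI_ex not_less_Least lessI)
  then show ?thesis by (intro that[of j]) (auto simp: P_def)
qed

context local_weight_function
begin

text \<open>The exponent \<open>n - \<alpha>\<close> of the kernel, expressed through \<open>p\<close> and \<open>q\<close>.\<close>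
definition \<beta> :: real where "\<beta> = real CARD('n) * (1 / q + (1 - 1 / p))"

text \<open>The \<open>2\<^sup>n\<close> shifts of the one-third trick, indexed by a type that does not depend on \<open>r\<close>, so that their number is a constant.\<close>
definition shift :: "bool ^ 'n \<Rightarrow> real ^ 'n" where
  "shift t = (\<chi> i. if t $ i then r / 3 else 0)"

text \<open>The dyadic cells of the first \<open>J\<close> generations in the grid with shift \<open>t\<close>, restricted to those that meet \<open>K\<close>; the others do not contribute, and this keeps the family finite.\<close>
definition cells :: "bool ^ 'n \<Rightarrow> nat \<Rightarrow> (real ^ 'n) set set" where
  "cells t J = (\<Union>j<J. cell (shift t) (r / 2 ^ j) ` cell_index (shift t) (r / 2 ^ j) ` K)"

text \<open>The possible differences of the indices of two cells of edge \<open>r / 3\<close> that contain points of sup distance at most \<open>r\<close>.\<close>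
definition offsets :: "(int ^ 'n) set" where "offsets = {m. \<forall>i. \<bar>m $ i\<bar> \<le> 3}"

text \<open>The indices of the cells of edge \<open>r / 3\<close> that meet \<open>K\<close>.\<close>
definition far_cells :: "(int ^ 'n) set" where "far_cells = cell_index 0 (r / 3) ` K"

text \<open>The dyadic operator for the grid with shift \<open>t\<close>.\<close>
definition near_op :: "bool ^ 'n \<Rightarrow> nat \<Rightarrow> real ^ 'n \<Rightarrow> real" where
  "near_op t J x = (\<Sum>Q\<in>cells t J. measure lebesgue Q powr (- (1 / q + (1 - 1 / p))) * (LINT y:Q|lebesgue. \<Phi> y) * indicator Q x)"

text \<open>The value at \<open>x\<close> is the integral of \<open>\<Phi>\<close> over the cell whose index is that of the cell of \<open>x\<close> minus \<open>m\<close>.\<close>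
definition far_op :: "int ^ 'n \<Rightarrow> real ^ 'n \<Rightarrow> real" where
  "far_op m x = (\<Sum>k\<in>far_cells. (LINT y:cell 0 (r / 3) k|lebesgue. \<Phi> y) * indicator (cell 0 (r / 3) (k + m)) x)"

text \<open>The dyadic operators (up to generation \<open>J\<close>) and the far operators with the constants that are needed to dominate the fractional integral.\<close>
definition total_op :: "nat \<Rightarrow> real ^ 'n \<Rightarrow> real" where
  "total_op J x = (\<Sum>t\<in>UNIV. 6 powr \<beta> * near_op t J x) + (\<Sum>m\<in>offsets. (r / 3) powr (- \<beta>) * far_op m x)"

text \<open>The integral kernel of \<open>total_op\<close>, see lemma \<open>integral_kernel\<close>.\<close>
definition kernel :: "nat \<Rightarrow> real ^ 'n \<Rightarrow> real ^ 'n \<Rightarrow> real" where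
  "kernel J x y = (\<Sum>t\<in>UNIV. 6 powr \<beta> * (\<Sum>Q\<in>cells t J. measure lebesgue Q powr (- (1 / q + (1 - 1 / p))) * indicator Q y * indicator Q x))
    + (\<Sum>m\<in>offsets. (r / 3) powr (- \<beta>) * (\<Sum>k\<in>far_cells. indicator (cell 0 (r / 3) k) y * indicator (cell 0 (r / 3) (k + m)) x))"

lemma beta_pos: "0 < \<beta>"
  using p q1 by (auto simp: \<beta>_def intro!: mult_pos_pos add_pos_pos)

lemma finite_cells: "finite (cells t J)"
  unfolding cells_def using r \<Phi>(3) by (intro finite_UN_I finite_imageI finite_cell_indices compact_imp_bounded) auto

lemma finite_far_cells: "finite far_cells"
  unfolding far_cells_def using r \<Phi>(3) by (intro finite_cell_indices compact_imp_bounded) auto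

lemma finite_offsets: "finite offsets"
proof -
  have "offsets = {m. \<forall>i. m $ i \<in> {(\<chi> i. -3) $ i..(\<chi> i. 3) $ i}}"
  proof -
    have "\<bar>v\<bar> \<le> 3 \<longleftrightarrow> v \<in> {-3..3}" for v :: int by auto
    then show ?thesis by (simp add: offsets_def)
  qed
  then show ?thesis by (rule ssubst[where P=finite]) (rule finite_bounded_int_vec)
qed

lemma cells_subset: "cells t J \<subseteq> {cell (shift t) (r / 2 ^ j) m | j m. True}"
  by (auto simp: cells_def)

lemma cells_sets: "Q \<in> cells t J \<Longrightarrow> Q \<in> sets lebesgue"
  by (auto simp: cells_def)

lemma cell_weight:
  assumes "0 < d"
  shows "measure lebesgue (cell c d m :: (real ^ 'n) set) powr (- (1 / q + (1 - 1 / p))) = d powr (- \<beta>)"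
  unfolding measure_cell[OF assms]
  by (simp only: powr_realpow[OF assms, symmetric] powr_powr \<beta>_def mult_minus_right)

lemma kernel_mono: "J \<le> J' \<Longrightarrow> kernel J x y \<le> kernel J' x y"
  unfolding kernel_def
  by (intro add_right_mono sum_mono mult_left_mono sum_mono2 finite_cells)
    (auto simp: cells_def intro: less_le_trans)

lemma kernel_nonneg: "0 \<le> kernel J x y"
  unfolding kernel_def by (intro add_nonneg_nonneg sum_nonneg mult_nonneg_nonneg) auto

lemma kernel_dominates_far:
  assumes y: "y \<in> K" and cube: "y \<in> cube x r" and far: "r / 3 \<le> infnorm (x - y)"
  shows "norm (x - y) powr (- \<beta>) \<le> kernel J x y"
proof -
  define k where "k = cell_index 0 (r / 3) y"
  define m where "m = cell_index 0 (r / 3) x - k"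
  have kD: "k \<in> far_cells" using y by (simp add: far_cells_def k_def)
  have mo: "m \<in> offsets"
    unfolding offsets_def mem_Collect_eq
  proof
    fix i
    have "\<bar>x $ i - y $ i\<bar> \<le> r" using cube by (auto simp: cube_def mem_box_cart abs_le_iff dest: spec[of _ i])
    then have "\<bar>x $ i / (r / 3) - y $ i / (r / 3)\<bar> \<le> 3"
      using r by (simp add: diff_divide_distrib[symmetric] abs_divide pos_divide_le_eq)
    then show "\<bar>m $ i\<bar> \<le> 3" by (simp add: m_def k_def cell_index_def) linarith
  qed
  have "norm (x - y) powr (- \<beta>) \<le> (r / 3) powr (- \<beta>)"
    using far infnorm_le_norm[of "x - y"] r beta_pos by (intro powr_mono2') auto
  also have "\<dots> = (r / 3) powr (- \<beta>) * (indicator (cell 0 (r / 3) k) y * indicator (cell 0 (r / 3) (k + m)) x)"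
    by (simp add: mem_cell_iff k_def m_def)
  also have "\<dots> \<le> (r / 3) powr (- \<beta>) * (\<Sum>k\<in>far_cells. indicator (cell 0 (r / 3) k) y * indicator (cell 0 (r / 3) (k + m)) x)"
    using kD by (intro mult_left_mono member_le_sum finite_far_cells) auto
  also have "\<dots> \<le> (\<Sum>m\<in>offsets. (r / 3) powr (- \<beta>) * (\<Sum>k\<in>far_cells. indicator (cell 0 (r / 3) k) y * indicator (cell 0 (r / 3) (k + m)) x))"
    using mo by (intro member_le_sum finite_offsets mult_nonneg_nonneg sum_nonneg) auto
  also have "\<dots> \<le> kernel J x y"
    unfolding kernel_def by (simp add: sum_nonneg)
  finally show ?thesis .
qed

lemma kernel_dominates_near:
  assumes y: "y \<in> K" and ne: "x \<noteq> y" and near: "infnorm (x - y) < r / 3"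
  obtains J where "norm (x - y) powr (- \<beta>) \<le> kernel J x y"
proof -
  define d where "d = infnorm (x - y)"
  have d0: "0 < d" using ne by (simp add: d_def infnorm_pos_lt)
  obtain j where j: "r / 3 / 2 ^ Suc j \<le> d" "d < r / 3 / 2 ^ j"
    using dyadic_scale[of d "r / 3"] d0 near by (auto simp: d_def)
  have rj: "0 < r / 2 ^ j" using r by simp
  define u where "u z i = z $ i / (r / 2 ^ j)" for z :: "real ^ 'n" and i
  have uv: "\<bar>u x i - u y i\<bar> < 1 / 3" for i
  proof -
    have "\<bar>x $ i - y $ i\<bar> \<le> d" using component_le_infnorm_cart[of "x - y" i] by (simp add: d_def)
    then have "\<bar>x $ i - y $ i\<bar> < r / 2 ^ j / 3" using j by simp
    moreover have "\<bar>a / e - b / e\<bar> < 1 / 3" if "0 < e" "\<bar>a - b\<bar> < e / 3" for a b e :: real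
      using that by (simp add: diff_divide_distrib[symmetric] abs_divide pos_divide_less_eq)
    ultimately show ?thesis using rj unfolding u_def by blast
  qed
  \<comment> \<open>Shift exactly those coordinates in which a grid point of the unshifted grid separates the two points.\<close>
  define t :: "bool ^ 'n" where "t = (\<chi> i. \<lfloor>u x i\<rfloor> \<noteq> \<lfloor>u y i\<rfloor>)"
  define m where "m = cell_index (shift t) (r / 2 ^ j) y"
  have sh: "(z $ i - shift t $ i) / (r / 2 ^ j) = u z i - (if t $ i then 2 ^ j / 3 else 0)" for z i
    using r by (auto simp: shift_def u_def field_simps)
  have "cell_index (shift t) (r / 2 ^ j) x = m"
    unfolding m_def cell_index_def sh
  proof (simp add: vec_eq_iff, intro allI conjI impI)
    fix i
    show "\<lfloor>u x i\<rfloor> = \<lfloor>u y i\<rfloor>" if "\<not> t $ i" using that by (simp add: t_def)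
    show "\<lfloor>u x i - 2 ^ j / 3\<rfloor> = \<lfloor>u y i - 2 ^ j / 3\<rfloor>" if "t $ i"
      using third_shift[OF uv, of i j] that by (simp add: t_def)
  qed
  then have x: "x \<in> cell (shift t) (r / 2 ^ j) m" and y': "y \<in> cell (shift t) (r / 2 ^ j) m"
    by (simp_all add: mem_cell_iff m_def)
  let ?Q = "cell (shift t) (r / 2 ^ j) m"
  have Q: "?Q \<in> cells t (Suc j)" using y by (auto simp: cells_def m_def)
  have "norm (x - y) powr (- \<beta>) \<le> (r / 2 ^ j / 6) powr (- \<beta>)"
    using j(1) infnorm_le_norm[of "x - y"] r beta_pos unfolding d_def
    by (intro powr_mono2') auto
  also have "\<dots> = 6 powr \<beta> * (measure lebesgue ?Q powr (- (1 / q + (1 - 1 / p))) * indicator ?Q y * indicator ?Q x)"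
  proof -
    have "(e / 6) powr (- \<beta>) = 6 powr \<beta> * e powr (- \<beta>)" if "0 < e" for e :: real
      using that by (simp add: powr_divide powr_minus divide_simps)
    from this[OF rj] show ?thesis unfolding cell_weight[OF rj] using x y' by (simp only: indicator_simps mult_1_right)
  qed
  also have "\<dots> \<le> 6 powr \<beta> * (\<Sum>Q\<in>cells t (Suc j). measure lebesgue Q powr (- (1 / q + (1 - 1 / p))) * indicator Q y * indicator Q x)"
    using Q by (intro mult_left_mono member_le_sum[of ?Q] finite_cells) auto
  also have "\<dots> \<le> (\<Sum>t\<in>UNIV. 6 powr \<beta> * (\<Sum>Q\<in>cells t (Suc j). measure lebesgue Q powr (- (1 / q + (1 - 1 / p))) * indicator Q y * indicator Q x))"
    by (intro member_le_sum mult_nonneg_nonneg sum_nonneg) auto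
  also have "\<dots> \<le> kernel (Suc j) x y"
    unfolding kernel_def by (simp add: sum_nonneg)
  finally show ?thesis by (rule that)
qed

lemma integral_kernel:
  "integrable lebesgue (\<lambda>y. \<Phi> y * kernel J x y)" "(\<integral>y. \<Phi> y * kernel J x y \<partial>lebesgue) = total_op J x"
proof -
  have int: "integrable lebesgue (\<lambda>y. indicator Q y * \<Phi> y)" if "Q \<in> sets lebesgue" for Q
    using integrable_mult_indicator[OF that \<Phi>_integrable] by simp
  define N1 where "N1 t Q y = 6 powr \<beta> * (measure lebesgue Q powr (- (1 / q + (1 - 1 / p))) * indicator Q x) * (indicator Q y * \<Phi> y)" for t :: "bool ^ 'n" and Q y
  define F1 where "F1 m k y = (r / 3) powr (- \<beta>) * indicator (cell 0 (r / 3) (k + m)) x * (indicator (cell 0 (r / 3) k) y * \<Phi> y)" for m k :: "int ^ 'n" and y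
  have eq: "\<Phi> y * kernel J x y = (\<Sum>t\<in>UNIV. \<Sum>Q\<in>cells t J. N1 t Q y) + (\<Sum>m\<in>offsets. \<Sum>k\<in>far_cells. F1 m k y)" for y
    by (simp add: kernel_def N1_def F1_def sum_distrib_left distrib_left mult_ac)
  have i: "integrable lebesgue (N1 t Q)" if "Q \<in> cells t J" for t Q
    unfolding N1_def[abs_def] using cells_sets[OF that] by (intro integrable_mult_right int)
  have i': "integrable lebesgue (F1 m k)" for m k
    unfolding F1_def[abs_def] by (intro integrable_mult_right int) auto
  show "integrable lebesgue (\<lambda>y. \<Phi> y * kernel J x y)"
    unfolding eq by (intro Bochner_Integration.integrable_add Bochner_Integration.integrable_sum i i')
  have "(\<integral>y. \<Phi> y * kernel J x y \<partial>lebesgue)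
    = (\<Sum>t\<in>UNIV. \<Sum>Q\<in>cells t J. \<integral>y. N1 t Q y \<partial>lebesgue) + (\<Sum>m\<in>offsets. \<Sum>k\<in>far_cells. \<integral>y. F1 m k y \<partial>lebesgue)"
    unfolding eq using i i'
    by (simp add: Bochner_Integration.integral_add Bochner_Integration.integral_sum Bochner_Integration.integrable_sum)
  also have "\<dots> = total_op J x"
  proof -
    have "(\<integral>y. N1 t Q y \<partial>lebesgue) = 6 powr \<beta> * (measure lebesgue Q powr (- (1 / q + (1 - 1 / p))) * indicator Q x) * (LINT y:Q|lebesgue. \<Phi> y)" for t Q
      by (simp add: N1_def set_lebesgue_integral_def)
    moreover have "(\<integral>y. F1 m k y \<partial>lebesgue) = (r / 3) powr (- \<beta>) * indicator (cell 0 (r / 3) (k + m)) x * (LINT y:cell 0 (r / 3) k|lebesgue. \<Phi> y)" for m k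
      by (simp add: F1_def set_lebesgue_integral_def)
    ultimately show ?thesis
      by (simp add: total_op_def near_op_def far_op_def sum_distrib_left mult_ac)
  qed
  finally show "(\<integral>y. \<Phi> y * kernel J x y \<partial>lebesgue) = total_op J x" .
qed

lemma frac_int_le_SUP:
  "(\<integral>\<^sup>+y\<in>cube x r. ennreal (\<Phi> y * norm (x - y) powr (- \<beta>)) \<partial>lebesgue) \<le> (SUP J. ennreal (total_op J x))"
proof -
  have "(\<integral>\<^sup>+y\<in>cube x r. ennreal (\<Phi> y * norm (x - y) powr (- \<beta>)) \<partial>lebesgue)
    \<le> (\<integral>\<^sup>+y. (SUP J. ennreal (\<Phi> y * kernel J x y)) \<partial>lebesgue)"
  proof (rule nn_integral_mono)
    fix y
    show "ennreal (\<Phi> y * norm (x - y) powr (- \<beta>)) * indicator (cube x r) y \<le> (SUP J. ennreal (\<Phi> y * kernel J x y))"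
    proof (cases "y \<in> cube x r \<and> y \<in> K \<and> x \<noteq> y")
      case True
      obtain J where "norm (x - y) powr (- \<beta>) \<le> kernel J x y"
        using kernel_dominates_far[of y x] kernel_dominates_near[of y x] True
        by (cases "r / 3 \<le> infnorm (x - y)") (auto simp: not_le)
      then have "ennreal (\<Phi> y * norm (x - y) powr (- \<beta>)) \<le> ennreal (\<Phi> y * kernel J x y)"
        using \<Phi> by (intro ennreal_leI mult_left_mono)
      then show ?thesis using True by (intro SUP_upper2[of J]) auto
    next
      case False
      then have "ennreal (\<Phi> y * norm (x - y) powr (- \<beta>)) * indicator (cube x r) y = 0"
        using \<Phi>(4)[of y] by (auto simp: indicator_def)
      then show ?thesis by (simp only: zero_le)
    qed
  qed
  also have "\<dots> = (SUP J. \<integral>\<^sup>+y. ennreal (\<Phi> y * kernel J x y) \<partial>lebesgue)"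
  proof (rule nn_integral_monotone_convergence_SUP)
    show "incseq (\<lambda>J y. ennreal (\<Phi> y * kernel J x y))"
      using \<Phi> by (auto simp: incseq_def le_fun_def intro!: ennreal_leI mult_left_mono kernel_mono)
    show "(\<lambda>y. ennreal (\<Phi> y * kernel J x y)) \<in> borel_measurable lebesgue" for J
      using integral_kernel(1)[of J x] by measurable
  qed
  also have "\<dots> = (SUP J. ennreal (total_op J x))"
    using \<Phi> by (intro SUP_cong refl) (simp add: nn_integral_eq_integral integral_kernel kernel_nonneg)
  finally show ?thesis .
qed

lemma total_op_nonneg: "0 \<le> total_op J x"
  unfolding integral_kernel(2)[symmetric] using \<Phi> kernel_nonneg
  by (intro integral_nonneg_AE AE_I2) auto

lemma total_op_mono: "J \<le> J' \<Longrightarrow> total_op J x \<le> total_op J' x"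
  unfolding integral_kernel(2)[symmetric] using \<Phi>
  by (intro integral_mono integral_kernel mult_left_mono kernel_mono) auto

lemma near_op_measurable [measurable]: "near_op t J \<in> borel_measurable lebesgue"
proof -
  have [measurable]: "Q \<in> cells t J \<Longrightarrow> Q \<in> sets lebesgue" for Q by (rule cells_sets)
  show ?thesis unfolding near_op_def[abs_def] by measurable
qed

lemma far_op_measurable [measurable]: "far_op m \<in> borel_measurable lebesgue"
  unfolding far_op_def[abs_def] by measurable

lemma total_op_measurable [measurable]: "total_op J \<in> borel_measurable lebesgue"
  unfolding total_op_def[abs_def] by measurable

lemma op_nonneg: "0 \<le> near_op t J x" "0 \<le> far_op m x"
proof -
  have "0 \<le> (LINT y:Q|lebesgue. \<Phi> y)" for Q
    unfolding set_lebesgue_integral_def using \<Phi> by (intro integral_nonneg_AE AE_I2) auto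
  then show "0 \<le> near_op t J x" "0 \<le> far_op m x"
    unfolding near_op_def far_op_def by (auto intro!: sum_nonneg mult_nonneg_nonneg)
qed

lemma bilinear_const_nonneg: "0 < bilinear_const p q"
proof -
  \<comment> \<open>The constant does not depend on the family, so positivity may be read off the empty one.\<close>
  interpret W: weighted_laminar "{}" lebesgue U V p q s by (rule weighted_laminar_cells) auto
  show ?thesis by (rule W.bilinear_const_pos)
qed

lemma sharp_exp_eq: "sharp_exp p q = (1 / q + (1 - 1 / p)) * max 1 (conj_exp p / q)"
  and sharp_exp_ge: "2 / q \<le> sharp_exp p q"
proof -
  define a b where "a = 1 / q" and "b = 1 - 1 / p"
  have ab: "0 < a" "0 < b" using p q1 by (auto simp: a_def b_def)
  have e: "p / (q * q * (p - 1)) = a * a / b" "conj_exp p / q = a / b"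
    using p q1 by (auto simp: a_def b_def conj_exp_def field_simps)
  have "a + max b (a * a / b) = (a + b) * max 1 (a / b)"
  proof (cases "a \<le> b")
    case True
    then have "a * a \<le> b * b" using ab by (intro mult_mono) auto
    then have "a * a / b \<le> b" "a / b \<le> 1" using True ab by (simp_all add: pos_divide_le_eq)
    then show ?thesis by (simp add: max_absorb1)
  next
    case False
    then have "b * b < a * a" using ab by (intro mult_strict_mono) auto
    then show ?thesis using False ab by (simp add: max_def pos_le_divide_eq field_simps)
  qed
  then show "sharp_exp p q = (1 / q + (1 - 1 / p)) * max 1 (conj_exp p / q)"
    unfolding sharp_exp_def e a_def[symmetric] b_def[symmetric] .
  have "a \<le> max b (a * a / b)"
  proof (cases "a \<le> b")
    case False
    then have "a * b \<le> a * a" using ab by simp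
    then have "a \<le> a * a / b" using ab by (simp add: pos_le_divide_eq)
    then show ?thesis by simp
  qed simp
  then show "2 / q \<le> sharp_exp p q"
    unfolding sharp_exp_def e b_def[symmetric] by (simp add: a_def)
qed

text \<open>It depends on the dimension, \<open>p\<close> and \<open>q\<close> only, not on \<open>r\<close> or the weight.\<close>
definition op_const :: real where
  "op_const = real (card (UNIV <+> offsets :: (bool ^ 'n + int ^ 'n) set)) ^ 2 * (6 powr \<beta> * bilinear_const p q + 9 powr \<beta>)"

lemma total_op_bound:
  "(\<integral>\<^sup>+x. ennreal (total_op J x powr q) \<partial>V) \<le> ennreal ((op_const * A powr sharp_exp p q * N powr (1 / p)) powr q)"
proof -
  let ?I = "UNIV <+> offsets :: (bool ^ 'n + int ^ 'n) set"
  define h where "h i x = (case i of Inl t \<Rightarrow> 6 powr \<beta> * near_op t J x | Inr m \<Rightarrow> (r / 3) powr (- \<beta>) * far_op m x)" for i x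
  define X where "X = (6 powr \<beta> * bilinear_const p q + 9 powr \<beta>) * (A powr sharp_exp p q * N powr (1 / p))"
  have X0: "0 \<le> X" using bilinear_const_nonneg by (simp add: X_def)
  have fin: "finite ?I" using finite_offsets by (intro finite_Plus) auto
  have total: "total_op J x = (\<Sum>i\<in>?I. h i x)" for x
    using finite_offsets by (simp add: total_op_def sum.Plus h_def)
  have qb: "real CARD('n) * (1 + s) = \<beta> * q"
    using p q1 by (simp add: \<beta>_def s_def field_simps)
  have scale: "(\<integral>\<^sup>+x. ennreal ((c * g x) powr q) \<partial>V) = ennreal (c powr q) * (\<integral>\<^sup>+x. ennreal (g x powr q) \<partial>V)"
    if "0 \<le> c" "\<And>x. 0 \<le> g x" "g \<in> borel_measurable lebesgue" for c g
    using that by (subst nn_integral_cmult[symmetric]) (auto simp: V_def powr_mult ennreal_mult')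
  have near: "(\<integral>\<^sup>+x. ennreal (h (Inl t) x powr q) \<partial>V) \<le> ennreal (X powr q)" for t
  proof -
    have "(\<integral>\<^sup>+x. ennreal (h (Inl t) x powr q) \<partial>V) = ennreal ((6 powr \<beta>) powr q) * (\<integral>\<^sup>+x. ennreal (near_op t J x powr q) \<partial>V)"
      unfolding h_def sum.case by (rule scale) (auto simp: op_nonneg)
    also have "\<dots> \<le> ennreal ((6 powr \<beta>) powr q) * ennreal ((bilinear_const p q * A powr sharp_exp p q * N powr (1 / p)) powr q)"
      unfolding near_op_def by (intro mult_left_mono dyadic_bound[OF finite_cells cells_subset]) auto
    also have "\<dots> = ennreal ((6 powr \<beta> * (bilinear_const p q * A powr sharp_exp p q * N powr (1 / p))) powr q)"
      using bilinear_const_nonneg by (simp add: ennreal_mult'[symmetric] powr_mult)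
    also have "\<dots> \<le> ennreal (X powr q)"
      using q1 bilinear_const_nonneg by (intro ennreal_leI powr_mono2) (auto simp: X_def algebra_simps)
    finally show ?thesis .
  qed
  have far: "(\<integral>\<^sup>+x. ennreal (h (Inr m) x powr q) \<partial>V) \<le> ennreal (X powr q)" if m: "m \<in> offsets" for m
  proof -
    have "(\<integral>\<^sup>+x. ennreal (h (Inr m) x powr q) \<partial>V) = ennreal (((r / 3) powr (- \<beta>)) powr q) * (\<integral>\<^sup>+x. ennreal (far_op m x powr q) \<partial>V)"
      unfolding h_def sum.case by (rule scale) (auto simp: op_nonneg)
    also have "\<dots> \<le> ennreal (((r / 3) powr (- \<beta>)) powr q) *
       ennreal (A ^ 2 * (3 ^ CARD('n)) powr (1 + s) * (r ^ CARD('n)) powr (1 + s) * N powr (q / p))"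
      unfolding far_op_def using m by (intro mult_left_mono far_bound finite_far_cells) (auto simp: offsets_def)
    also have "\<dots> = ennreal ((9 powr \<beta> * (A powr (2 / q) * N powr (1 / p))) powr q)"
    proof -
      have n: "(c ^ CARD('n)) powr (1 + s) = c powr (\<beta> * q)" if "0 < c" for c :: real
        using that by (simp add: powr_realpow[symmetric] powr_powr qb)
      have A2: "A ^ 2 = (A powr (2 / q)) powr q" using A_ge_1 q1 by (simp add: powr_powr)
      have Nq: "N powr (q / p) = (N powr (1 / p)) powr q" by (simp add: powr_powr)
      have rearrange: "x * (a * y * z * b) = c * (a * b)" if "x * (y * z) = c" for x y z a b c :: real
        unfolding that[symmetric] by (simp only: mult_ac)
      have nine: "(9::real) powr \<beta> = 3 powr \<beta> * 3 powr \<beta>" by (simp flip: powr_mult)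
      have "((r / 3) powr (- \<beta>)) powr q * (3 powr (\<beta> * q) * r powr (\<beta> * q)) = (9 powr \<beta>) powr q"
      proof -
        have "((r / 3) powr (- \<beta>)) powr q * r powr (\<beta> * q) = 3 powr (\<beta> * q)"
          using r by (simp add: powr_powr powr_divide powr_minus divide_simps)
        then show ?thesis unfolding nine by (simp add: powr_mult powr_powr mult_ac)
      qed
      then have "((r / 3) powr (- \<beta>)) powr q * (A ^ 2 * (3 ^ CARD('n)) powr (1 + s) * (r ^ CARD('n)) powr (1 + s) * N powr (q / p))
        = (9 powr \<beta>) powr q * ((A powr (2 / q)) powr q * (N powr (1 / p)) powr q)"
        unfolding n[OF r] n[of 3, simplified] A2 Nq
        by (rule rearrange)
      then show ?thesis using A_ge_1 by (simp add: ennreal_mult'[symmetric] powr_mult)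
    qed
    also have "\<dots> \<le> ennreal (X powr q)"
    proof (intro ennreal_leI powr_mono2)
      have "9 powr \<beta> * (A powr (2 / q) * N powr (1 / p)) \<le> 9 powr \<beta> * (A powr sharp_exp p q * N powr (1 / p))"
        using A_ge_1 sharp_exp_ge by (intro mult_left_mono mult_right_mono powr_mono) auto
      also have "\<dots> \<le> X" using bilinear_const_nonneg by (simp add: X_def distrib_right)
      finally show "9 powr \<beta> * (A powr (2 / q) * N powr (1 / p)) \<le> X" .
    qed (use q1 in auto)
    finally show ?thesis .
  qed
  have "(\<integral>\<^sup>+x. ennreal ((\<Sum>i\<in>?I. h i x) powr q) \<partial>V) \<le> ennreal ((real (card ?I) * real (card ?I) * X) powr q)"
  proof (rule nn_integral_sum_powr_le[OF fin])
    show "h i \<in> borel_measurable V" if "i \<in> ?I" for i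
      by (cases i) (simp_all add: h_def[abs_def] V_def)
    show "0 \<le> h i x" for i x by (cases i) (simp_all add: h_def op_nonneg)
    show "(\<integral>\<^sup>+x. ennreal (h i x powr q) \<partial>V) \<le> ennreal (X powr q)" if "i \<in> ?I" for i
      using that near far by auto
  qed (use q1 X0 in auto)
  then show ?thesis unfolding total[symmetric] by (simp add: op_const_def X_def power2_eq_square mult_ac)
qed

text \<open>By monotone convergence in \<open>J\<close>. The function \<open>T\<close> is not assumed to be measurable.\<close>
lemma frac_int_bound:
  assumes T: "\<And>x. 0 \<le> T x" "\<And>x. ennreal (T x) \<le> (\<integral>\<^sup>+y\<in>cube x r. ennreal (\<Phi> y * norm (x - y) powr (- \<beta>)) \<partial>lebesgue)"
  shows "(\<integral>\<^sup>+x. ennreal (T x powr q * w x) \<partial>lebesgue) \<le> ennreal ((op_const * A powr sharp_exp p q * N powr (1 / p)) powr q)"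
proof -
  have q0: "0 < q" using q1 by simp
  have "(\<integral>\<^sup>+x. ennreal (T x powr q * w x) \<partial>lebesgue) \<le> (\<integral>\<^sup>+x. (SUP J. ennreal (w x) * ennreal (total_op J x powr q)) \<partial>lebesgue)"
  proof (rule nn_integral_mono)
    fix x
    have "ennreal (T x powr q) \<le> (SUP J. ennreal (total_op J x powr q))"
      using T frac_int_le_SUP[of x] total_op_nonneg q0 by (intro ennreal_powr_le_SUP) (auto intro: order_trans)
    then have "ennreal (w x) * ennreal (T x powr q) \<le> ennreal (w x) * (SUP J. ennreal (total_op J x powr q))"
      by (intro mult_left_mono) auto
    then show "ennreal (T x powr q * w x) \<le> (SUP J. ennreal (w x) * ennreal (total_op J x powr q))"
      by (simp add: SUP_mult_left_ennreal ennreal_mult' mult.commute w_nonneg)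
  qed
  also have "\<dots> = (SUP J. \<integral>\<^sup>+x. ennreal (w x) * ennreal (total_op J x powr q) \<partial>lebesgue)"
  proof (rule nn_integral_monotone_convergence_SUP)
    show "incseq (\<lambda>J x. ennreal (w x) * ennreal (total_op J x powr q))"
      using q0 by (auto simp: incseq_def le_fun_def intro!: mult_left_mono ennreal_leI powr_mono2 total_op_mono total_op_nonneg)
  qed measurable
  also have "\<dots> = (SUP J. \<integral>\<^sup>+x. ennreal (total_op J x powr q) \<partial>V)"
    unfolding V_def by (subst nn_integral_density) auto
  also have "\<dots> \<le> ennreal ((op_const * A powr sharp_exp p q * N powr (1 / p)) powr q)"
    by (intro SUP_least total_op_bound)
  finally show ?thesis .
qed

end

section \<open>The sharp bound\<close>

lemma epowr_le:
  assumes "0 < q" "0 \<le> c" "X \<le> ennreal (c powr q)"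
  shows "epowr X (1 / q) \<le> ennreal c"
proof -
  have X: "X \<noteq> top" using assms(3) by (auto simp: top_unique)
  have "enn2real X \<le> c powr q"
    using enn2real_mono[OF assms(3)] by simp
  then have "enn2real X powr (1 / q) \<le> (c powr q) powr (1 / q)"
    using assms by (intro powr_mono2) auto
  then show ?thesis using X assms by (simp add: epowr_def powr_powr ennreal_leI)
qed

theorem corollary4p9:
  fixes \<alpha> p q :: real
  assumes "0 < \<alpha>" and "\<alpha> < real CARD('n::finite)"
    and "1 < p" and "p < real CARD('n) / \<alpha>"
    and "1 < q"
    and "1 / q = 1 / p - \<alpha> / real CARD('n)"
  shows "\<exists>C::real. 0 < C \<and>
    (\<forall>r::real. 0 < r \<longrightarrow> (\<forall>w :: real ^ 'n \<Rightarrow> real. w \<in> Aloc p q r \<longrightarrow>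
      op_norm p (\<lambda>x. w x powr (p / q)) q w (local_frac_int \<alpha> r)
        \<le> ennreal C * epowr (Aloc_const p q r w)
              ((1 - \<alpha> / real CARD('n)) * max 1 (conj_exp p / q))))"
proof -
  let ?n = "real CARD('n)"
  define C0 where "C0 = real (card (UNIV <+> {m :: int ^ 'n. \<forall>i. \<bar>m $ i\<bar> \<le> 3} :: (bool ^ 'n + int ^ 'n) set)) ^ 2 *
    (6 powr (?n * (1 / q + (1 - 1 / p))) * bilinear_const p q + 9 powr (?n * (1 / q + (1 - 1 / p))))"
  have pq: "p < q"
  proof -
    have "1 / q < 1 / p" using assms by simp
    moreover have "1 / p \<le> 1 / q" if "q \<le> p" using that assms by (intro divide_left_mono) auto
    ultimately show ?thesis by linarith
  qed
  have "1 - \<alpha> / ?n = 1 / q + (1 - 1 / p)" using assms by simp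
  moreover have "?n - \<alpha> = ?n * (1 - \<alpha> / ?n)" by (simp add: right_diff_distrib)
  ultimately have exps: "1 - \<alpha> / ?n = 1 / q + (1 - 1 / p)" "?n - \<alpha> = ?n * (1 / q + (1 - 1 / p))"
    by simp_all
  have "op_norm p (\<lambda>x. w x powr (p / q)) q w (local_frac_int \<alpha> r)
        \<le> ennreal (max 1 C0) * epowr (Aloc_const p q r w) ((1 - \<alpha> / ?n) * max 1 (conj_exp p / q))"
    if r: "0 < r" and w: "w \<in> Aloc p q r" for r and w :: "real ^ 'n \<Rightarrow> real"
  proof -
    interpret local_weight p q r w
      using assms pq r w by unfold_locales auto
    define e where "e = (1 - \<alpha> / ?n) * max 1 (conj_exp p / q)"
    have A: "epowr (Aloc_const p q r w) e = ennreal (A powr e)"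
      using w by (auto simp: epowr_def A_def Aloc_def)
    have "weighted_Lnorm q w (local_frac_int \<alpha> r g)
        \<le> ennreal (max 1 C0) * epowr (Aloc_const p q r w) e * weighted_Lnorm p (\<lambda>x. w x powr (p / q)) g"
      if g: "g \<in> bounded_compact_support" for g
    proof -
      obtain M where M: "\<And>x. norm (g x) \<le> M"
        using g by (auto simp: bounded_compact_support_def bounded_iff)
      have [measurable]: "g \<in> borel_measurable lebesgue"
        using g by (simp add: bounded_compact_support_def)
      interpret F: local_weight_function p q r w "\<lambda>x. norm (g x)" M "closure {x. g x \<noteq> 0}"
      proof unfold_locales
        show "norm (g x) = 0" if "x \<notin> closure {x. g x \<noteq> 0}" for x
          using that closure_subset[of "{x. g x \<noteq> 0}"] by auto
      qed (use M g in \<open>auto simp: bounded_compact_support_def\<close>)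
      have \<beta>: "F.\<beta> = ?n - \<alpha>" by (simp only: F.\<beta>_def exps)
      have e: "e = sharp_exp p q" unfolding e_def exps(1) F.sharp_exp_eq ..
      have C0: "F.op_const = C0" by (simp add: F.op_const_def C0_def F.offsets_def F.\<beta>_def)
      have C00: "0 \<le> C0" using F.bilinear_const_nonneg by (simp add: C0_def)
      have T: "ennreal (norm (local_frac_int \<alpha> r g x))
        \<le> (\<integral>\<^sup>+y\<in>cube x r. ennreal (norm (g y) * norm (x - y) powr (- F.\<beta>)) \<partial>lebesgue)" for x
      proof -
        let ?h = "\<lambda>y. indicator (cube x r) y *\<^sub>R (g y /\<^sub>R (norm (x - y) powr (?n - \<alpha>)))"
        have "ennreal (norm (local_frac_int \<alpha> r g x)) \<le> (\<integral>\<^sup>+y. ennreal (norm (?h y)) \<partial>lebesgue)"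
        proof (cases "integrable lebesgue ?h")
          case True
          then show ?thesis
            unfolding local_frac_int_def set_lebesgue_integral_def by (rule integral_norm_bound_ennreal)
        next
          case False
          then show ?thesis
            unfolding local_frac_int_def set_lebesgue_integral_def by (simp add: not_integrable_integral_eq)
        qed
        also have "\<dots> = (\<integral>\<^sup>+y\<in>cube x r. ennreal (norm (g y) * norm (x - y) powr (- F.\<beta>)) \<partial>lebesgue)"
          unfolding \<beta> powr_minus
          by (intro nn_integral_cong) (auto simp: indicator_def mult.commute)
        finally show ?thesis .
      qed
      have N: "weighted_Lnorm p (\<lambda>x. w x powr (p / q)) g = ennreal (F.N powr (1 / p))"
        unfolding weighted_Lnorm_def F.N_def
        using F.integrable_N by (subst nn_integral_eq_integral) (auto simp: epowr_def)
      have "weighted_Lnorm q w (local_frac_int \<alpha> r g) \<le> ennreal (C0 * A powr e * F.N powr (1 / p))"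
        unfolding weighted_Lnorm_def
      proof (rule epowr_le)
        show "(\<integral>\<^sup>+x. ennreal (norm (local_frac_int \<alpha> r g x) powr q * w x) \<partial>lebesgue)
            \<le> ennreal ((C0 * A powr e * F.N powr (1 / p)) powr q)"
          using F.frac_int_bound[of "\<lambda>x. norm (local_frac_int \<alpha> r g x)"] T unfolding C0 e by simp
      qed (use assms C00 in auto)
      also have "\<dots> \<le> ennreal (max 1 C0 * A powr e * F.N powr (1 / p))"
        by (intro ennreal_leI mult_right_mono) auto
      also have "\<dots> = ennreal (max 1 C0) * epowr (Aloc_const p q r w) e * weighted_Lnorm p (\<lambda>x. w x powr (p / q)) g"
        unfolding A N by (simp add: ennreal_mult')
      finally show ?thesis .
    qed
    then show ?thesis
      unfolding op_norm_def e_def by (intro Inf_lower) simp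
  qed
  then show ?thesis by (intro exI[of _ "max 1 C0"]) auto
qed

end
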